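(* Suppose that Assumption A (stated in the context) holds, and let $(\widehat{\Delta z},\widehat{\Delta\lambda},\widehat{\Delta s})$ be the step calculated in the finite-precision environment described in the context by using the procedure condensed. Let $\hat\alpha_{\max}\in[0,1]$ be the maximum step length in $[0,1]$ that can be taken along this direction without violating the nonnegativity conditions on $\lambda$ and $s$, that is, the largest $\hat\alpha\in[0,1]$ such that $(\lambda,s)+\alpha(\widehat{\Delta\lambda},\widehat{\Delta s})\ge0$ for all $\alpha\in[0,\hat\alpha]$. Then $$1-\hat\alpha_{\max}=\delta_{\mathbf u}/\mu+O(\mu),$$ and for all $\alpha\in[0,1]$, $$(\lambda_i+\alpha\widehat{\Delta\lambda}_i)(s_i+\alpha\widehat{\Delta s}_i)=(1-\alpha)\lambda_is_i+\delta_{\mathbf u}+O(\mu^2),\quad i=1,\dots,m,$$ $$\mu(\lambda+\alpha\widehat{\Delta\lambda},s+\alpha\widehat{\Delta s})=(1-\alpha)\mu+\delta_{\mathbf u}+O(\mu^2),$$ $$r_f(z+\alpha\widehat{\Delta z},\lambda+\alpha\widehat{\Delta\lambda})=(1-\alpha)r_f(z,\lambda)+\delta_{\mathbf u}+O(\mu^2),$$ $$r_g(z+\alpha\widehat{\Delta z},s+\alpha\widehat{\Delta s})=(1-\alpha)r_g(z,s)+\delta_{\mathbf u}+O(\mu^2).$$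
   Context: (NLP) is $\min_z\phi(z)$ subject to $g(z)\le0$, where $\phi:\mathbb{R}^n\to\mathbb{R}$ and $g:\mathbb{R}^n\to\mathbb{R}^m$ are twice Lipschitz continuously differentiable. $\mathcal{L}(z,\lambda)=\phi(z)+\lambda^Tg(z)$; $\mathcal{L}_z$, $\mathcal{L}_{zz}$ are its gradient and Hessian in $z$. $r_f(z,\lambda)=\mathcal{L}_z(z,\lambda)$, $r_g(z,s)=g(z)+s$, $\mu(\lambda,s)=\lambda^Ts/m$, and $\mu$ without arguments is evaluated at the current iterate. $\nabla g(z)=[\nabla g_1(z),\dots,\nabla g_m(z)]$. KKT conditions: $\mathcal{L}_z(z,\lambda)=0$, $g(z)\le0$, $\lambda\ge0$, $\lambda^Tg(z)=0$. $\mathcal{S}_\lambda$ is the set of $\lambda^*$ such that $(z^*,\lambda^* )$ satisfies the KKT conditions, $\mathcal{S}=\{z^*\}\times\mathcal{S}_\lambda$, $\delta(z,\lambda)$ is the Euclidean distance from $(z,\lambda)$ to $\mathcal{S}$. $\mathcal{B}=\{i:g_i(z^* )=0\}$, $\mathcal{N}=\{1,\dots,m\}\setminus\mathcal{B}$, $\mathcal{B}_+=\{i\in\mathcal{B}:\lambda_i^*>0\text{ for some }\lambda^*\in\mathcal{S}_\lambda\}$. Subscripts $\mathcal{B},\mathcal{N}$ denote subvectors/submatrices; $\nabla g_{\mathcal{B}}(z)$ has columns $\nabla g_i(z)$, $i\in\mathcal{B}$. $S=\mathrm{diag}(s)$, $\Lambda=\mathrm{diag}(\lambda)$, $D=\Lambda^{-1}S$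 (with diagonal blocks $D_{\mathcal{B}},D_{\mathcal{N}}$). SVD: $\nabla g_{\mathcal{B}}(z^* )=\begin{bmatrix}\hat U&\hat V\end{bmatrix}\begin{bmatrix}\Sigma&0\\ 0&0\end{bmatrix}\begin{bmatrix}U^T\\ V^T\end{bmatrix}=\hat U\Sigma U^T$ with $[\hat U\ \hat V]$, $[U\ V]$ orthogonal and $\Sigma$ diagonal with positive diagonal. $\sigma_{\min}$ denotes smallest eigenvalue. Assumption A. (a) $z^*$ is a solution of (NLP), so the KKT conditions hold ($\mathcal{S}_\lambda\neq\emptyset$). MFCQ: there is $\bar y$ with $\nabla g_{\mathcal{B}}(z^* )^T\bar y<0$. Second-order conditions: there is $\xi>0$ with $w^T\mathcal{L}_{zz}(z^*,\lambda^* )w\ge\xi\|w\|^2$ for all $\lambda^*\in\mathcal{S}_\lambda$ and all $w$ with $\nabla g_i(z^* )^Tw=0$ ($i\in\mathcal{B}_+$), $\nabla g_i(z^* )^Tw\le0$ ($i\in\mathcal{B}\setminus\mathcal{B}_+$). SC: some $\lambda^*\in\mathcal{S}_\lambda$ has $\lambda_i^*>0$ for all $i\in\mathcal{B}$. The current iterate $(z,\lambda,s)$ satisfies, with $\mu=\lambda^Ts/m$ and fixed constants $C>0$, $\gamma\in(0,1)$: $\|\mathcal{L}_z(z,\lambda)\|\le C\mu$, $\|g(z)+s\|\le C\mu$, $(\lambda,s)>0$, $\lambda_is_i\ge\gamma\mu$ for all $i$. The vector $t\in\mathbb{R}^m$ satisfies $t=O(\mu^2)$. (b) For a sufficiently large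 $\beta>0$: $\mathbf u/\mu\ll1$, $\mathbf u\ll1$, $\sigma_{\min}(\Sigma)\ge\beta\max(\mu^{1/3},\mathbf u/\mu)$, and $\sigma_{\min}(\hat V^T\mathcal{L}_{zz}(z^*,\lambda^* )\hat V)\ge\beta\max(\mu^{1/3},\mathbf u/\mu)$ for all $\lambda^*\in\mathcal{S}_\lambda$. Procedure condensed: given $(z,\lambda,s)$, form and solve $[\mathcal{L}_{zz}(z,\lambda)+\nabla g(z)D^{-1}\nabla g(z)^T]\Delta z=-\mathcal{L}_z(z,\lambda)-\nabla g(z)D^{-1}[g(z)-\Lambda^{-1}t]$ by a backward stable algorithm; then set $\Delta\lambda=D^{-1}[g(z)-\Lambda^{-1}t+\nabla g(z)^T\Delta z]$; then set $\Delta s=-(g(z)+s)-\nabla g(z)^T\Delta z$. Finite-precision environment: $z,\lambda,s,t$ are floating-point vectors. $\mathbf u$ is the unit roundoff: for floating-point numbers $x,y$ and $\mathrm{op}\in\{+,-,\times,/\}$, $fl(x\,\mathrm{op}\,y)=(x\,\mathrm{op}\,y)(1+\epsilon)$ with $|\epsilon|\le\mathbf u$. The computed values of $\mathcal{L}_{zz}(z,\lambda)$, $\mathcal{L}_z(z,\lambda)$, $\nabla g(z)$, $g(z)$ are $\mathcal{L}_{zz}(z,\lambda)+\bar F$, $\mathcal{L}_z(z,\lambda)+\bar f$, $\nabla g(z)+F$, $g(z)+f$ with $\bar F,\bar f,F,f$ all of size $\delta_{\mathbf u}$. The computed $D^{-1}$ is $(D+G)^{-1}$ with $G$ diagonal,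 $G_{\mathcal{B}}=\mu\,\delta_{\mathbf u}$, $G_{\mathcal{N}}=\delta_{\mathbf u}/\mu$. Roundoff in forming the linear system from these computed quantities and in the backward stable solve is accounted for by a matrix $\hat F=\delta_{\mathbf u}/\mu$ and a vector $\hat f=\delta_{\mathbf u}$: $\widehat{\Delta z}$ is the exact solution of $$[\mathcal{L}_{zz}(z,\lambda)+\bar F+(\nabla g(z)+F)(D+G)^{-1}(\nabla g(z)+F)^T+\hat F]\widehat{\Delta z}=-\mathcal{L}_z(z,\lambda)-\bar f-(\nabla g(z)+F)(D+G)^{-1}[g(z)+f-\Lambda^{-1}t]+\hat f.$$ Then $\widehat{\Delta\lambda}$ and $\widehat{\Delta s}$ are obtained by carrying out the last two assignments of the procedure in floating-point arithmetic (each operation obeying the model above), using $\widehat{\Delta z}$ and the computed values of $g(z)$, $\nabla g(z)$, $D^{-1}$. Conventions: $O(\epsilon)$ means norm at most a constant times $\epsilon$; $\delta_{\mathbf u}$ denotes any quantity of norm at most a constant times $\mathbf u$. Precisely: for fixed problem, $z^*$, $C,\gamma$ and every choice of the constants implicit in the hypotheses, there exist $\epsilon,\eta,\beta_0,K'>0$ depending only on these such that, whenever the hypotheses hold with $\delta(z,\lambda)\le\epsilon$, $\mu\le\epsilon$, $\mathbf u/\mu\le\eta$, $\mathbf u\le\eta$, $\beta\ge\beta_0$, the conclusions hold with all implied constants equal to $K'$ (uniformly in $\alpha$). *)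

theory Defs
  imports "HOL-Analysis.Analysis"
begin

definition gradient :: "(real^'n \<Rightarrow> real) \<Rightarrow> real^'n \<Rightarrow> real^'n" where
  "gradient f z = (THE D. GDERIV f z :> D)"

definition hessian :: "(real^'n \<Rightarrow> real) \<Rightarrow> real^'n \<Rightarrow> real^'n^'n" where
  "hessian f z = matrix (frechet_derivative (gradient f) (at z))"

text \<open>The Lipschitz condition on the second derivative is only required locally, so that globally
  Lipschitz Hessians are a special case.\<close>

definition twice_lipschitz_differentiable :: "(real^'n \<Rightarrow> real) \<Rightarrow> bool" where
  "twice_lipschitz_differentiable f \<longleftrightarrow>
     (\<forall>z. f differentiable (at z)) \<and>
     (\<forall>z. gradient f differentiable (at z)) \<and>
     (\<forall>z. \<exists>e>0. \<exists>L. L-lipschitz_on (ball z e) (hessian f))"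

definition lagrangian ::
  "(real^'n \<Rightarrow> real) \<Rightarrow> (real^'n \<Rightarrow> real^'m) \<Rightarrow> real^'n \<Rightarrow> real^'m \<Rightarrow> real" where
  "lagrangian \<phi> g z l = \<phi> z + l \<bullet> g z"

definition Lz ::
  "(real^'n \<Rightarrow> real) \<Rightarrow> (real^'n \<Rightarrow> real^'m) \<Rightarrow> real^'n \<Rightarrow> real^'m \<Rightarrow> real^'n" where
  "Lz \<phi> g z l = gradient (\<lambda>y. lagrangian \<phi> g y l) z"

definition Lzz ::
  "(real^'n \<Rightarrow> real) \<Rightarrow> (real^'n \<Rightarrow> real^'m) \<Rightarrow> real^'n \<Rightarrow> real^'m \<Rightarrow> real^'n^'n" where
  "Lzz \<phi> g z l = hessian (\<lambda>y. lagrangian \<phi> g y l) z"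

definition grad_g :: "(real^'n \<Rightarrow> real^'m) \<Rightarrow> real^'n \<Rightarrow> 'm \<Rightarrow> real^'n" where
  "grad_g g z i = gradient (\<lambda>y. g y $ i) z"

text \<open>The matrix whose \<open>i\<close>-th column is the gradient of \<open>g\<^sub>i\<close>, i.e.\ the transposed Jacobian.\<close>

definition nabla_g :: "(real^'n \<Rightarrow> real^'m) \<Rightarrow> real^'n \<Rightarrow> real^'m^'n" where
  "nabla_g g z = (\<chi> j i. grad_g g z i $ j)"

definition r_f ::
  "(real^'n \<Rightarrow> real) \<Rightarrow> (real^'n \<Rightarrow> real^'m) \<Rightarrow> real^'n \<Rightarrow> real^'m \<Rightarrow> real^'n" where
  "r_f \<phi> g z l = Lz \<phi> g z l"

definition r_g :: "(real^'n \<Rightarrow> real^'m) \<Rightarrow> real^'n \<Rightarrow> real^'m \<Rightarrow> real^'m" where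
  "r_g g z s = g z + s"

definition mu :: "real^'m \<Rightarrow> real^'m \<Rightarrow> real" where
  "mu l s = (l \<bullet> s) / real CARD('m)"

definition nlp_feasible :: "(real^'n \<Rightarrow> real^'m) \<Rightarrow> real^'n \<Rightarrow> bool" where
  "nlp_feasible g z \<longleftrightarrow> (\<forall>i. g z $ i \<le> 0)"

text \<open>Local solutions; global solutions are a special case.\<close>

definition nlp_solution ::
  "(real^'n \<Rightarrow> real) \<Rightarrow> (real^'n \<Rightarrow> real^'m) \<Rightarrow> real^'n \<Rightarrow> bool" where
  "nlp_solution \<phi> g zs \<longleftrightarrow>
     nlp_feasible g zs \<and> (\<exists>e>0. \<forall>z\<in>ball zs e. nlp_feasible g z \<longrightarrow> \<phi> zs \<le> \<phi> z)"

definition KKT ::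
  "(real^'n \<Rightarrow> real) \<Rightarrow> (real^'n \<Rightarrow> real^'m) \<Rightarrow> real^'n \<Rightarrow> real^'m \<Rightarrow> bool" where
  "KKT \<phi> g z l \<longleftrightarrow>
     Lz \<phi> g z l = 0 \<and> (\<forall>i. g z $ i \<le> 0) \<and> (\<forall>i. 0 \<le> l $ i) \<and> l \<bullet> g z = 0"

definition multipliers ::
  "(real^'n \<Rightarrow> real) \<Rightarrow> (real^'n \<Rightarrow> real^'m) \<Rightarrow> real^'n \<Rightarrow> (real^'m) set" where
  "multipliers \<phi> g zs = {l. KKT \<phi> g zs l}"

definition sol_dist ::
  "(real^'n \<Rightarrow> real) \<Rightarrow> (real^'n \<Rightarrow> real^'m) \<Rightarrow> real^'n \<Rightarrow> real^'n \<Rightarrow> real^'m \<Rightarrow> real" where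
  "sol_dist \<phi> g zs z l = infdist (z, l) ({zs} \<times> multipliers \<phi> g zs)"

definition active :: "(real^'n \<Rightarrow> real^'m) \<Rightarrow> real^'n \<Rightarrow> 'm set" where
  "active g zs = {i. g zs $ i = 0}"

definition active_pos ::
  "(real^'n \<Rightarrow> real) \<Rightarrow> (real^'n \<Rightarrow> real^'m) \<Rightarrow> real^'n \<Rightarrow> 'm set" where
  "active_pos \<phi> g zs = {i \<in> active g zs. \<exists>l\<in>multipliers \<phi> g zs. 0 < l $ i}"

definition MFCQ :: "(real^'n \<Rightarrow> real^'m) \<Rightarrow> real^'n \<Rightarrow> bool" where
  "MFCQ g zs \<longleftrightarrow> (\<exists>y. \<forall>i\<in>active g zs. grad_g g zs i \<bullet> y < 0)"

definition second_order_conditions ::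
  "(real^'n \<Rightarrow> real) \<Rightarrow> (real^'n \<Rightarrow> real^'m) \<Rightarrow> real^'n \<Rightarrow> bool" where
  "second_order_conditions \<phi> g zs \<longleftrightarrow>
     (\<exists>\<xi>>0. \<forall>l\<in>multipliers \<phi> g zs. \<forall>w.
        (\<forall>i\<in>active_pos \<phi> g zs. grad_g g zs i \<bullet> w = 0) \<and>
        (\<forall>i\<in>active g zs - active_pos \<phi> g zs. grad_g g zs i \<bullet> w \<le> 0)
        \<longrightarrow> \<xi> * (norm w)\<^sup>2 \<le> w \<bullet> (Lzz \<phi> g zs l *v w))"

definition strict_complementarity ::
  "(real^'n \<Rightarrow> real) \<Rightarrow> (real^'n \<Rightarrow> real^'m) \<Rightarrow> real^'n \<Rightarrow> bool" where
  "strict_complementarity \<phi> g zs \<longleftrightarrow>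
     (\<exists>l\<in>multipliers \<phi> g zs. \<forall>i\<in>active g zs. 0 < l $ i)"

definition solution_conditions ::
  "(real^'n \<Rightarrow> real) \<Rightarrow> (real^'n \<Rightarrow> real^'m) \<Rightarrow> real^'n \<Rightarrow> bool" where
  "solution_conditions \<phi> g zs \<longleftrightarrow>
     nlp_solution \<phi> g zs \<and> multipliers \<phi> g zs \<noteq> {} \<and> MFCQ g zs \<and>
     second_order_conditions \<phi> g zs \<and> strict_complementarity \<phi> g zs"

text \<open>\<open>Ct\<close> is the constant in \<open>t = O(\<mu>\<^sup>2)\<close>.\<close>

definition iterate_conditions ::
  "(real^'n \<Rightarrow> real) \<Rightarrow> (real^'n \<Rightarrow> real^'m) \<Rightarrow> real \<Rightarrow> real \<Rightarrow> real \<Rightarrow>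
   real^'n \<Rightarrow> real^'m \<Rightarrow> real^'m \<Rightarrow> real^'m \<Rightarrow> bool" where
  "iterate_conditions \<phi> g C \<gamma> Ct z l s t \<longleftrightarrow>
     norm (Lz \<phi> g z l) \<le> C * mu l s \<and>
     norm (g z + s) \<le> C * mu l s \<and>
     (\<forall>i. 0 < l $ i \<and> 0 < s $ i) \<and>
     (\<forall>i. \<gamma> * mu l s \<le> l $ i * s $ i) \<and>
     norm t \<le> Ct * (mu l s)\<^sup>2"

text \<open>The block sizes (number of active constraints, rank) depend on the problem, so these matrices
  are functions restricted to explicit index sets.\<close>

definition orthogonal_on :: "'i set \<Rightarrow> 'k set \<Rightarrow> ('i \<Rightarrow> 'k \<Rightarrow> real) \<Rightarrow> bool" where
  "orthogonal_on I K Q \<longleftrightarrow>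
     (\<forall>k\<in>K. \<forall>k'\<in>K. (\<Sum>i\<in>I. Q i k * Q i k') = (if k = k' then 1 else 0)) \<and>
     (\<forall>i\<in>I. \<forall>i'\<in>I. (\<Sum>k\<in>K. Q i k * Q i' k) = (if i = i' then 1 else 0))"

text \<open>\<open>Q\<close> is \<open>[\<hat>U \<hat>V]\<close> and \<open>P\<close> is \<open>[U V]\<close>; in both, the first \<open>r\<close> columns
  form the first block.\<close>

definition is_svd ::
  "(real^'n \<Rightarrow> real^'m) \<Rightarrow> real^'n \<Rightarrow> nat \<Rightarrow>
   ('n \<Rightarrow> nat \<Rightarrow> real) \<Rightarrow> (nat \<Rightarrow> nat \<Rightarrow> real) \<Rightarrow> ('m \<Rightarrow> nat \<Rightarrow> real) \<Rightarrow> bool" where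
  "is_svd g zs r Q \<Sigma> P \<longleftrightarrow>
     r \<le> CARD('n) \<and> r \<le> card (active g zs) \<and>
     orthogonal_on UNIV {..<CARD('n)} Q \<and>
     orthogonal_on (active g zs) {..<card (active g zs)} P \<and>
     (\<forall>k<r. \<forall>k'<r. k \<noteq> k' \<longrightarrow> \<Sigma> k k' = 0) \<and>
     (\<forall>k<r. 0 < \<Sigma> k k) \<and>
     (\<forall>j. \<forall>i\<in>active g zs.
        nabla_g g zs $ j $ i = (\<Sum>k<r. \<Sum>k'<r. Q j k * \<Sigma> k k' * P i k'))"

definition eigenvalues_on :: "'k set \<Rightarrow> ('k \<Rightarrow> 'k \<Rightarrow> real) \<Rightarrow> real set" where
  "eigenvalues_on K A =
     {\<kappa>. \<exists>v. (\<exists>k\<in>K. v k \<noteq> 0) \<and> (\<forall>k\<in>K. (\<Sum>k'\<in>K. A k k' * v k') = \<kappa> * v k)}"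

definition sigma_min :: "'k set \<Rightarrow> ('k \<Rightarrow> 'k \<Rightarrow> real) \<Rightarrow> real" where
  "sigma_min K A = Min (eigenvalues_on K A)"

definition congruence_transform ::
  "('n::finite \<Rightarrow> 'k \<Rightarrow> real) \<Rightarrow> real^'n^'n \<Rightarrow> 'k \<Rightarrow> 'k \<Rightarrow> real" where
  "congruence_transform Q H k k' = (\<Sum>i\<in>UNIV. \<Sum>j\<in>UNIV. Q i k * H $ i $ j * Q j k')"

text \<open>A condition on \<open>\<sigma>\<^sub>m\<^sub>i\<^sub>n\<close> of an empty (0 by 0) block is void.\<close>

definition conditioning ::
  "(real^'n \<Rightarrow> real) \<Rightarrow> (real^'n \<Rightarrow> real^'m) \<Rightarrow> real^'n \<Rightarrow> nat \<Rightarrow>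
   ('n \<Rightarrow> nat \<Rightarrow> real) \<Rightarrow> (nat \<Rightarrow> nat \<Rightarrow> real) \<Rightarrow> real \<Rightarrow> real \<Rightarrow> real \<Rightarrow> bool" where
  "conditioning \<phi> g zs r Q \<Sigma> \<beta> u m \<longleftrightarrow>
     ({..<r} \<noteq> {} \<longrightarrow> \<beta> * max (m powr (1/3)) (u / m) \<le> sigma_min {..<r} \<Sigma>) \<and>
     ({r..<CARD('n)} \<noteq> {} \<longrightarrow>
       (\<forall>l\<in>multipliers \<phi> g zs.
          \<beta> * max (m powr (1/3)) (u / m)
            \<le> sigma_min {r..<CARD('n)} (congruence_transform Q (Lzz \<phi> g zs l))))"

datatype fp_op = FAdd | FSub | FMul | FDiv

fun exact_op :: "fp_op \<Rightarrow> real \<Rightarrow> real \<Rightarrow> real" where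
  "exact_op FAdd x y = x + y"
| "exact_op FSub x y = x - y"
| "exact_op FMul x y = x * y"
| "exact_op FDiv x y = x / y"

text \<open>\<open>Fl\<close> is the set of floating-point numbers and \<open>fl\<close> the arithmetic on it, with unit roundoff
  \<open>u\<close>. Overflow and underflow are ignored, and sign changes are exact.\<close>

definition fp_model :: "real \<Rightarrow> real set \<Rightarrow> (fp_op \<Rightarrow> real \<Rightarrow> real \<Rightarrow> real) \<Rightarrow> bool" where
  "fp_model u Fl fl \<longleftrightarrow>
     (\<forall>x\<in>Fl. - x \<in> Fl) \<and>
     (\<forall>op. \<forall>x\<in>Fl. \<forall>y\<in>Fl. (op = FDiv \<longrightarrow> y \<noteq> 0) \<longrightarrow>
        fl op x y \<in> Fl \<and>
        (\<exists>\<epsilon>. \<bar>\<epsilon>\<bar> \<le> u \<and> fl op x y = exact_op op x y * (1 + \<epsilon>)))"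

text \<open>\<open>fp_sum fl x A v\<close>: adding up the numbers \<open>x i\<close>, \<open>i \<in> A\<close>, in floating-point arithmetic, in some
  order and with some bracketing, yields \<open>v\<close>.\<close>

inductive fp_sum :: "(fp_op \<Rightarrow> real \<Rightarrow> real \<Rightarrow> real) \<Rightarrow> ('i \<Rightarrow> real) \<Rightarrow> 'i set \<Rightarrow> real \<Rightarrow> bool"
  for fl x where
  single: "fp_sum fl x {i} (x i)"
| join: "fp_sum fl x A a \<Longrightarrow> fp_sum fl x B b \<Longrightarrow> A \<inter> B = {} \<Longrightarrow> fp_sum fl x (A \<union> B) (fl FAdd a b)"

definition fp_inner ::
  "(fp_op \<Rightarrow> real \<Rightarrow> real \<Rightarrow> real) \<Rightarrow> real^'n \<Rightarrow> real^'n \<Rightarrow> real \<Rightarrow> bool" where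
  "fp_inner fl x y v \<longleftrightarrow> fp_sum fl (\<lambda>j. fl FMul (x $ j) (y $ j)) UNIV v"

text \<open>Possible floating-point values of \<open>a - b + c\<close>.\<close>

definition fp_diff_plus :: "(fp_op \<Rightarrow> real \<Rightarrow> real \<Rightarrow> real) \<Rightarrow> real \<Rightarrow> real \<Rightarrow> real \<Rightarrow> real set" where
  "fp_diff_plus fl a b c =
     {fl FAdd (fl FSub a b) c, fl FSub (fl FAdd a c) b, fl FAdd a (fl FSub c b)}"

definition fp_vector :: "real set \<Rightarrow> real^'k \<Rightarrow> bool" where
  "fp_vector Fl x \<longleftrightarrow> (\<forall>i. x $ i \<in> Fl)"

definition diag_mat :: "real^'m \<Rightarrow> real^'m^'m" where
  "diag_mat d = (\<chi> i j. if i = j then d $ i else 0)"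

definition D_mat :: "real^'m \<Rightarrow> real^'m \<Rightarrow> real^'m^'m" where
  "D_mat l s = matrix_inv (diag_mat l) ** diag_mat s"

text \<open>The perturbations are bounded with a common constant \<open>K\<close> (all quantities of size
  \<open>\<delta>\<^sub>u\<close>, up to the stated powers of \<open>\<mu>\<close>).\<close>

definition perturbation_bounds ::
  "real \<Rightarrow> real \<Rightarrow> real \<Rightarrow> 'm set \<Rightarrow>
   real^'n^'n \<Rightarrow> real^'n \<Rightarrow> real^'m^'n \<Rightarrow> real^'m \<Rightarrow> real^'m^'m \<Rightarrow> real^'n^'n \<Rightarrow> real^'n \<Rightarrow> bool" where
  "perturbation_bounds K u m B Fbar fbar F f G Fhat fhat \<longleftrightarrow>
     norm Fbar \<le> K * u \<and> norm fbar \<le> K * u \<and> norm F \<le> K * u \<and> norm f \<le> K * u \<and>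
     (\<forall>i j. i \<noteq> j \<longrightarrow> G $ i $ j = 0) \<and>
     (\<forall>i\<in>B. \<bar>G $ i $ i\<bar> \<le> K * (m * u)) \<and>
     (\<forall>i\<in>- B. \<bar>G $ i $ i\<bar> \<le> K * (u / m)) \<and>
     norm Fhat \<le> K * (u / m) \<and> norm fhat \<le> K * u"

text \<open>\<open>A\<close>, \<open>c\<close>, \<open>J\<close>, \<open>b\<close>, \<open>E\<close> are the computed Hessian and gradient of the Lagrangian, the computed
  \<open>\<nabla>g(z)\<close>, the computed \<open>g(z)\<close>, and the computed \<open>D\<inverse>\<close>.\<close>

definition computed_step ::
  "(real^'n \<Rightarrow> real) \<Rightarrow> (real^'n \<Rightarrow> real^'m) \<Rightarrow> real^'n \<Rightarrow> real \<Rightarrow>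
   real \<Rightarrow> real set \<Rightarrow> (fp_op \<Rightarrow> real \<Rightarrow> real \<Rightarrow> real) \<Rightarrow>
   real^'n \<Rightarrow> real^'m \<Rightarrow> real^'m \<Rightarrow> real^'m \<Rightarrow> real^'n \<Rightarrow> real^'m \<Rightarrow> real^'m \<Rightarrow> bool" where
  "computed_step \<phi> g zs K u Fl fl z l s t dz dl ds \<longleftrightarrow>
     (\<exists>Fbar fbar F f G Fhat fhat A c J b E.
        perturbation_bounds K u (mu l s) (active g zs) Fbar fbar F f G Fhat fhat \<and>
        A = Lzz \<phi> g z l + Fbar \<and>
        c = Lz \<phi> g z l + fbar \<and>
        J = nabla_g g z + F \<and>
        b = g z + f \<and>
        E = matrix_inv (D_mat l s + G) \<and>
        fp_vector Fl z \<and> fp_vector Fl l \<and> fp_vector Fl s \<and> fp_vector Fl t \<and>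
        (\<forall>j. fp_vector Fl (J $ j)) \<and> fp_vector Fl b \<and> (\<forall>i. E $ i $ i \<in> Fl) \<and>
        fp_vector Fl dz \<and>
        (A + J ** E ** transpose J + Fhat) *v dz
          = - c - (J ** E) *v (b - matrix_inv (diag_mat l) *v t) + fhat \<and>
        (\<forall>i. \<exists>p w. fp_inner fl (column i J) dz p \<and>
               w \<in> fp_diff_plus fl (b $ i) (fl FDiv (t $ i) (l $ i)) p \<and>
               dl $ i = fl FMul (E $ i $ i) w) \<and>
        (\<forall>i. \<exists>p. fp_inner fl (column i J) dz p \<and>
               ds $ i = fl FSub (- fl FAdd (b $ i) (s $ i)) p))"

definition max_step :: "real^'m \<Rightarrow> real^'m \<Rightarrow> real^'m \<Rightarrow> real^'m \<Rightarrow> real" where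
  "max_step l s dl ds =
     (GREATEST a. a \<in> {0..1} \<and>
        (\<forall>\<alpha>\<in>{0..a}. \<forall>i. 0 \<le> (l + \<alpha> *\<^sub>R dl) $ i \<and> 0 \<le> (s + \<alpha> *\<^sub>R ds) $ i))"

end

theory Submission
  imports Defs "HOL-Library.Landau_Symbols"
begin

text \<open>All constants may depend on the problem, so it suffices to prove order estimates along an
  arbitrary sequence of admissible instances whose \<open>sol_dist\<close>, \<open>\<mu>\<close>, \<open>u/\<mu>\<close> tend to zero; a
  failure of uniformity would produce a sequence violating them. For a fixed problem the smallest
  singular value of the active gradients is a constant, and the second-order conditions with strict
  complementarity make the Hessian of the Lagrangian positive definite on the kernel of the
  transposed active gradients.

  Testing the residual equations against \<open>z - z\<^sup>*\<close> gives \<open>z - z\<^sup>* = O(\<mu>)\<close>, hence \<open>s\<^sub>i\<close> and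
  \<open>\<lambda>\<^sub>j\<close> are of order \<open>\<mu>\<close> for active \<open>i\<close> and inactive \<open>j\<close>. The computed step solves, with
  \<open>p = \<Delta>z + (z - z\<^sup>*)\<close>, a perturbed saddle point system with small right-hand side. The multiplier
  step is split into a part controlled by the range of the active gradients and a part in their
  kernel, which only sees the block \<open>D\<close> of order \<open>\<mu>\<close>; this yields \<open>\<Delta>z = O(\<mu>)\<close> and
  \<open>\<Delta>\<lambda> = O(\<mu> + u/\<mu>)\<close>, and the claims follow by expansion.\<close>

section \<open>Order estimates along sequences\<close>

text \<open>MFCQ bounds the multiplier set but need not make it a single point, so
  \<open>l n\<close> need not approach any fixed multiplier and the matrix of active gradients may
  have a kernel. On that kernel the linear system is only as definite as the block D, of order mu,
  so an error of size u in the constraints can move the multiplier step by u/mu. The primal step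
  escapes this loss because the multiplier step enters the stationarity equation only through its
  image under the active gradients; there it can be replaced by a bounded preimage, whose size
  contains no u/mu.

  The bounds are circular: multipliers are estimated by the primal error, and that error by the
  multipliers. Each feedback term carries a factor tending to zero and is absorbed into the
  left-hand side. No prior bound is required for this, since each member of a sequence is finite,
  and the sequence formulation hides the explicit smallness conditions that absorption would
  otherwise accumulate.\<close>

definition lesssim :: "(nat \<Rightarrow> 'b::real_normed_vector) \<Rightarrow> (nat \<Rightarrow> real) \<Rightarrow> bool" (infix "\<preceq>" 50) where
  "X \<preceq> Y \<longleftrightarrow> (\<lambda>n. norm (X n)) \<in> O(Y)"

lemma lesssimI:
  assumes "\<forall>\<^sub>F n in sequentially. norm (X n) \<le> K * Y n"
  shows "X \<preceq> Y"
  unfolding lesssim_def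
proof (rule bigoI[where c = "\<bar>K\<bar>"])
  show "\<forall>\<^sub>F n in sequentially. norm (norm (X n)) \<le> \<bar>K\<bar> * norm (Y n)"
    using assms by eventually_elim (simp add: abs_mult[symmetric])
qed

lemma lesssimE:
  assumes "X \<preceq> Y"
  obtains K where "K > 0" "\<forall>\<^sub>F n in sequentially. norm (X n) \<le> K * \<bar>Y n\<bar>"
  using assms unfolding lesssim_def by (auto elim!: landau_o.bigE)

lemma lesssim_trans: "X \<preceq> Y \<Longrightarrow> Y \<preceq> Z \<Longrightarrow> X \<preceq> Z"
  unfolding lesssim_def using landau_o.big_trans by fastforce

lemma lesssim_le_trans:
  assumes "X \<preceq> Y" "\<forall>\<^sub>F n in sequentially. \<bar>Y n\<bar> \<le> K * Z n"
  shows "X \<preceq> Z"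
  by (rule lesssim_trans[OF assms(1)]) (use assms(2) in \<open>auto intro: lesssimI\<close>)

lemma lesssim_mono:
  assumes "X \<preceq> Y" "\<And>n. 0 \<le> Y n" "\<And>n. Y n \<le> Z n"
  shows "X \<preceq> Z"
  by (rule lesssim_le_trans[OF assms(1), of 1]) (use assms(2,3) in auto)

lemma lesssim_norm_le:
  assumes "X' \<preceq> Y" "\<forall>\<^sub>F n in sequentially. norm (X n) \<le> norm (X' n)"
  shows "X \<preceq> Y"
proof -
  have "X \<preceq> (\<lambda>n. norm (X' n))" using assms(2) by (auto intro: lesssimI[of _ 1])
  then show ?thesis using assms(1) unfolding lesssim_def by (auto intro: landau_o.big_trans)
qed

lemma lesssim_norm [simp]: "(\<lambda>n. norm (X n)) \<preceq> Y \<longleftrightarrow> X \<preceq> Y"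
  by (simp add: lesssim_def)

lemma lesssim_refl: "Y \<preceq> Y"
  by (rule lesssim_norm_le[of "\<lambda>n. Y n", OF _ always_eventually]) (auto simp: lesssim_def)

lemma lesssim_add: "X \<preceq> Y \<Longrightarrow> X' \<preceq> Y \<Longrightarrow> (\<lambda>n. X n + X' n) \<preceq> Y"
  by (rule lesssim_norm_le[of "\<lambda>n. norm (X n) + norm (X' n)"])
     (auto simp: lesssim_def norm_triangle_ineq intro: sum_in_bigo)

lemma lesssim_minus [simp]: "(\<lambda>n. - X n) \<preceq> Y \<longleftrightarrow> X \<preceq> Y"
  by (simp add: lesssim_def)

lemma lesssim_diff: "X \<preceq> Y \<Longrightarrow> X' \<preceq> Y \<Longrightarrow> (\<lambda>n. X n - X' n) \<preceq> Y"
  using lesssim_add[of X Y "\<lambda>n. - X' n"] by simp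

lemma lesssim_zero [simp]: "(\<lambda>n. 0) \<preceq> Y"
  by (simp add: lesssim_def)

lemma lesssim_sum: "(\<And>i. i \<in> I \<Longrightarrow> X i \<preceq> Y) \<Longrightarrow> (\<lambda>n. \<Sum>i\<in>I. X i n) \<preceq> Y"
  by (induction I rule: infinite_finite_induct) (auto intro: lesssim_add)

lemma lesssim_bilinear:
  assumes "bounded_bilinear h" "X \<preceq> Y" "X' \<preceq> Y'"
  shows "(\<lambda>n. h (X n) (X' n)) \<preceq> (\<lambda>n. Y n * Y' n)"
proof -
  obtain K where K: "\<And>a b. norm (h a b) \<le> norm a * norm b * K"
    using bounded_bilinear.bounded[OF assms(1)] by blast
  have "(\<lambda>n. h (X n) (X' n)) \<preceq> (\<lambda>n. norm (X n) * norm (X' n))"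
    by (rule lesssimI[of _ K]) (use K in \<open>auto simp: mult.commute\<close>)
  moreover have "(\<lambda>n. norm (X n) * norm (X' n)) \<preceq> (\<lambda>n. Y n * Y' n)"
    using landau_o.big.mult assms(2,3) unfolding lesssim_def by fastforce
  ultimately show ?thesis by (rule lesssim_trans)
qed

lemma bounded_bilinear_matrix_vector:
  "bounded_bilinear (\<lambda>(A::real^'n^'m) v. A *v v)"
  unfolding bilinear_conv_bounded_bilinear[symmetric] bilinear_def
  by (auto intro!: linearI simp: matrix_vector_mult_add_rdistrib matrix_vector_right_distrib
        matrix_vector_mult_scaleR scaleR_matrix_vector_assoc)

lemmas lesssim_mult = lesssim_bilinear[OF bounded_bilinear_mult]
lemmas lesssim_inner = lesssim_bilinear[OF bounded_bilinear_inner]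
lemmas lesssim_scaleR = lesssim_bilinear[OF bounded_bilinear_scaleR]
lemmas lesssim_matrix_vector = lesssim_bilinear[OF bounded_bilinear_matrix_vector]

lemma lesssim_tendsto:
  assumes "X \<longlonglongrightarrow> L"
  shows "X \<preceq> (\<lambda>_. 1)"
proof (rule lesssimI[of _ "norm L + 1"])
  have "(\<lambda>n. norm (X n)) \<longlonglongrightarrow> norm L" using assms by (rule tendsto_norm)
  then have "\<forall>\<^sub>F n in sequentially. norm (X n) < norm L + 1"
    by (rule order_tendstoD) simp
  then show "\<forall>\<^sub>F n in sequentially. norm (X n) \<le> (norm L + 1) * 1"
    by eventually_elim simp
qed

lemma lesssim_const: "(\<lambda>n. c) \<preceq> (\<lambda>_. 1)"
  by (rule lesssim_tendsto[OF tendsto_const])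

lemma lesssim_nth: "X \<preceq> Y \<Longrightarrow> (\<lambda>n. X n $ i) \<preceq> Y"
  by (rule lesssim_norm_le) (auto simp: Finite_Cartesian_Product.norm_nth_le)

lemma lesssim_vec:
  fixes X :: "nat \<Rightarrow> ('b::real_normed_vector)^'m"
  assumes "\<And>i. (\<lambda>n. X n $ i) \<preceq> Y"
  shows "X \<preceq> Y"
proof (rule lesssim_norm_le)
  show "(\<lambda>n. \<Sum>i\<in>UNIV. norm (X n $ i)) \<preceq> Y"
    by (rule lesssim_sum) (use assms in simp)
  show "\<forall>\<^sub>F n in sequentially. norm (X n) \<le> norm (\<Sum>i\<in>UNIV. norm (X n $ i))"
    by (auto simp: norm_vec_def L2_set_le_sum sum_nonneg)
qed

lemma lesssim_tendsto_zero:
  assumes "X \<preceq> Y" "Y \<longlonglongrightarrow> 0"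
  shows "X \<longlonglongrightarrow> 0"
proof -
  obtain K where K: "\<forall>\<^sub>F n in sequentially. norm (X n) \<le> K * \<bar>Y n\<bar>"
    using assms(1) by (rule lesssimE)
  have "(\<lambda>n. K * \<bar>Y n\<bar>) \<longlonglongrightarrow> 0"
    using tendsto_mult[OF tendsto_const tendsto_rabs[OF assms(2)], of K] by simp
  with K show ?thesis by (rule Lim_null_comparison)
qed

lemma lesssim_inverse:
  assumes "c > 0" "\<forall>\<^sub>F n in sequentially. c * Y n \<le> X n" "\<And>n. (0::real) < Y n"
  shows "(\<lambda>n. inverse (X n)) \<preceq> (\<lambda>n. inverse (Y n))"
proof (rule lesssimI[of _ "inverse c"])
  show "\<forall>\<^sub>F n in sequentially. norm (inverse (X n)) \<le> inverse c * inverse (Y n)"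
    using assms(2)
  proof eventually_elim
    case (elim n)
    have "0 < c * Y n" using assms by simp
    then have "inverse (X n) \<le> inverse (c * Y n)" "0 < X n" using elim by (auto simp only: le_imp_inverse_le)
    then have "norm (inverse (X n)) \<le> inverse (c * Y n)" by simp
    then show ?case by (simp only: inverse_mult_distrib)
  qed
qed

text \<open>Once \<open>K * \<bar>e n\<bar>\<close> is below 1/2, half of \<open>norm (X n)\<close>
  remains on the left. No boundedness of \<open>X\<close> enters, so circular estimates can be
  closed with it.\<close>

lemma lesssim_absorb:
  assumes "X \<preceq> (\<lambda>n. Y n + e n * norm (X n))" "e \<longlonglongrightarrow> 0" "\<And>n. 0 \<le> Y n"
  shows "X \<preceq> Y"
proof -
  obtain K where K: "K > 0" "\<forall>\<^sub>F n in sequentially. norm (X n) \<le> K * \<bar>Y n + e n * norm (X n)\<bar>"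
    using assms(1) by (rule lesssimE)
  have "\<forall>\<^sub>F n in sequentially. \<bar>e n\<bar> < 1 / (2 * K)"
    using tendsto_rabs[OF assms(2)] K(1) by (intro order_tendstoD(2)) auto
  with K(2) have "\<forall>\<^sub>F n in sequentially. norm (X n) \<le> 2 * K * Y n"
  proof eventually_elim
    case (elim n)
    have "\<bar>e n\<bar> * norm (X n) \<le> 1 / (2 * K) * norm (X n)"
      using elim(2) by (intro mult_right_mono) auto
    then have "K * (\<bar>e n\<bar> * norm (X n)) \<le> norm (X n) / 2"
      using mult_left_mono[of "\<bar>e n\<bar> * norm (X n)" "1 / (2 * K) * norm (X n)" K] K(1) by simp
    moreover have "\<bar>Y n + e n * norm (X n)\<bar> \<le> Y n + \<bar>e n\<bar> * norm (X n)"
      using assms(3)[of n] abs_triangle_ineq[of "Y n" "e n * norm (X n)"] by (simp add: abs_mult)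
    then have "K * \<bar>Y n + e n * norm (X n)\<bar> \<le> K * (Y n + \<bar>e n\<bar> * norm (X n))"
      using K(1) by simp
    ultimately show ?case using elim(1) by (simp add: distrib_left)
  qed
  then show ?thesis by (rule lesssimI)
qed

text \<open>After the \<open>e\<close>-term is absorbed,
  \<open>a * a \<le> K * (m * a + m * m)\<close> forces \<open>a \<le> (K + 1) * m\<close>: a larger
  \<open>a\<close> would give \<open>m * a \<le> K * (m * m)\<close> although \<open>m * a\<close>
  exceeds \<open>(K + 1) * (m * m)\<close>.\<close>

lemma lesssim_absorb_quadratic:
  fixes a m :: "nat \<Rightarrow> real"
  assumes "(\<lambda>n. (a n)\<^sup>2) \<preceq> (\<lambda>n. m n * a n + (m n)\<^sup>2 + e n * (a n)\<^sup>2)"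
    and "e \<longlonglongrightarrow> 0" and a: "\<And>n. 0 \<le> a n" and m: "\<And>n. 0 < m n"
  shows "a \<preceq> m"
proof -
  have "(\<lambda>n. (a n)\<^sup>2) \<preceq> (\<lambda>n. m n * a n + (m n)\<^sup>2)"
    by (rule lesssim_absorb[OF _ assms(2)]) (use assms m in \<open>auto simp: less_imp_le\<close>)
  then obtain K where K: "K > 0"
    "\<forall>\<^sub>F n in sequentially. norm ((a n)\<^sup>2) \<le> K * \<bar>m n * a n + (m n)\<^sup>2\<bar>"
    by (rule lesssimE)
  from K(2) have "\<forall>\<^sub>F n in sequentially. norm (a n) \<le> (K + 1) * m n"
  proof eventually_elim
    case (elim n)
    have le: "a n * a n \<le> K * (m n * a n) + K * (m n * m n)"
      using elim a[of n] m[of n] by (simp add: power2_eq_square distrib_left)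
    show ?case
    proof (rule ccontr)
      assume "\<not> ?thesis"
      then have gt: "(K + 1) * m n < a n" using a[of n] by simp
      have "(K + 1) * m n * a n \<le> a n * a n" using gt a[of n] by (intro mult_right_mono) auto
      then have "m n * a n \<le> K * (m n * m n)" using le by (simp add: algebra_simps)
      moreover have "m n * ((K + 1) * m n) < m n * a n" using gt m[of n] by simp
      moreover have "m n * ((K + 1) * m n) = K * (m n * m n) + m n * m n" by (simp add: algebra_simps)
      moreover have "0 < m n * m n" using m[of n] by simp
      ultimately show False by linarith
    qed
  qed
  then show ?thesis by (rule lesssimI)
qed

text \<open>Bounded preimages: a linear right inverse on the range plays the role of the pseudoinverse
  \<open>U \<Sigma>\<inverse> \<hat>U\<^sup>T\<close>.\<close>

lemma bounded_preimage_on_subspace: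
  fixes f :: "'a::euclidean_space \<Rightarrow> 'b::euclidean_space"
  assumes "linear f" "subspace V"
  obtains K where "K > 0" "\<And>v. v \<in> V \<Longrightarrow> \<exists>w\<in>V. f w = f v \<and> norm w \<le> K * norm (f v)"
proof -
  obtain h where h: "h ` UNIV \<subseteq> V" "linear h" "\<forall>v\<in>f ` V. f (h v) = v"
    using linear_exists_right_inverse_on[OF assms] by blast
  obtain K where K: "K > 0" "\<And>x. norm (h x) \<le> K * norm x"
    using linear_bounded_pos[OF h(2)] by blast
  show ?thesis
    by (rule that[OF K(1)]) (use h K in \<open>auto intro!: bexI[of _ "h (f _)"]\<close>)
qed

lemma norm_matrix_vector_le:
  obtains K where "K > 0" "\<And>(A::real^'n^'m) v. norm (A *v v) \<le> K * norm A * norm v"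
proof -
  obtain K where "K > 0" "\<And>(A::real^'n^'m) v. norm (A *v v) \<le> norm A * norm v * K"
    using bounded_bilinear.pos_bounded[OF bounded_bilinear_matrix_vector] by blast
  then show ?thesis using that by (simp add: mult_ac)
qed

text \<open>A quantitative Finsler lemma. A vector \<open>r\<close> with the same value under
  \<open>transpose A\<close> as \<open>p\<close>, and norm controlled by that value, is subtracted
  from \<open>p\<close>; the difference lies in the kernel, and the cross terms are split by Young's
  inequality. The constant depends on \<open>H\<close> only through the bound \<open>M\<close>, so
  it serves a whole sequence of Hessians.\<close>

lemma coercive_on_kernel:
  fixes A :: "real^'m^'n"
  assumes "\<xi> > 0"
  obtains K where "K > 0"
    "\<And>(H::real^'n^'n) p. norm H \<le> M \<Longrightarrow>
       (\<And>w. transpose A *v w = 0 \<Longrightarrow> \<xi> * (norm w)\<^sup>2 \<le> w \<bullet> (H *v w)) \<Longrightarrow>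
       (norm p)\<^sup>2 \<le> K * (\<bar>p \<bullet> (H *v p)\<bar> + (norm (transpose A *v p))\<^sup>2)"
proof -
  obtain K1 where K1: "K1 > 0"
    "\<And>v. \<exists>w. transpose A *v w = transpose A *v v \<and> norm w \<le> K1 * norm (transpose A *v v)"
    using bounded_preimage_on_subspace[OF matrix_vector_mul_linear[of "transpose A"] subspace_UNIV]
    by auto
  obtain K2 where K2: "K2 > 0" "\<And>(B::real^'n^'n) v. norm (B *v v) \<le> K2 * norm B * norm v"
    using norm_matrix_vector_le[where 'm = 'n and 'n = 'n] by blast
  define M' where "M' = K2 * max M 1"
  have M': "M' > 0" using K2 by (simp add: M'_def)
  \<comment> \<open>The first entry multiplies the quadratic form, the second collects everything
    that comes from \<open>r\<close>; with \<open>k = 2 * M' / \<xi>\<close> it is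
    \<open>(2 * k + 8 * k^2 + 4) * K1^2\<close>.\<close>
  define K where "K = max (4 / \<xi>) ((4 * M' / \<xi> + 8 * (2 * M' / \<xi>)\<^sup>2 + 4) * K1\<^sup>2)"
  show ?thesis
  proof (rule that)
    show "K > 0" using assms by (simp add: K_def less_max_iff_disj)
    fix H :: "real^'n^'n" and p :: "real^'n"
    assume H: "norm H \<le> M" and pos: "\<And>w. transpose A *v w = 0 \<Longrightarrow> \<xi> * (norm w)\<^sup>2 \<le> w \<bullet> (H *v w)"
    obtain r where r: "transpose A *v r = transpose A *v p" "norm r \<le> K1 * norm (transpose A *v p)"
      using K1 by blast
    have bd: "\<bar>x \<bullet> (H *v y)\<bar> \<le> M' * (norm x * norm y)" for x y
    proof -
      have "\<bar>x \<bullet> (H *v y)\<bar> \<le> norm x * norm (H *v y)" by (rule Cauchy_Schwarz_ineq2)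
      also have "\<dots> \<le> norm x * (K2 * norm H * norm y)" using K2 by (intro mult_left_mono) auto
      also have "\<dots> \<le> norm x * (M' * norm y)"
        using K2(1) H by (auto intro!: mult_left_mono mult_right_mono simp: M'_def)
      finally show ?thesis by (simp add: mult_ac)
    qed
    define q where "q = p - r"
    have "transpose A *v q = 0" using r(1) by (simp add: q_def matrix_vector_mult_diff_distrib)
    then have "\<xi> * (norm q)\<^sup>2 \<le> q \<bullet> (H *v q)" by (rule pos)
    also have "q \<bullet> (H *v q) = p \<bullet> (H *v p) - p \<bullet> (H *v r) - r \<bullet> (H *v p) + r \<bullet> (H *v r)"
      by (simp add: q_def matrix_vector_mult_diff_distrib inner_diff_left inner_diff_right)
    also have "\<dots> \<le> \<bar>p \<bullet> (H *v p)\<bar> + 2 * M' * (norm p * norm r) + M' * (norm r)\<^sup>2"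
      using bd[of p r] bd[of r p] bd[of r r] by (simp add: power2_eq_square mult_ac)
    finally have 1: "\<xi> * (norm q)\<^sup>2 \<le> \<bar>p \<bullet> (H *v p)\<bar> + 2 * M' * (norm p * norm r) + M' * (norm r)\<^sup>2" .
    define a b c where "a = norm p" and "b = norm r" and "c = \<bar>p \<bullet> (H *v p)\<bar>"
    define k where "k = 2 * M' / \<xi>"
    have "norm p \<le> norm q + norm r" using norm_triangle_ineq[of q r] by (simp add: q_def)
    then have "a\<^sup>2 \<le> (norm q + b)\<^sup>2" by (auto simp: a_def b_def intro: power_mono)
    also have "\<dots> \<le> 2 * (norm q)\<^sup>2 + 2 * b\<^sup>2"
      using sum_squares_ge_zero[of "norm q - b" 0] by (simp add: power2_eq_square algebra_simps)
    finally have 2: "a\<^sup>2 \<le> 2 * (norm q)\<^sup>2 + 2 * b\<^sup>2" .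
    have 3: "(norm q)\<^sup>2 \<le> c / \<xi> + k * (a * b) + k / 2 * b\<^sup>2"
      using 1 assms by (simp add: a_def b_def c_def k_def field_simps)
    \<comment> \<open>Young's inequality, weighted so that the mixed term costs only half of the
      square of \<open>a\<close> when facts 2 and 3 are combined.\<close>
    have "0 \<le> (a - 2 * k * b)\<^sup>2" by simp
    then have 4: "4 * (k * (a * b)) \<le> a\<^sup>2 + 4 * k\<^sup>2 * b\<^sup>2" by (simp add: power2_eq_square algebra_simps)
    have "a\<^sup>2 \<le> 4 / \<xi> * c + (2 * k + 8 * k\<^sup>2 + 4) * b\<^sup>2"
    proof -
      have "4 / \<xi> * c = 4 * (c / \<xi>)" "(2 * k + 8 * k\<^sup>2 + 4) * b\<^sup>2 = 4 * (k / 2 * b\<^sup>2) + 8 * (k\<^sup>2 * b\<^sup>2) + 4 * b\<^sup>2"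
        "0 \<le> k\<^sup>2 * b\<^sup>2" "4 * k\<^sup>2 * b\<^sup>2 = 4 * (k\<^sup>2 * b\<^sup>2)"
        by (auto simp: algebra_simps)
      then show ?thesis using 2 3 4 by linarith
    qed
    also have "\<dots> \<le> 4 / \<xi> * c + (2 * k + 8 * k\<^sup>2 + 4) * (K1 * norm (transpose A *v p))\<^sup>2"
      using r(2) M' assms by (intro add_left_mono mult_left_mono power_mono) (auto simp: b_def k_def)
    also have "\<dots> = 4 / \<xi> * c + ((4 * M' / \<xi> + 8 * (2 * M' / \<xi>)\<^sup>2 + 4) * K1\<^sup>2) * (norm (transpose A *v p))\<^sup>2"
      by (simp add: k_def power_mult_distrib)
    also have "\<dots> \<le> K * c + K * (norm (transpose A *v p))\<^sup>2"
      by (intro add_mono mult_right_mono) (auto simp: K_def c_def)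
    finally show "(norm p)\<^sup>2 \<le> K * (\<bar>p \<bullet> (H *v p)\<bar> + (norm (transpose A *v p))\<^sup>2)"
      by (simp add: a_def c_def distrib_left)
  qed
qed

section \<open>Smoothness of the problem data\<close>

lemma gradient_eqI:
  fixes f :: "real^'n \<Rightarrow> real"
  assumes "GDERIV f z :> D"
  shows "gradient f z = D"
  unfolding gradient_def
proof (rule the_equality[of "\<lambda>D. GDERIV f z :> D", OF assms])
  fix D' assume "GDERIV f z :> D'"
  then have "(\<lambda>h. h \<bullet> D') = (\<lambda>h. h \<bullet> D)"
    using assms unfolding gderiv_def by (rule has_derivative_unique)
  then have "(D' - D) \<bullet> D' = (D' - D) \<bullet> D" by (rule fun_cong)
  then have "(D' - D) \<bullet> (D' - D) = 0" by (simp add: inner_diff_right)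
  then show "D' = D" by simp
qed

lemma gderiv_gradient:
  fixes f :: "real^'n \<Rightarrow> real"
  assumes "f differentiable (at z)"
  shows "GDERIV f z :> gradient f z"
proof -
  obtain f' where f': "(f has_derivative f') (at z)"
    using assms by (auto simp: differentiable_def)
  have "linear f'" using f' by (rule has_derivative_linear)
  then have "f' = (\<lambda>h. h \<bullet> adjoint f' 1)"
    by (auto simp: adjoint_works[of f' _ 1, simplified])
  then have "GDERIV f z :> adjoint f' 1" using f' by (simp add: gderiv_def)
  then show ?thesis using gradient_eqI by metis
qed

lemma hessian_eqI:
  fixes f :: "real^'n \<Rightarrow> real"
  assumes "(gradient f has_derivative (\<lambda>h. H *v h)) (at z)"
  shows "hessian f z = H"
  unfolding hessian_def frechet_derivative_at[OF assms, symmetric]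
  by (rule matrix_of_matrix_vector_mul)

lemma has_derivative_gradient:
  fixes f :: "real^'n \<Rightarrow> real"
  assumes "gradient f differentiable (at z)"
  shows "(gradient f has_derivative (\<lambda>h. hessian f z *v h)) (at z)"
proof -
  have 1: "(gradient f has_derivative frechet_derivative (gradient f) (at z)) (at z)"
    using assms by (simp add: frechet_derivative_works)
  have "(\<lambda>h. hessian f z *v h) = frechet_derivative (gradient f) (at z)"
    unfolding hessian_def
    by (rule ext, rule matrix_works) (use has_derivative_linear[OF 1] in \<open>simp only: linear_matrix_vector_mul_eq\<close>)
  then show ?thesis using 1 by simp
qed

text \<open>One ball and one constant for all pairs of points, not only for expansions about
  \<open>c\<close>: later both the base point and the displaced point move. Each remainder follows
  from the previous estimate by the mean value inequality on the segment, which stays in the ball by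
  convexity.\<close>

lemma twice_lipschitz_expansion:
  fixes f :: "real^'n \<Rightarrow> real"
  assumes "twice_lipschitz_differentiable f"
  obtains e M where "e > 0" "M > 0"
    "\<And>a b. a \<in> ball c e \<Longrightarrow> b \<in> ball c e \<Longrightarrow> norm (hessian f b - hessian f a) \<le> M * norm (b - a)"
    "\<And>a b. a \<in> ball c e \<Longrightarrow> b \<in> ball c e \<Longrightarrow> norm (gradient f b - gradient f a) \<le> M * norm (b - a)"
    "\<And>a b. a \<in> ball c e \<Longrightarrow> b \<in> ball c e \<Longrightarrow>
       norm (gradient f b - gradient f a - hessian f a *v (b - a)) \<le> M * (norm (b - a))\<^sup>2"
    "\<And>a b. a \<in> ball c e \<Longrightarrow> b \<in> ball c e \<Longrightarrow>
       norm (f b - f a - gradient f a \<bullet> (b - a)) \<le> M * (norm (b - a))\<^sup>2"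
proof -
  have df: "GDERIV f z :> gradient f z" "(gradient f has_derivative (\<lambda>h. hessian f z *v h)) (at z)" for z
    using assms by (auto simp: twice_lipschitz_differentiable_def gderiv_gradient has_derivative_gradient)
  obtain e L where e: "e > 0" and L: "L-lipschitz_on (ball c e) (hessian f)"
    using assms unfolding twice_lipschitz_differentiable_def by blast
  have L0: "L \<ge> 0" using L by (rule lipschitz_on_nonneg)
  have hess: "norm (hessian f b - hessian f a) \<le> L * norm (b - a)" if "a \<in> ball c e" "b \<in> ball c e" for a b
    using lipschitz_onD[OF L that(2,1)] by (simp add: dist_norm)
  obtain K where K: "K > 0" "\<And>(A::real^'n^'n) v. norm (A *v v) \<le> K * norm A * norm v"
    by (rule norm_matrix_vector_le) blast
  define M1 where "M1 = K * L"
  have M1: "M1 \<ge> 0" using K L0 by (simp add: M1_def)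
  have seg: "closed_segment a b \<subseteq> ball c e" if "a \<in> ball c e" "b \<in> ball c e" for a b
    using that by (simp add: closed_segment_subset)
  have dist_seg: "norm (x - a) \<le> norm (b - a)" if "x \<in> closed_segment a b" for x a b :: "real^'n"
    using segment_bound(1)[OF that] by (simp add: norm_minus_commute)
  have grad2: "norm (gradient f b - gradient f a - hessian f a *v (b - a)) \<le> M1 * (norm (b - a))\<^sup>2"
    if ab: "a \<in> ball c e" "b \<in> ball c e" for a b
  proof -
    \<comment> \<open>The linearization bound needs only the variation of the derivative along the
      segment, which the Lipschitz Hessian limits to a multiple of
      \<open>norm (b - a)\<close>.\<close>
    have "norm (gradient f b - gradient f a - hessian f a *v (b - a)) \<le> norm (b - a) * (M1 * norm (b - a))"
    proof (rule differentiable_bound_linearization[where S = "closed_segment a b" and f' = "\<lambda>x h. hessian f x *v h"])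
      show "a + t *\<^sub>R (b - a) \<in> closed_segment a b" if "t \<in> {0..1}" for t
        using that unfolding closed_segment_def by (auto simp: scaleR_diff_right scaleR_diff_left)
      show "(gradient f has_derivative (\<lambda>h. hessian f x *v h)) (at x within closed_segment a b)" for x
        by (rule has_derivative_at_withinI[OF df(2)])
      show "onorm ((\<lambda>h. hessian f x *v h) - (\<lambda>h. hessian f a *v h)) \<le> M1 * norm (b - a)"
        if x: "x \<in> closed_segment a b" for x
      proof (rule onorm_le)
        fix h
        have "norm (((\<lambda>h. hessian f x *v h) - (\<lambda>h. hessian f a *v h)) h) = norm ((hessian f x - hessian f a) *v h)"
          by (simp add: matrix_vector_mult_diff_rdistrib)
        also have "\<dots> \<le> K * norm (hessian f x - hessian f a) * norm h" by (rule K)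
        also have "\<dots> \<le> K * (L * norm (b - a)) * norm h"
          using order_trans[OF hess mult_left_mono[OF dist_seg[OF x] L0]] ab(1) seg[OF ab] x K
          by (intro mult_right_mono mult_left_mono) auto
        finally show "norm (((\<lambda>h. hessian f x *v h) - (\<lambda>h. hessian f a *v h)) h) \<le> M1 * norm (b - a) * norm h"
          by (simp add: M1_def mult_ac)
      qed
    qed auto
    then show ?thesis by (simp add: power2_eq_square mult_ac)
  qed
  \<comment> \<open>The quadratic remainder is made linear by the diameter \<open>2 * e\<close> of
    the ball; the linear term uses the bound \<open>norm (hessian f c) + L * e\<close> for the
    Hessian on the ball.\<close>
  define M2 where "M2 = M1 * (2 * e) + K * (norm (hessian f c) + L * e)"
  have M2: "M2 \<ge> 0" using M1 K e L0 by (simp add: M2_def)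
  have grad1: "norm (gradient f b - gradient f a) \<le> M2 * norm (b - a)"
    if ab: "a \<in> ball c e" "b \<in> ball c e" for a b
  proof -
    have "norm (gradient f b - gradient f a) \<le>
        norm (gradient f b - gradient f a - hessian f a *v (b - a)) + norm (hessian f a *v (b - a))"
      by norm
    also have "\<dots> \<le> M1 * (norm (b - a))\<^sup>2 + K * norm (hessian f a) * norm (b - a)"
      by (intro add_mono grad2 ab K)
    also have "\<dots> \<le> M1 * (2 * e * norm (b - a)) + K * (norm (hessian f c) + L * e) * norm (b - a)"
    proof (intro add_mono mult_left_mono mult_right_mono)
      have "norm (b - a) \<le> 2 * e"
        using ab norm_triangle_ineq4[of "c - a" "c - b"] by (simp add: dist_norm)
      then show "(norm (b - a))\<^sup>2 \<le> 2 * e * norm (b - a)"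
        by (simp add: power2_eq_square mult_right_mono)
      have "norm (hessian f a - hessian f c) \<le> L * norm (a - c)" using ab e by (intro hess) auto
      also have "\<dots> \<le> L * e" using ab L0 by (intro mult_left_mono) (auto simp: dist_norm norm_minus_commute)
      finally show "norm (hessian f a) \<le> norm (hessian f c) + L * e"
        using norm_triangle_ineq2[of "hessian f a" "hessian f c"] by simp
    qed (use M1 K in auto)
    finally show ?thesis by (simp add: M2_def algebra_simps)
  qed
  have f2: "norm (f b - f a - gradient f a \<bullet> (b - a)) \<le> M2 * (norm (b - a))\<^sup>2"
    if ab: "a \<in> ball c e" "b \<in> ball c e" for a b
  proof -
    have "norm (f b - f a - (b - a) \<bullet> gradient f a) \<le> norm (b - a) * (M2 * norm (b - a))"
    proof (rule differentiable_bound_linearization[where S = "closed_segment a b" and f' = "\<lambda>x h. h \<bullet> gradient f x"])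
      show "a + t *\<^sub>R (b - a) \<in> closed_segment a b" if "t \<in> {0..1}" for t
        using that unfolding closed_segment_def by (auto simp: scaleR_diff_right scaleR_diff_left)
      show "(f has_derivative (\<lambda>h. h \<bullet> gradient f x)) (at x within closed_segment a b)" for x
        by (rule has_derivative_at_withinI[OF df(1)[unfolded gderiv_def]])
      show "onorm ((\<lambda>h. h \<bullet> gradient f x) - (\<lambda>h. h \<bullet> gradient f a)) \<le> M2 * norm (b - a)"
        if x: "x \<in> closed_segment a b" for x
      proof (rule onorm_le)
        fix h
        have "norm (((\<lambda>h. h \<bullet> gradient f x) - (\<lambda>h. h \<bullet> gradient f a)) h) = norm (h \<bullet> (gradient f x - gradient f a))"
          by (simp add: inner_diff_right)
        also have "\<dots> \<le> norm h * norm (gradient f x - gradient f a)" by (simp add: Cauchy_Schwarz_ineq2)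
        also have "\<dots> \<le> norm h * (M2 * norm (b - a))"
          using order_trans[OF grad1 mult_left_mono[OF dist_seg[OF x] M2]] ab(1) seg[OF ab] x
          by (intro mult_left_mono) auto
        finally show "norm (((\<lambda>h. h \<bullet> gradient f x) - (\<lambda>h. h \<bullet> gradient f a)) h) \<le> M2 * norm (b - a) * norm h"
          by (simp add: mult_ac)
      qed
    qed auto
    then show ?thesis by (simp add: power2_eq_square mult_ac inner_commute)
  qed
  show ?thesis
  proof (rule that[of e "L + M1 + M2 + 1"])
    have le: "L \<le> L + M1 + M2 + 1" "M1 \<le> L + M1 + M2 + 1" "M2 \<le> L + M1 + M2 + 1"
      using L0 M1 M2 by auto
    fix a b assume ab: "a \<in> ball c e" "b \<in> ball c e"
    show "norm (hessian f b - hessian f a) \<le> (L + M1 + M2 + 1) * norm (b - a)"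
      using hess[OF ab] mult_right_mono[OF le(1), of "norm (b - a)"] by simp
    show "norm (gradient f b - gradient f a) \<le> (L + M1 + M2 + 1) * norm (b - a)"
      using grad1[OF ab] mult_right_mono[OF le(3), of "norm (b - a)"] by simp
    show "norm (gradient f b - gradient f a - hessian f a *v (b - a)) \<le> (L + M1 + M2 + 1) * (norm (b - a))\<^sup>2"
      using grad2[OF ab] mult_right_mono[OF le(2), of "(norm (b - a))\<^sup>2"] by simp
    show "norm (f b - f a - gradient f a \<bullet> (b - a)) \<le> (L + M1 + M2 + 1) * (norm (b - a))\<^sup>2"
      using f2[OF ab] mult_right_mono[OF le(3), of "(norm (b - a))\<^sup>2"] by simp
  qed (use e L0 M1 M2 in auto)
qed

lemma twice_lipschitz_lesssim:
  fixes f :: "real^'n \<Rightarrow> real"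
  assumes "twice_lipschitz_differentiable f" and "x \<longlonglongrightarrow> c" "y \<longlonglongrightarrow> c"
  shows "(\<lambda>n. hessian f (y n) - hessian f (x n)) \<preceq> (\<lambda>n. norm (y n - x n))"
    and "(\<lambda>n. gradient f (y n) - gradient f (x n)) \<preceq> (\<lambda>n. norm (y n - x n))"
    and "(\<lambda>n. gradient f (y n) - gradient f (x n) - hessian f (x n) *v (y n - x n)) \<preceq> (\<lambda>n. (norm (y n - x n))\<^sup>2)"
    and "(\<lambda>n. f (y n) - f (x n) - gradient f (x n) \<bullet> (y n - x n)) \<preceq> (\<lambda>n. (norm (y n - x n))\<^sup>2)"
proof -
  obtain e M where e: "e > 0" and "M > 0" and M:
    "\<And>a b. a \<in> ball c e \<Longrightarrow> b \<in> ball c e \<Longrightarrow> norm (hessian f b - hessian f a) \<le> M * norm (b - a)"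
    "\<And>a b. a \<in> ball c e \<Longrightarrow> b \<in> ball c e \<Longrightarrow> norm (gradient f b - gradient f a) \<le> M * norm (b - a)"
    "\<And>a b. a \<in> ball c e \<Longrightarrow> b \<in> ball c e \<Longrightarrow>
       norm (gradient f b - gradient f a - hessian f a *v (b - a)) \<le> M * (norm (b - a))\<^sup>2"
    "\<And>a b. a \<in> ball c e \<Longrightarrow> b \<in> ball c e \<Longrightarrow>
       norm (f b - f a - gradient f a \<bullet> (b - a)) \<le> M * (norm (b - a))\<^sup>2"
    by (rule twice_lipschitz_expansion[OF assms(1), of c], rule that)
  have "\<forall>\<^sub>F n in sequentially. x n \<in> ball c e" "\<forall>\<^sub>F n in sequentially. y n \<in> ball c e"
    using topological_tendstoD[OF assms(2) open_ball] topological_tendstoD[OF assms(3) open_ball] e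
    by (meson centre_in_ball)+
  then have ev: "\<forall>\<^sub>F n in sequentially. x n \<in> ball c e \<and> y n \<in> ball c e" by eventually_elim simp
  show "(\<lambda>n. hessian f (y n) - hessian f (x n)) \<preceq> (\<lambda>n. norm (y n - x n))"
    by (rule lesssimI[of _ M], rule eventually_mono[OF ev]) (use M(1) in blast)
  show "(\<lambda>n. gradient f (y n) - gradient f (x n)) \<preceq> (\<lambda>n. norm (y n - x n))"
    by (rule lesssimI[of _ M], rule eventually_mono[OF ev]) (use M(2) in blast)
  show "(\<lambda>n. gradient f (y n) - gradient f (x n) - hessian f (x n) *v (y n - x n)) \<preceq> (\<lambda>n. (norm (y n - x n))\<^sup>2)"
    by (rule lesssimI[of _ M], rule eventually_mono[OF ev]) (use M(3) in blast)
  show "(\<lambda>n. f (y n) - f (x n) - gradient f (x n) \<bullet> (y n - x n)) \<preceq> (\<lambda>n. (norm (y n - x n))\<^sup>2)"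
    by (rule lesssimI[of _ M], rule eventually_mono[OF ev]) (use M(4) in blast)
qed

section \<open>Derivatives of the Lagrangian in terms of those of the objective and the
  constraints\<close>

lemma nabla_g_mult_vector: "nabla_g g z *v v = (\<Sum>i\<in>UNIV. v $ i *\<^sub>R grad_g g z i)"
  by (vector nabla_g_def matrix_vector_mult_def) (simp add: mult.commute)

lemma transpose_nabla_g_mult_vector: "(transpose (nabla_g g z) *v p) $ i = grad_g g z i \<bullet> p"
  by (simp add: nabla_g_def matrix_vector_mult_def transpose_def inner_vec_def)

lemma gradient_lagrangian:
  fixes \<phi> :: "real^'n \<Rightarrow> real" and g :: "real^'n \<Rightarrow> real^'m"
  assumes "twice_lipschitz_differentiable \<phi>" "\<And>i. twice_lipschitz_differentiable (\<lambda>z. g z $ i)"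
  shows "gradient (\<lambda>y. lagrangian \<phi> g y l) = (\<lambda>z. gradient \<phi> z + (\<Sum>i\<in>UNIV. l $ i *\<^sub>R grad_g g z i))"
proof
  fix z
  have \<phi>: "GDERIV \<phi> z :> gradient \<phi> z"
    using assms(1) by (auto simp: twice_lipschitz_differentiable_def gderiv_gradient)
  have g: "GDERIV (\<lambda>z. g z $ i) z :> grad_g g z i" for i
    using assms(2) by (auto simp: twice_lipschitz_differentiable_def gderiv_gradient grad_g_def)
  have "GDERIV (\<lambda>y. \<phi> y + (\<Sum>i\<in>UNIV. l $ i * g y $ i)) z :> gradient \<phi> z + (\<Sum>i\<in>UNIV. l $ i *\<^sub>R grad_g g z i)"
    using \<phi> g unfolding gderiv_def
    by (auto intro!: derivative_eq_intros simp: inner_add_right inner_sum_right)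
  then show "gradient (\<lambda>y. lagrangian \<phi> g y l) z = gradient \<phi> z + (\<Sum>i\<in>UNIV. l $ i *\<^sub>R grad_g g z i)"
    by (intro gradient_eqI) (simp add: lagrangian_def[abs_def] inner_vec_def)
qed

lemma Lz_eq:
  fixes \<phi> :: "real^'n \<Rightarrow> real" and g :: "real^'n \<Rightarrow> real^'m"
  assumes "twice_lipschitz_differentiable \<phi>" "\<And>i. twice_lipschitz_differentiable (\<lambda>z. g z $ i)"
  shows "Lz \<phi> g z l = gradient \<phi> z + nabla_g g z *v l"
  using gradient_lagrangian[OF assms] by (simp add: Lz_def nabla_g_mult_vector)

lemma Lzz_eq:
  fixes \<phi> :: "real^'n \<Rightarrow> real" and g :: "real^'n \<Rightarrow> real^'m"
  assumes "twice_lipschitz_differentiable \<phi>" "\<And>i. twice_lipschitz_differentiable (\<lambda>z. g z $ i)"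
  shows "Lzz \<phi> g z l = hessian \<phi> z + (\<Sum>i\<in>UNIV. l $ i *\<^sub>R hessian (\<lambda>y. g y $ i) z)"
  unfolding Lzz_def
proof (rule hessian_eqI)
  have \<phi>: "(gradient \<phi> has_derivative (\<lambda>h. hessian \<phi> z *v h)) (at z)"
    using assms(1) by (auto simp: twice_lipschitz_differentiable_def has_derivative_gradient)
  have g: "((\<lambda>z. grad_g g z i) has_derivative (\<lambda>h. hessian (\<lambda>y. g y $ i) z *v h)) (at z)" for i
    using assms(2)[of i] has_derivative_gradient[of "\<lambda>y. g y $ i" z]
    by (simp add: twice_lipschitz_differentiable_def grad_g_def[abs_def])
  have "(\<lambda>h. (hessian \<phi> z + (\<Sum>i\<in>UNIV. l $ i *\<^sub>R hessian (\<lambda>y. g y $ i) z)) *v h)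
      = (\<lambda>h. hessian \<phi> z *v h + (\<Sum>i\<in>UNIV. l $ i *\<^sub>R (hessian (\<lambda>y. g y $ i) z *v h)))"
    by (simp add: matrix_vector_mult_add_rdistrib bounded_bilinear.sum_left[OF bounded_bilinear_matrix_vector]
        scaleR_matrix_vector_assoc)
  then show "(gradient (\<lambda>y. lagrangian \<phi> g y l) has_derivative
      (\<lambda>h. (hessian \<phi> z + (\<Sum>i\<in>UNIV. l $ i *\<^sub>R hessian (\<lambda>y. g y $ i) z)) *v h)) (at z)"
    using \<phi> g unfolding gradient_lagrangian[OF assms] by (auto intro!: derivative_intros)
qed

section \<open>Floating-point error bounds and the maximal step\<close>

lemma fp_model_op:
  assumes "fp_model u Fl fl" "x \<in> Fl" "y \<in> Fl" "op = FDiv \<Longrightarrow> y \<noteq> 0"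
  shows "fl op x y \<in> Fl" and "\<bar>fl op x y - exact_op op x y\<bar> \<le> u * \<bar>exact_op op x y\<bar>"
proof -
  obtain e where e: "fl op x y \<in> Fl" "\<bar>e\<bar> \<le> u" "fl op x y = exact_op op x y * (1 + e)"
  proof -
    have "(op = FDiv \<longrightarrow> y \<noteq> 0) \<longrightarrow>
        fl op x y \<in> Fl \<and> (\<exists>\<epsilon>. \<bar>\<epsilon>\<bar> \<le> u \<and> fl op x y = exact_op op x y * (1 + \<epsilon>))"
      using assms(1)[unfolded fp_model_def, THEN conjunct2, rule_format, OF assms(2,3)] by blast
    moreover have "op = FDiv \<longrightarrow> y \<noteq> 0" using assms(4) by (rule impI)
    ultimately have "fl op x y \<in> Fl \<and> (\<exists>\<epsilon>. \<bar>\<epsilon>\<bar> \<le> u \<and> fl op x y = exact_op op x y * (1 + \<epsilon>))"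
      by (rule mp)
    then show ?thesis using that by blast
  qed
  then show "fl op x y \<in> Fl" by simp
  have "\<bar>fl op x y - exact_op op x y\<bar> = \<bar>e\<bar> * \<bar>exact_op op x y\<bar>"
    using e(3) by (simp add: algebra_simps abs_mult)
  also have "\<dots> \<le> u * \<bar>exact_op op x y\<bar>" using e(2) by (intro mult_right_mono) auto
  finally show "\<bar>fl op x y - exact_op op x y\<bar> \<le> u * \<bar>exact_op op x y\<bar>" .
qed

lemma fp_model_uminus: "fp_model u Fl fl \<Longrightarrow> x \<in> Fl \<Longrightarrow> - x \<in> Fl"
  by (simp add: fp_model_def)

text \<open>The factor \<open>2 ^ card A - 1\<close> satisfies the recursion of a join: if both
  partial sums have relative error factor \<open>c\<close>, one more rounding gives at most
  \<open>2 * c + 1\<close>. This holds for every bracketing, at the price of an exponential constant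
  that depends only on the number of terms.\<close>

lemma fp_sum_error:
  assumes "fp_sum fl x A v" "fp_model u Fl fl" "0 \<le> u" "u \<le> 1" "\<forall>i\<in>A. x i \<in> Fl"
  shows "finite A \<and> v \<in> Fl \<and> A \<noteq> {} \<and> \<bar>v - sum x A\<bar> \<le> (2 ^ card A - 1) * u * (\<Sum>i\<in>A. \<bar>x i\<bar>)"
  using assms
proof (induction rule: fp_sum.induct)
  case (single i)
  then show ?case by simp
next
  case (join A a B b)
  then have A: "finite A" "a \<in> Fl" "A \<noteq> {}" "\<bar>a - sum x A\<bar> \<le> (2 ^ card A - 1) * u * (\<Sum>i\<in>A. \<bar>x i\<bar>)"
    and B: "finite B" "b \<in> Fl" "B \<noteq> {}" "\<bar>b - sum x B\<bar> \<le> (2 ^ card B - 1) * u * (\<Sum>i\<in>B. \<bar>x i\<bar>)"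
    by auto
  define k where "k = max (card A) (card B)"
  define s where "s = (\<Sum>i\<in>A \<union> B. \<bar>x i\<bar>)"
  have s: "s = (\<Sum>i\<in>A. \<bar>x i\<bar>) + (\<Sum>i\<in>B. \<bar>x i\<bar>)" and sx: "sum x (A \<union> B) = sum x A + sum x B"
    using A(1) B(1) join.hyps(3) by (simp_all add: s_def sum.union_disjoint)
  \<comment> \<open>Neither operand is empty, so the disjoint union is strictly larger than each of
    them; this pays for the doubling of the constant.\<close>
  have "card A > 0" "card B > 0" using A B by auto
  then have k: "Suc k \<le> card (A \<union> B)"
    using A(1) B(1) join.hyps(3) by (auto simp: k_def card_Un_disjoint)
  define c :: real where "c = 2 ^ k - 1"
  have c: "0 \<le> c" "2 * c + 1 \<le> 2 ^ card (A \<union> B) - 1"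
    using power_increasing[OF k, of "2::real"] by (auto simp: c_def)
  have "(2 ^ card A - 1) * u * (\<Sum>i\<in>A. \<bar>x i\<bar>) \<le> c * u * (\<Sum>i\<in>A. \<bar>x i\<bar>)"
    "(2 ^ card B - 1) * u * (\<Sum>i\<in>B. \<bar>x i\<bar>) \<le> c * u * (\<Sum>i\<in>B. \<bar>x i\<bar>)"
    using \<open>0 \<le> u\<close> by (auto intro!: mult_right_mono sum_nonneg simp: c_def k_def)
  with A(4) B(4) have ab: "\<bar>(a + b) - sum x (A \<union> B)\<bar> \<le> c * u * s"
    unfolding s sx by (simp add: distrib_left)
  have "\<bar>sum x (A \<union> B)\<bar> \<le> s" by (simp add: s_def sum_abs)
  moreover have "c * u * s \<le> c * s"
    using \<open>u \<le> 1\<close> c(1) \<open>0 \<le> u\<close> by (auto intro!: mult_right_mono mult_left_le simp: s_def sum_nonneg)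
  ultimately have "\<bar>a + b\<bar> \<le> (1 + c) * s" using ab by (simp add: algebra_simps)
  then have "u * \<bar>a + b\<bar> \<le> u * ((1 + c) * s)" using \<open>0 \<le> u\<close> by (rule mult_left_mono)
  then have "\<bar>fl FAdd a b - (a + b)\<bar> \<le> u * ((1 + c) * s)"
    using fp_model_op(2)[OF join.prems(1) A(2) B(2), of FAdd] by simp
  with ab have "\<bar>fl FAdd a b - sum x (A \<union> B)\<bar> \<le> (2 * c + 1) * (u * s)"
    by (simp add: algebra_simps)
  also have "\<dots> \<le> (2 ^ card (A \<union> B) - 1) * (u * s)"
    using c \<open>0 \<le> u\<close> by (intro mult_right_mono) (auto simp: s_def sum_nonneg)
  finally show ?case
    using A B fp_model_op(1)[OF join.prems(1) A(2) B(2), of FAdd] by (simp add: s_def mult.assoc)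
qed

text \<open>Each rounded product is at most twice the product of the norms, which yields the
  summation part \<open>2 * 2 ^ n * n\<close>; rounding the products themselves adds the remaining
  \<open>n\<close>.\<close>

lemma fp_inner_error:
  fixes x y :: "real^'n"
  assumes "fp_inner fl x y v" "fp_model u Fl fl" "0 \<le> u" "u \<le> 1" "fp_vector Fl x" "fp_vector Fl y"
  shows "v \<in> Fl"
    and "\<bar>v - x \<bullet> y\<bar> \<le> (2 * 2 ^ CARD('n) + 1) * CARD('n) * (u * (norm x * norm y))"
proof -
  define q where "q j = fl FMul (x $ j) (y $ j)" for j
  have q: "q j \<in> Fl" "\<bar>q j - x $ j * y $ j\<bar> \<le> u * (norm x * norm y)" for j
  proof -
    have "x $ j \<in> Fl" "y $ j \<in> Fl" using assms by (auto simp: fp_vector_def)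
    note op = fp_model_op[OF assms(2) this, of FMul]
    show "q j \<in> Fl" using op(1) by (simp add: q_def)
    have "\<bar>x $ j * y $ j\<bar> \<le> norm x * norm y"
      by (auto simp: abs_mult component_le_norm_cart intro!: mult_mono)
    then show "\<bar>q j - x $ j * y $ j\<bar> \<le> u * (norm x * norm y)"
      using op(2) mult_left_mono[of "\<bar>x $ j * y $ j\<bar>" "norm x * norm y" u] assms(3) by (simp add: q_def)
  qed
  have "\<bar>q j\<bar> \<le> 2 * (norm x * norm y)" for j
  proof -
    have "\<bar>x $ j * y $ j\<bar> \<le> norm x * norm y"
      by (auto simp: abs_mult component_le_norm_cart intro!: mult_mono)
    moreover have "u * (norm x * norm y) \<le> norm x * norm y"
      using assms(3,4) by (intro mult_left_le_one_le mult_nonneg_nonneg) auto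
    ultimately show ?thesis using q(2)[of j] by linarith
  qed
  then have sum_q: "(\<Sum>j\<in>UNIV. \<bar>q j\<bar>) \<le> CARD('n) * (2 * (norm x * norm y))"
    by (intro sum_bounded_above[where A = "UNIV::'n set", simplified]) simp
  have fs: "v \<in> Fl" "\<bar>v - sum q UNIV\<bar> \<le> (2 ^ CARD('n) - 1) * u * (\<Sum>j\<in>UNIV. \<bar>q j\<bar>)"
    using fp_sum_error[of fl q UNIV v u Fl] assms q(1) by (auto simp: fp_inner_def q_def[abs_def])
  then show "v \<in> Fl" by simp
  note fs(2)
  also have "(2 ^ CARD('n) - 1) * u * (\<Sum>j\<in>UNIV. \<bar>q j\<bar>) \<le> 2 ^ CARD('n) * u * (CARD('n) * (2 * (norm x * norm y)))"
    using sum_q assms(3) by (intro mult_mono) (auto simp: sum_nonneg)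
  finally have 1: "\<bar>v - sum q UNIV\<bar> \<le> 2 * 2 ^ CARD('n) * CARD('n) * (u * (norm x * norm y))"
    by (simp add: mult_ac)
  have "\<bar>sum q UNIV - x \<bullet> y\<bar> = \<bar>\<Sum>j\<in>UNIV. (q j - x $ j * y $ j)\<bar>"
    by (simp add: inner_vec_def sum_subtractf)
  also have "\<dots> \<le> (\<Sum>j\<in>(UNIV::'n set). u * (norm x * norm y))"
    by (rule order_trans[OF sum_abs sum_mono]) (rule q)
  finally have "\<bar>sum q UNIV - x \<bullet> y\<bar> \<le> CARD('n) * (u * (norm x * norm y))" by simp
  with 1 show "\<bar>v - x \<bullet> y\<bar> \<le> (2 * 2 ^ CARD('n) + 1) * CARD('n) * (u * (norm x * norm y))"
    by (simp add: algebra_simps)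
qed

text \<open>Left and right bracketing of two additive operations; the three evaluation orders of a -
  b + c are instances of these.\<close>

lemma fp_two_ops_error:
  assumes "fp_model u Fl fl" "0 \<le> u" "u \<le> 1" "op \<in> {FAdd, FSub}" "op' \<in> {FAdd, FSub}"
    and "a \<in> Fl" "b \<in> Fl" "c \<in> Fl"
  shows "fl op' (fl op a b) c \<in> Fl"
    and "\<bar>fl op' (fl op a b) c - exact_op op' (exact_op op a b) c\<bar> \<le> 3 * (u * (\<bar>a\<bar> + \<bar>b\<bar> + \<bar>c\<bar>))"
    and "fl op' a (fl op b c) \<in> Fl"
    and "\<bar>fl op' a (fl op b c) - exact_op op' a (exact_op op b c)\<bar> \<le> 3 * (u * (\<bar>a\<bar> + \<bar>b\<bar> + \<bar>c\<bar>))"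
proof -
  \<comment> \<open>Here \<open>e\<close> is the outer operation applied exactly to the rounded
    inner result and \<open>e'\<close> is the exact value. The inner error gives one
    \<open>u * S\<close>, the outer rounding at most two.\<close>
  have key: "\<bar>r - e'\<bar> \<le> 3 * (u * S)"
    if "\<bar>r - e\<bar> \<le> u * \<bar>e\<bar>" "\<bar>e - e'\<bar> \<le> u * S" "\<bar>e'\<bar> \<le> S" for r e e' S
  proof -
    have "u * \<bar>e\<bar> \<le> u * (S + u * S)" using that assms(2) by (intro mult_left_mono) auto
    moreover have "u * (u * S) \<le> u * S"
      using that assms(2,3) by (intro mult_left_le_one_le) auto
    ultimately show ?thesis using that by (simp add: distrib_left)
  qed
  have ex: "\<bar>exact_op o' x y\<bar> \<le> \<bar>x\<bar> + \<bar>y\<bar>" "\<bar>exact_op o' x y - exact_op o' x' y\<bar> = \<bar>x - x'\<bar>"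
    "\<bar>exact_op o' x y - exact_op o' x y'\<bar> = \<bar>y - y'\<bar>" if "o' \<in> {FAdd, FSub}" for o' x x' y y'
    using that by auto
  note op = assms(4)[simplified] and op' = assms(5)[simplified]
  have F: "fl op a b \<in> Fl" "fl op b c \<in> Fl"
    using assms op by (auto intro: fp_model_op(1))
  show "fl op' (fl op a b) c \<in> Fl" "fl op' a (fl op b c) \<in> Fl"
    using assms(1,6,8) F op' by (auto intro: fp_model_op(1))
  have err: "\<bar>fl op a b - exact_op op a b\<bar> \<le> u * \<bar>exact_op op a b\<bar>"
    "\<bar>fl op b c - exact_op op b c\<bar> \<le> u * \<bar>exact_op op b c\<bar>"
    "\<bar>fl op' (fl op a b) c - exact_op op' (fl op a b) c\<bar> \<le> u * \<bar>exact_op op' (fl op a b) c\<bar>"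
    "\<bar>fl op' a (fl op b c) - exact_op op' a (fl op b c)\<bar> \<le> u * \<bar>exact_op op' a (fl op b c)\<bar>"
    using assms(1,6-8) F op op' by (auto intro!: fp_model_op(2))
  have "u * \<bar>exact_op op a b\<bar> \<le> u * (\<bar>a\<bar> + \<bar>b\<bar> + \<bar>c\<bar>)" "u * \<bar>exact_op op b c\<bar> \<le> u * (\<bar>a\<bar> + \<bar>b\<bar> + \<bar>c\<bar>)"
    using order_trans[OF ex(1)[OF assms(4)]] by (intro mult_left_mono assms(2); simp)+
  note le = order_trans[OF err(1) this(1)] order_trans[OF err(2) this(2)]
  show "\<bar>fl op' (fl op a b) c - exact_op op' (exact_op op a b) c\<bar> \<le> 3 * (u * (\<bar>a\<bar> + \<bar>b\<bar> + \<bar>c\<bar>))"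
  proof (rule key[of _ "exact_op op' (fl op a b) c"])
    show "\<bar>exact_op op' (exact_op op a b) c\<bar> \<le> \<bar>a\<bar> + \<bar>b\<bar> + \<bar>c\<bar>"
      using ex(1)[OF assms(5), of "exact_op op a b" c] ex(1)[OF assms(4), of a b] by linarith
  qed (use err(3) le(1) in \<open>simp_all only: ex(2)[OF assms(5)]\<close>)
  show "\<bar>fl op' a (fl op b c) - exact_op op' a (exact_op op b c)\<bar> \<le> 3 * (u * (\<bar>a\<bar> + \<bar>b\<bar> + \<bar>c\<bar>))"
  proof (rule key[of _ "exact_op op' a (fl op b c)"])
    show "\<bar>exact_op op' a (exact_op op b c)\<bar> \<le> \<bar>a\<bar> + \<bar>b\<bar> + \<bar>c\<bar>"
      using ex(1)[OF assms(5), of a "exact_op op b c"] ex(1)[OF assms(4), of b c] by linarith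
  qed (use err(4) le(2) in \<open>simp_all only: ex(3)[OF assms(5)]\<close>)
qed

lemma fp_diff_plus_error:
  assumes "w \<in> fp_diff_plus fl a b c" "fp_model u Fl fl" "0 \<le> u" "u \<le> 1" "a \<in> Fl" "b \<in> Fl" "c \<in> Fl"
  shows "w \<in> Fl" and "\<bar>w - (a - b + c)\<bar> \<le> 3 * (u * (\<bar>a\<bar> + \<bar>b\<bar> + \<bar>c\<bar>))"
proof -
  note e = fp_two_ops_error[OF assms(2-4)]
  from e(1,2)[of FSub FAdd a b c] e(1,2)[of FAdd FSub a c b] e(3,4)[of FSub FAdd a c b]
  show "w \<in> Fl" "\<bar>w - (a - b + c)\<bar> \<le> 3 * (u * (\<bar>a\<bar> + \<bar>b\<bar> + \<bar>c\<bar>))"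
    using assms(1,5-7) by (auto simp: fp_diff_plus_def algebra_simps)
qed

section \<open>The maximal step length\<close>

lemma max_step_bounds:
  fixes l s dl ds :: "real^'m"
  assumes "\<And>i. 0 \<le> l $ i" "\<And>i. 0 \<le> s $ i" "0 \<le> a" "a \<le> 1"
    and "\<And>\<alpha> i. 0 \<le> \<alpha> \<Longrightarrow> \<alpha> \<le> a \<Longrightarrow> 0 \<le> l $ i + \<alpha> * dl $ i \<and> 0 \<le> s $ i + \<alpha> * ds $ i"
  shows "a \<le> max_step l s dl ds" "max_step l s dl ds \<le> 1"
proof -
  define N where "N b i = (0 \<le> l $ i + b * dl $ i \<and> 0 \<le> s $ i + b * ds $ i)" for b i
  define P where "P b \<longleftrightarrow> b \<in> {0..1} \<and> (\<forall>\<alpha>\<in>{0..b}. \<forall>i. N \<alpha> i)" for b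
  have P_max: "max_step l s dl ds = Greatest P"
  proof -
    have "P = (\<lambda>b. b \<in> {0..1} \<and> (\<forall>\<alpha>\<in>{0..b}. \<forall>i. 0 \<le> (l + \<alpha> *\<^sub>R dl) $ i \<and> 0 \<le> (s + \<alpha> *\<^sub>R ds) $ i))"
      by (intro ext) (simp add: P_def N_def)
    then show ?thesis by (simp only: max_step_def)
  qed
  \<comment> \<open>Writing \<alpha> as \<open>\<theta> * b\<close> makes the range of the
    quantifier independent of \<open>b\<close>, so the admissible step lengths form an intersection
    of closed sets in the unit interval. Compactness then shows that the greatest element exists.
    The case \<open>b = 0\<close>, where \<theta> cannot be recovered, is covered by the signs of
    \<open>l\<close> and \<open>s\<close>.\<close>
  have P_eq: "Collect P = {0..1} \<inter> (\<Inter>\<theta>\<in>{0..1}. \<Inter>i. {b. N (\<theta> * b) i})"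
    (is "_ = ?R")
  proof (intro equalityI subsetI)
    fix b assume "b \<in> Collect P"
    then have b: "b \<in> {0..1}" "\<And>\<alpha> i. \<alpha> \<in> {0..b} \<Longrightarrow> N \<alpha> i" by (auto simp: P_def)
    have "N (\<theta> * b) i" if "\<theta> \<in> {0..1}" for \<theta> i
      using that b(1) by (intro b(2)) (simp add: mult_left_le_one_le)
    with b(1) show "b \<in> ?R" by blast
  next
    fix b assume b: "b \<in> ?R"
    have "N \<alpha> i" if \<alpha>: "\<alpha> \<in> {0..b}" for \<alpha> i
    proof (cases "b = 0")
      case True
      then show ?thesis using \<alpha> assms(1,2) by (simp add: N_def)
    next
      case False
      then have "\<alpha> / b \<in> {0..1}" "\<alpha> / b * b = \<alpha>" using \<alpha> b by (auto simp: divide_simps)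
      moreover have "N (\<alpha> / b * b) i" using b calculation(1) by blast
      ultimately show ?thesis by simp
    qed
    then show "b \<in> Collect P" using b unfolding P_def by blast
  qed
  have cl: "closed {b. N (\<theta> * b) i}" for \<theta> i
  proof -
    have "closed {b. 0 \<le> l $ i + \<theta> * b * dl $ i}" "closed {b. 0 \<le> s $ i + \<theta> * b * ds $ i}"
      by (intro closed_Collect_le continuous_intros)+
    then show ?thesis unfolding N_def Collect_conj_eq by (rule closed_Int)
  qed
  have "compact (Collect P)"
    unfolding P_eq by (intro compact_Int_closed compact_Icc closed_INT ballI cl)
  moreover have "P 0" using assms(1,2) by (simp add: P_def N_def)
  ultimately obtain b where b: "P b" "\<And>b'. P b' \<Longrightarrow> b' \<le> b"
    using compact_attains_sup[of "Collect P"] by blast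
  then have "max_step l s dl ds = b"
    unfolding P_max by (intro Greatest_equality) auto
  moreover have "P a" using assms(3-5) unfolding P_def N_def by auto
  ultimately show "a \<le> max_step l s dl ds" "max_step l s dl ds \<le> 1" using b by (auto simp: P_def)
qed

section \<open>Iterates close to the solution set\<close>

declare transpose_matrix_vector [simp del]

lemma multipliers_inactive:
  assumes "l \<in> multipliers \<phi> g zs" "i \<notin> active g zs"
  shows "l $ i = 0"
proof -
  have *: "g zs $ j \<le> 0" "0 \<le> l $ j" "l \<bullet> g zs = 0" for j
    using assms(1) by (auto simp: multipliers_def KKT_def)
  have "(\<Sum>j\<in>UNIV. - (l $ j * g zs $ j)) = 0"
    using *(3) by (simp add: inner_vec_def sum_negf)
  moreover have "0 \<le> - (l $ j * g zs $ j)" for j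
    using *(1,2)[of j] by (simp add: mult_le_0_iff)
  ultimately have "l $ i * g zs $ i = 0"
    by (simp add: sum_nonneg_eq_0_iff)
  then show ?thesis using assms(2) by (simp add: active_def)
qed

text \<open>Pairing the stationarity equation with an MFCQ direction gives a sum of nonnegative
  terms with a fixed value, so each term, and with it each active multiplier, is bounded by that
  value.\<close>

lemma multipliers_bounded:
  fixes \<phi> :: "real^'n \<Rightarrow> real" and g :: "real^'n \<Rightarrow> real^'m"
  assumes "twice_lipschitz_differentiable \<phi>" "\<And>i. twice_lipschitz_differentiable (\<lambda>z. g z $ i)"
    and "MFCQ g zs"
  obtains M where "\<And>l. l \<in> multipliers \<phi> g zs \<Longrightarrow> norm l \<le> M"
proof -
  obtain y where y: "\<And>i. i \<in> active g zs \<Longrightarrow> grad_g g zs i \<bullet> y < 0"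
    using assms(3) by (auto simp: MFCQ_def)
  define M where "M = (\<Sum>i\<in>active g zs. \<bar>gradient \<phi> zs \<bullet> y\<bar> / (- (grad_g g zs i \<bullet> y)))"
  have "norm l \<le> M" if l: "l \<in> multipliers \<phi> g zs" for l
  proof -
    have l0: "0 \<le> l $ i" for i using l by (simp add: multipliers_def KKT_def)
    have "gradient \<phi> zs + (\<Sum>i\<in>UNIV. l $ i *\<^sub>R grad_g g zs i) = 0"
      using l by (simp add: multipliers_def KKT_def Lz_eq[OF assms(1,2)] nabla_g_mult_vector)
    then have "(gradient \<phi> zs + (\<Sum>i\<in>UNIV. l $ i *\<^sub>R grad_g g zs i)) \<bullet> y = 0" by simp
    then have eq: "(\<Sum>i\<in>UNIV. l $ i * (- (grad_g g zs i \<bullet> y))) = gradient \<phi> zs \<bullet> y"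
      by (simp add: inner_add_left inner_sum_left sum_negf)
    have nn: "0 \<le> l $ i * (- (grad_g g zs i \<bullet> y))" for i
      using l0[of i] y[of i] multipliers_inactive[OF l, of i] by (cases "i \<in> active g zs") (auto simp: mult_le_0_iff less_imp_le)
    have le: "l $ i * (- (grad_g g zs i \<bullet> y)) \<le> \<bar>gradient \<phi> zs \<bullet> y\<bar>" for i
      using member_le_sum[of i UNIV "\<lambda>i. l $ i * (- (grad_g g zs i \<bullet> y))"] nn eq by simp
    have "norm l \<le> (\<Sum>i\<in>UNIV. \<bar>l $ i\<bar>)" by (rule norm_le_l1_cart)
    also have "\<dots> = (\<Sum>i\<in>active g zs. l $ i)"
      using l0 multipliers_inactive[OF l] by (intro sum.mono_neutral_cong_right) auto
    also have "\<dots> \<le> M"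
      unfolding M_def
    proof (rule sum_mono)
      fix i assume "i \<in> active g zs"
      then have "0 < - (grad_g g zs i \<bullet> y)" using y by auto
      then show "l $ i \<le> \<bar>gradient \<phi> zs \<bullet> y\<bar> / (- (grad_g g zs i \<bullet> y))"
        using le[of i] by (subst pos_le_divide_eq) auto
    qed
    finally show ?thesis .
  qed
  then show ?thesis by (rule that)
qed

text \<open>Columns outside \<open>B\<close> are set to zero rather than removed, so the active
  block keeps the index type of the constraints and products with full multiplier vectors make
  sense.\<close>

definition nabla_g_on :: "'m set \<Rightarrow> (real^'n \<Rightarrow> real^'m) \<Rightarrow> real^'n \<Rightarrow> real^'m^'n" where
  "nabla_g_on B g z = (\<chi> j i. if i \<in> B then grad_g g z i $ j else 0)"

lemma nabla_g_on_mult_vector: "nabla_g_on B g z *v v = (\<Sum>i\<in>B. v $ i *\<^sub>R grad_g g z i)"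
  unfolding vec_eq_iff
  by (auto simp: nabla_g_on_def matrix_vector_mult_def mult.commute intro!: sum.mono_neutral_cong_right)

lemma transpose_nabla_g_on_mult_vector:
  "(transpose (nabla_g_on B g z) *v p) $ i = (if i \<in> B then grad_g g z i \<bullet> p else 0)"
  by (simp add: nabla_g_on_def matrix_vector_mult_def transpose_def inner_vec_def)

lemma inner_matrix_vector: "p \<bullet> (A *v v) = (transpose A *v p) \<bullet> v" for p :: "real^'n" and A :: "real^'m^'n"
  using dot_lmul_matrix[of p A v] by (simp add: transpose_matrix_vector)

text \<open>Iterates of a sequence of instances, before any step is taken. Only the distance to the
  solution set tends to zero; convergence of \<open>l\<close> is not assumed.\<close>

locale kkt_sequence =
  fixes \<phi> :: "real^'n \<Rightarrow> real" and g :: "real^'n \<Rightarrow> real^'m" and zs :: "real^'n"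
    and C \<gamma> :: real and z :: "nat \<Rightarrow> real^'n" and l s :: "nat \<Rightarrow> real^'m"
  assumes smooth: "twice_lipschitz_differentiable \<phi>" "\<And>i. twice_lipschitz_differentiable (\<lambda>z. g z $ i)"
    and sol: "solution_conditions \<phi> g zs"
    and \<gamma>: "0 < \<gamma>"
    and pos: "\<And>n i. 0 < l n $ i" "\<And>n i. 0 < s n $ i"
    and centred: "\<And>n i. \<gamma> * mu (l n) (s n) \<le> l n $ i * s n $ i"
    and residuals: "\<And>n. norm (Lz \<phi> g (z n) (l n)) \<le> C * mu (l n) (s n)"
      "\<And>n. norm (g (z n) + s n) \<le> C * mu (l n) (s n)"
    and dist_lim: "(\<lambda>n. sol_dist \<phi> g zs (z n) (l n)) \<longlonglongrightarrow> 0"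
    and mu_lim: "(\<lambda>n. mu (l n) (s n)) \<longlonglongrightarrow> 0"
begin

definition m :: "nat \<Rightarrow> real" where "m n = mu (l n) (s n)"
definition d :: "nat \<Rightarrow> real^'n" where "d n = z n - zs"
definition B :: "'m set" where "B = active g zs"
definition A :: "real^'m^'n" where "A = nabla_g_on B g zs"
text \<open>A multiplier that is nearest up to the slack \<open>m n\<close>. The positive slack
  makes its existence immediate from the infimum, without attainment.\<close>

definition ls :: "nat \<Rightarrow> real^'m" where
  "ls n = (SOME y. y \<in> multipliers \<phi> g zs \<and> dist (z n, l n) (zs, y) < sol_dist \<phi> g zs (z n) (l n) + m n)"
abbreviation "Hs n \<equiv> Lzz \<phi> g zs (ls n)"
abbreviation "H n \<equiv> Lzz \<phi> g (z n) (l n)"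

lemma sum_complementarity: "(\<Sum>i\<in>UNIV. l n $ i * s n $ i) = real CARD('m) * m n"
  by (simp add: m_def mu_def inner_vec_def)

lemma m_pos [simp]: "0 < m n"
proof -
  have "0 < (\<Sum>i\<in>UNIV. l n $ i * s n $ i)" using pos by (intro sum_pos) auto
  then show ?thesis unfolding sum_complementarity by (simp add: zero_less_mult_iff)
qed

lemma m_nonneg [simp]: "0 \<le> m n"
  by (rule less_imp_le[OF m_pos])

lemma m_lim: "m \<longlonglongrightarrow> 0"
  using mu_lim by (simp add: m_def[abs_def])

lemma complementarity: "(\<lambda>n. l n $ i * s n $ i) \<preceq> m"
proof (rule lesssimI[of _ "real CARD('m)"], rule always_eventually, rule allI)
  fix n
  have "l n $ i * s n $ i \<le> (\<Sum>i\<in>UNIV. l n $ i * s n $ i)"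
    using pos by (intro member_le_sum) (auto simp: less_imp_le)
  then show "norm (l n $ i * s n $ i) \<le> real CARD('m) * m n"
    using pos[of n i] by (simp add: sum_complementarity abs_mult)
qed

lemma residual_Lz: "(\<lambda>n. Lz \<phi> g (z n) (l n)) \<preceq> m"
  by (rule lesssimI[of _ C]) (use residuals in \<open>auto simp: m_def\<close>)

lemma residual_g: "(\<lambda>n. g (z n) + s n) \<preceq> m"
  by (rule lesssimI[of _ C]) (use residuals in \<open>auto simp: m_def\<close>)

lemma ls: "ls n \<in> multipliers \<phi> g zs"
  and ls_dist: "dist (z n, l n) (zs, ls n) < sol_dist \<phi> g zs (z n) (l n) + m n"
proof -
  let ?S = "{zs} \<times> multipliers \<phi> g zs"
  have ne: "?S \<noteq> {}" using sol by (auto simp: solution_conditions_def)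
  have "(INF a\<in>?S. dist (z n, l n) a) < sol_dist \<phi> g zs (z n) (l n) + m n"
    using ne by (simp add: sol_dist_def infdist_notempty)
  moreover have bdd: "bdd_below (dist (z n, l n) ` ?S)"
    by (rule bdd_belowI2[of _ 0]) simp
  ultimately obtain a where "a \<in> ?S" "dist (z n, l n) a < sol_dist \<phi> g zs (z n) (l n) + m n"
    using cINF_less_iff[OF ne bdd] by blast
  then have "\<exists>y. y \<in> multipliers \<phi> g zs \<and> dist (z n, l n) (zs, y) < sol_dist \<phi> g zs (z n) (l n) + m n"
    by auto
  from someI_ex[OF this]
  show "ls n \<in> multipliers \<phi> g zs" "dist (z n, l n) (zs, ls n) < sol_dist \<phi> g zs (z n) (l n) + m n"
    unfolding ls_def by auto
qed

lemma d_lim: "d \<longlonglongrightarrow> 0" and l_ls_lim: "(\<lambda>n. l n - ls n) \<longlonglongrightarrow> 0"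
proof -
  have lim: "(\<lambda>n. sol_dist \<phi> g zs (z n) (l n) + m n) \<longlonglongrightarrow> 0"
    using tendsto_add[OF dist_lim m_lim] by simp
  have "norm (d n) \<le> sol_dist \<phi> g zs (z n) (l n) + m n" for n
    using order_trans[OF dist_fst_le less_imp_le[OF ls_dist[of n]]] by (simp add: d_def dist_norm)
  then show "d \<longlonglongrightarrow> 0" by (intro Lim_null_comparison[OF _ lim]) auto
  have "norm (l n - ls n) \<le> sol_dist \<phi> g zs (z n) (l n) + m n" for n
    using order_trans[OF dist_snd_le less_imp_le[OF ls_dist[of n]]] by (simp add: dist_norm)
  then show "(\<lambda>n. l n - ls n) \<longlonglongrightarrow> 0" by (intro Lim_null_comparison[OF _ lim]) auto
qed

lemma z_lim: "z \<longlonglongrightarrow> zs"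
  using d_lim unfolding d_def[abs_def] by (simp add: LIM_zero_iff)

lemma ls_bounded: "ls \<preceq> (\<lambda>_. 1)"
proof -
  obtain M where M: "\<And>l. l \<in> multipliers \<phi> g zs \<Longrightarrow> norm l \<le> M"
    using multipliers_bounded[OF smooth] sol by (auto simp: solution_conditions_def)
  show ?thesis by (rule lesssimI[of _ M]) (use M ls in auto)
qed

lemma l_bounded: "l \<preceq> (\<lambda>_. 1)"
  using lesssim_add[OF lesssim_tendsto[OF l_ls_lim] ls_bounded] by simp

lemma nabla_g_diff:
  assumes "x \<longlonglongrightarrow> zs" "y \<longlonglongrightarrow> zs"
  shows "(\<lambda>n. nabla_g g (y n) - nabla_g g (x n)) \<preceq> (\<lambda>n. norm (y n - x n))"
proof (intro lesssim_vec)
  fix j i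
  have "(\<lambda>n. grad_g g (y n) i - grad_g g (x n) i) \<preceq> (\<lambda>n. norm (y n - x n))"
    using twice_lipschitz_lesssim(2)[OF smooth(2)[of i] assms] by (simp add: grad_g_def)
  from lesssim_nth[OF this, of j]
  show "(\<lambda>n. (nabla_g g (y n) - nabla_g g (x n)) $ j $ i) \<preceq> (\<lambda>n. norm (y n - x n))"
    by (simp add: nabla_g_def)
qed

lemma g_expansion:
  assumes "x \<longlonglongrightarrow> zs" "y \<longlonglongrightarrow> zs"
  shows "(\<lambda>n. g (y n) - g (x n) - transpose (nabla_g g (x n)) *v (y n - x n)) \<preceq> (\<lambda>n. (norm (y n - x n))\<^sup>2)"
proof (rule lesssim_vec)
  fix i
  show "(\<lambda>n. (g (y n) - g (x n) - transpose (nabla_g g (x n)) *v (y n - x n)) $ i) \<preceq> (\<lambda>n. (norm (y n - x n))\<^sup>2)"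
    using twice_lipschitz_lesssim(4)[OF smooth(2)[of i] assms]
    by (simp add: transpose_nabla_g_mult_vector grad_g_def)
qed

lemma Lzz_diff:
  assumes "x \<longlonglongrightarrow> zs" "y \<longlonglongrightarrow> zs" "L \<preceq> (\<lambda>_. 1)"
  shows "(\<lambda>n. Lzz \<phi> g (y n) (L n) - Lzz \<phi> g (x n) (L n)) \<preceq> (\<lambda>n. norm (y n - x n))"
proof -
  have "(\<lambda>n. (hessian \<phi> (y n) - hessian \<phi> (x n)) + (\<Sum>i\<in>UNIV. L n $ i *\<^sub>R (hessian (\<lambda>y. g y $ i) (y n) - hessian (\<lambda>y. g y $ i) (x n))))
      \<preceq> (\<lambda>n. norm (y n - x n))"
  proof (intro lesssim_add lesssim_sum)
    fix i
    show "(\<lambda>n. L n $ i *\<^sub>R (hessian (\<lambda>y. g y $ i) (y n) - hessian (\<lambda>y. g y $ i) (x n))) \<preceq> (\<lambda>n. norm (y n - x n))"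
      using lesssim_scaleR[OF lesssim_nth[OF assms(3), of i] twice_lipschitz_lesssim(1)[OF smooth(2)[of i] assms(1,2)]] by simp
  qed (rule twice_lipschitz_lesssim(1)[OF smooth(1) assms(1,2)])
  then show ?thesis
    by (simp add: Lzz_eq[OF smooth] scaleR_diff_right sum_subtractf algebra_simps)
qed

lemma Lz_expansion:
  assumes "x \<longlonglongrightarrow> zs" "y \<longlonglongrightarrow> zs" "L \<preceq> (\<lambda>_. 1)"
  shows "(\<lambda>n. Lz \<phi> g (y n) (L n) - Lz \<phi> g (x n) (L n) - Lzz \<phi> g (x n) (L n) *v (y n - x n)) \<preceq> (\<lambda>n. (norm (y n - x n))\<^sup>2)"
    (is "?X \<preceq> ?Y")
proof -
  let ?r = "\<lambda>f n. gradient f (y n) - gradient f (x n) - hessian f (x n) *v (y n - x n)"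
  have "(\<lambda>n. ?r \<phi> n + (\<Sum>i\<in>UNIV. L n $ i *\<^sub>R ?r (\<lambda>y. g y $ i) n)) \<preceq> ?Y"
  proof (intro lesssim_add lesssim_sum)
    fix i
    show "(\<lambda>n. L n $ i *\<^sub>R ?r (\<lambda>y. g y $ i) n) \<preceq> ?Y"
      using lesssim_scaleR[OF lesssim_nth[OF assms(3), of i] twice_lipschitz_lesssim(3)[OF smooth(2)[of i] assms(1,2)]] by simp
  qed (rule twice_lipschitz_lesssim(3)[OF smooth(1) assms(1,2)])
  moreover have "?r \<phi> n + (\<Sum>i\<in>UNIV. L n $ i *\<^sub>R ?r (\<lambda>y. g y $ i) n) = ?X n" for n
    by (simp add: Lz_eq[OF smooth] Lzz_eq[OF smooth] nabla_g_mult_vector grad_g_def scaleR_diff_right sum_subtractf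
        matrix_vector_mult_add_rdistrib bounded_bilinear.sum_left[OF bounded_bilinear_matrix_vector]
        scaleR_matrix_vector_assoc)
  ultimately show ?thesis by simp
qed

lemma Lz_diff: "Lz \<phi> g x L - Lz \<phi> g x L' = nabla_g g x *v (L - L')"
  by (simp add: Lz_eq[OF smooth] matrix_vector_mult_diff_distrib)

lemma Lzz_diff_multiplier:
  "(\<lambda>n. Lzz \<phi> g zs (L n) - Lzz \<phi> g zs (L' n)) \<preceq> (\<lambda>n. norm (L n - L' n))"
proof -
  have "(\<lambda>n. \<Sum>i\<in>UNIV. (L n - L' n) $ i *\<^sub>R hessian (\<lambda>y. g y $ i) zs) \<preceq> (\<lambda>n. norm (L n - L' n))"
  proof (intro lesssim_sum)
    fix i
    have "(\<lambda>n. L n - L' n) \<preceq> (\<lambda>n. norm (L n - L' n))" by (rule lesssimI[of _ 1]) simp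
    from lesssim_scaleR[OF lesssim_nth[OF this, of i] lesssim_const]
    show "(\<lambda>n. (L n - L' n) $ i *\<^sub>R hessian (\<lambda>y. g y $ i) zs) \<preceq> (\<lambda>n. norm (L n - L' n))" by simp
  qed
  then show ?thesis by (simp add: Lzz_eq[OF smooth] scaleR_diff_left sum_subtractf)
qed

lemma Hs_bounded: "Hs \<preceq> (\<lambda>_. 1)"
proof -
  have "(\<lambda>n. (Hs n - Lzz \<phi> g zs 0) + Lzz \<phi> g zs 0) \<preceq> (\<lambda>_. 1)"
    by (intro lesssim_add lesssim_const lesssim_trans[OF Lzz_diff_multiplier]) (simp add: ls_bounded)
  then show ?thesis by simp
qed

text \<open>The reference Hessian moves with \<open>ls n\<close>, so only the difference has a
  limit; boundedness of \<open>Hs\<close> replaces its convergence.\<close>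

lemma H_lim: "(\<lambda>n. H n - Hs n) \<longlonglongrightarrow> 0"
proof -
  have "(\<lambda>n. H n - Lzz \<phi> g zs (l n)) \<longlonglongrightarrow> 0"
    by (rule lesssim_tendsto_zero[OF Lzz_diff[OF tendsto_const z_lim l_bounded]])
       (use tendsto_norm_zero[OF d_lim] in \<open>simp add: d_def\<close>)
  moreover have "(\<lambda>n. Lzz \<phi> g zs (l n) - Hs n) \<longlonglongrightarrow> 0"
    by (rule lesssim_tendsto_zero[OF Lzz_diff_multiplier tendsto_norm_zero[OF l_ls_lim]])
  ultimately have "(\<lambda>n. (H n - Lzz \<phi> g zs (l n)) + (Lzz \<phi> g zs (l n) - Hs n)) \<longlonglongrightarrow> 0 + 0"
    by (rule tendsto_add)
  then show ?thesis by simp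
qed

text \<open>The kernel of \<open>transpose A\<close> consists of directions orthogonal to all active
  gradients and therefore lies in the critical cone. Both \<xi> and the bound on \<open>Hs\<close>
  are independent of the index, hence a single constant.\<close>

lemma coercive:
  "(\<lambda>n. (norm (p n))\<^sup>2) \<preceq> (\<lambda>n. \<bar>p n \<bullet> (Hs n *v p n)\<bar> + (norm (transpose A *v p n))\<^sup>2)"
proof -
  obtain \<xi> where \<xi>: "\<xi> > 0" and sosc: "\<And>l w. l \<in> multipliers \<phi> g zs \<Longrightarrow>
        (\<forall>i\<in>active_pos \<phi> g zs. grad_g g zs i \<bullet> w = 0) \<Longrightarrow>
        (\<forall>i\<in>active g zs - active_pos \<phi> g zs. grad_g g zs i \<bullet> w \<le> 0)
        \<Longrightarrow> \<xi> * (norm w)\<^sup>2 \<le> w \<bullet> (Lzz \<phi> g zs l *v w)"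
    using sol unfolding solution_conditions_def second_order_conditions_def by blast
  have pd: "\<xi> * (norm w)\<^sup>2 \<le> w \<bullet> (Hs n *v w)" if "transpose A *v w = 0" for w n
  proof (rule sosc[OF ls])
    have "grad_g g zs i \<bullet> w = 0" if "i \<in> active g zs" for i
      using \<open>transpose A *v w = 0\<close> that transpose_nabla_g_on_mult_vector[of B g zs w i]
      by (simp add: A_def B_def)
    then show "\<forall>i\<in>active_pos \<phi> g zs. grad_g g zs i \<bullet> w = 0"
      "\<forall>i\<in>active g zs - active_pos \<phi> g zs. grad_g g zs i \<bullet> w \<le> 0"
      by (auto simp: active_pos_def)
  qed
  obtain M where M: "\<forall>\<^sub>F n in sequentially. norm (Hs n) \<le> M * \<bar>1\<bar>"
    using Hs_bounded by (rule lesssimE)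
  obtain K where K: "K > 0" "\<And>(H::real^'n^'n) p. norm H \<le> M \<Longrightarrow>
       (\<And>w. transpose A *v w = 0 \<Longrightarrow> \<xi> * (norm w)\<^sup>2 \<le> w \<bullet> (H *v w)) \<Longrightarrow>
       (norm p)\<^sup>2 \<le> K * (\<bar>p \<bullet> (H *v p)\<bar> + (norm (transpose A *v p))\<^sup>2)"
    using coercive_on_kernel[OF \<xi>, of M A] by blast
  show ?thesis
  proof (rule lesssimI[of _ K], rule eventually_mono[OF M])
    fix n assume "norm (Hs n) \<le> M * \<bar>1\<bar>"
    then show "norm ((norm (p n))\<^sup>2) \<le> K * (\<bar>p n \<bullet> (Hs n *v p n)\<bar> + (norm (transpose A *v p n))\<^sup>2)"
      using K(2)[of "Hs n" "p n", OF _ pd] by simp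
  qed
qed

text \<open>What is known about a multiplier difference is mostly its image under \<open>A\<close>.
  The substitute \<open>w\<close> has the same image, is controlled by it, and stays supported on
  the active set.\<close>

lemma preimage:
  obtains w where "\<And>n i. i \<notin> B \<Longrightarrow> w n $ i = 0" "\<And>n. A *v w n = A *v (v n)" "w \<preceq> (\<lambda>n. norm (A *v v n))"
proof -
  let ?V = "{w. \<forall>i\<in>-B. w $ i = 0} :: (real^'m) set"
  have V: "subspace ?V" by (auto simp: subspace_def)
  obtain K where K: "K > 0" "\<And>v. v \<in> ?V \<Longrightarrow> \<exists>w\<in>?V. A *v w = A *v v \<and> norm w \<le> K * norm (A *v v)"
    by (rule bounded_preimage_on_subspace[OF matrix_vector_mul_linear[of A] V], rule that)
  have "\<forall>n. \<exists>w. w \<in> ?V \<and> A *v w = A *v v n \<and> norm w \<le> K * norm (A *v v n)"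
  proof
    fix n
    \<comment> \<open>\<open>A\<close> ignores the inactive components, so they may be cleared to
      reach the subspace on which bounded preimages are available.\<close>
    define v' :: "real^'m" where "v' = (\<chi> i. if i \<in> B then v n $ i else 0)"
    have "A *v v' = A *v v n" by (simp add: A_def nabla_g_on_mult_vector v'_def)
    moreover have "v' \<in> ?V" by (simp add: v'_def)
    ultimately show "\<exists>w. w \<in> ?V \<and> A *v w = A *v v n \<and> norm w \<le> K * norm (A *v v n)"
      using K(2)[of v'] by (simp add: Bex_def)
  qed
  from choice[OF this] obtain w where
    w: "\<forall>n. w n \<in> ?V \<and> A *v w n = A *v v n \<and> norm (w n) \<le> K * norm (A *v v n)" ..
  show ?thesis
    by (rule that[of w]) (use w in \<open>auto intro!: lesssimI[of _ K]\<close>)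
qed

text \<open>The slack converges to \<open>- g zs $ i\<close>, which is positive for an inactive
  constraint.\<close>

lemma inactive_s_bounded_below:
  assumes "i \<notin> B"
  obtains c where "c > 0" "\<forall>\<^sub>F n in sequentially. c \<le> s n $ i"
proof -
  have "g zs $ i \<le> 0" "g zs $ i \<noteq> 0"
    using assms sol unfolding B_def active_def solution_conditions_def nlp_solution_def nlp_feasible_def
    by blast+
  then have gi: "g zs $ i < 0" by simp
  have "(\<lambda>n. g (z n) $ i - g zs $ i - gradient (\<lambda>z. g z $ i) zs \<bullet> (z n - zs)) \<longlonglongrightarrow> 0"
    by (rule lesssim_tendsto_zero[OF twice_lipschitz_lesssim(4)[OF smooth(2)[of i] tendsto_const z_lim]])
       (use tendsto_power[OF tendsto_norm_zero[OF d_lim], of 2] in \<open>simp add: d_def\<close>)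
  moreover have "(\<lambda>n. gradient (\<lambda>z. g z $ i) zs \<bullet> (z n - zs)) \<longlonglongrightarrow> 0"
    using tendsto_inner[OF tendsto_const d_lim] by (simp add: d_def)
  moreover have "(\<lambda>n. (g (z n) + s n) $ i) \<longlonglongrightarrow> 0"
    by (rule lesssim_tendsto_zero[OF lesssim_nth[OF residual_g] m_lim])
  ultimately have "(\<lambda>n. (g (z n) + s n) $ i - (g (z n) $ i - g zs $ i - gradient (\<lambda>z. g z $ i) zs \<bullet> (z n - zs))
      - gradient (\<lambda>z. g z $ i) zs \<bullet> (z n - zs) - g zs $ i) \<longlonglongrightarrow> 0 - 0 - 0 - g zs $ i"
    by (intro tendsto_diff tendsto_const)
  then have "(\<lambda>n. s n $ i) \<longlonglongrightarrow> - g zs $ i" by simp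
  then have "\<forall>\<^sub>F n in sequentially. - g zs $ i / 2 < s n $ i"
    by (rule order_tendstoD) (use gi in simp)
  then show ?thesis
    using gi by (intro that[of "- g zs $ i / 2"]) (auto elim: eventually_mono)
qed

lemma inactive_l:
  assumes "i \<notin> B" shows "(\<lambda>n. l n $ i) \<preceq> m"
proof -
  obtain c where c: "c > 0" "\<forall>\<^sub>F n in sequentially. c \<le> s n $ i"
    using inactive_s_bounded_below[OF assms] .
  have "(\<lambda>n. inverse (s n $ i)) \<preceq> (\<lambda>n. inverse 1)"
    by (rule lesssim_inverse[OF c(1)]) (use c in auto)
  from lesssim_mult[OF complementarity this, of i]
  moreover have "l n $ i * s n $ i * inverse (s n $ i) = l n $ i" for n
    using pos(2)[of n i] by simp
  ultimately show ?thesis by simp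
qed

end

section \<open>Slacks of active constraints and the order of the primal error\<close>

context kkt_sequence
begin

text \<open>The leading term \<open>gradient \<phi> zs \<bullet> d n\<close> does not depend on
  \<open>L\<close>: stationarity turns the linearized constraints weighted by any multiplier into
  minus this term. Differences of two multipliers therefore see only the remainder.\<close>

lemma multiplier_inner_s:
  assumes "L \<preceq> (\<lambda>_. 1)" "\<And>n. L n \<in> multipliers \<phi> g zs"
  shows "(\<lambda>n. L n \<bullet> s n - gradient \<phi> zs \<bullet> d n) \<preceq> (\<lambda>n. m n + (norm (d n))\<^sup>2)"
proof -
  let ?T = "transpose (nabla_g g zs)"
  have "L n \<bullet> s n - gradient \<phi> zs \<bullet> d n = L n \<bullet> (g (z n) + s n) - L n \<bullet> (g (z n) - g zs - ?T *v d n)" for n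
  proof -
    have "L n \<bullet> g zs = 0" "gradient \<phi> zs + nabla_g g zs *v L n = 0"
      using assms(2)[of n] by (auto simp: multipliers_def KKT_def Lz_eq[OF smooth])
    then have "L n \<bullet> g zs = 0" "gradient \<phi> zs = - (nabla_g g zs *v L n)"
      using eq_neg_iff_add_eq_0 by blast+
    moreover have "L n \<bullet> (?T *v d n) = d n \<bullet> (nabla_g g zs *v L n)"
      using inner_matrix_vector[of "d n" "nabla_g g zs" "L n"] by (simp only: inner_commute[of "L n"])
    ultimately show ?thesis
      by (simp add: inner_add_right inner_diff_right inner_commute[of "d n"] inner_minus_left)
  qed
  moreover have "(\<lambda>n. L n \<bullet> (g (z n) + s n)) \<preceq> (\<lambda>n. m n + (norm (d n))\<^sup>2)"
    by (rule lesssim_mono[OF lesssim_inner[OF assms(1) residual_g]]) auto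
  moreover have "(\<lambda>n. L n \<bullet> (g (z n) - g zs - ?T *v d n)) \<preceq> (\<lambda>n. m n + (norm (d n))\<^sup>2)"
    by (rule lesssim_mono[OF lesssim_inner[OF assms(1) g_expansion[OF tendsto_const z_lim, folded d_def]]]) auto
  ultimately show ?thesis by (simp add: lesssim_diff)
qed

text \<open>Pairing \<open>s\<close> with the difference of a strictly complementary multiplier and the multiplier
  close to \<open>l\<close> cancels the first-order term.\<close>

lemma active_s_preliminary:
  assumes "i \<in> B"
  shows "(\<lambda>n. s n $ i) \<preceq> (\<lambda>n. m n + (norm (d n))\<^sup>2)"
proof -
  let ?Y = "\<lambda>n. m n + (norm (d n))\<^sup>2"
  define S where "S n = (\<Sum>i\<in>B. s n $ i)" for n
  define k where "k n = norm (l n - ls n)" for n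
  have S0: "0 \<le> S n" for n unfolding S_def using pos by (simp add: sum_nonneg less_imp_le)
  obtain lc where lc: "lc \<in> multipliers \<phi> g zs" "\<And>i. i \<in> B \<Longrightarrow> 0 < lc $ i"
    using sol by (auto simp: solution_conditions_def strict_complementarity_def B_def)
  have "(\<lambda>n. s n $ i) \<preceq> (\<lambda>n. lc \<bullet> s n)" if "i \<in> B" for i
  proof (rule lesssimI[of _ "1 / lc $ i"], rule always_eventually, rule allI)
    fix n
    have "lc $ i * s n $ i \<le> (\<Sum>i\<in>UNIV. lc $ i * s n $ i)"
      using lc(1) pos by (intro member_le_sum) (auto simp: multipliers_def KKT_def less_imp_le)
    then have "lc $ i * s n $ i \<le> lc \<bullet> s n" by (simp add: inner_vec_def)
    then show "norm (s n $ i) \<le> 1 / lc $ i * (lc \<bullet> s n)"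
      using lc(2)[OF that] pos(2)[of n i] by (simp add: field_simps)
  qed
  then have "S \<preceq> (\<lambda>n. lc \<bullet> s n)"
    unfolding S_def[abs_def] by (rule lesssim_sum)
  also have "(\<lambda>n. lc \<bullet> s n) \<preceq> (\<lambda>n. ?Y n + k n * norm (S n))"
  proof -
    have Y_le: "X \<preceq> (\<lambda>n. ?Y n + k n * norm (S n))" if "X \<preceq> ?Y" for X :: "nat \<Rightarrow> real"
      by (rule lesssim_mono[OF that]) (auto simp: k_def)
    have m_Y: "X \<preceq> ?Y" if "X \<preceq> m" for X :: "nat \<Rightarrow> real"
      by (rule lesssim_mono[OF that]) auto
    \<comment> \<open>The pairing with \<open>lc\<close> is written as that with \<open>ls\<close>,
      up to the cancelling first-order terms, and \<open>ls\<close> is traded for \<open>l\<close>,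
      whose pairing with \<open>s\<close> is known. The trade costs the active part of
      \<open>(l - ls) \<bullet> s\<close>, at most \<open>k n * S n\<close> with \<open>k\<close>
      tending to zero, and the inactive part, where \<open>ls\<close> vanishes.\<close>
    have eq: "lc \<bullet> s n = (lc \<bullet> s n - gradient \<phi> zs \<bullet> d n) - (ls n \<bullet> s n - gradient \<phi> zs \<bullet> d n)
        + (\<Sum>i\<in>UNIV. l n $ i * s n $ i) - (\<Sum>i\<in>B. (l n - ls n) $ i * s n $ i) - (\<Sum>i\<in>-B. l n $ i * s n $ i)" for n
    proof -
      have "(\<Sum>i\<in>-B. (l n - ls n) $ i * s n $ i) = (\<Sum>i\<in>-B. l n $ i * s n $ i)"
        using multipliers_inactive[OF ls] by (intro sum.cong) (auto simp: B_def)
      moreover have "(l n - ls n) \<bullet> s n = (\<Sum>i\<in>B. (l n - ls n) $ i * s n $ i) + (\<Sum>i\<in>-B. (l n - ls n) $ i * s n $ i)"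
        using sum.union_disjoint[of B "-B" "\<lambda>i. (l n - ls n) $ i * s n $ i"] by (simp add: inner_vec_def Un_commute)
      moreover have "(\<Sum>i\<in>UNIV. l n $ i * s n $ i) = l n \<bullet> s n" by (simp add: inner_vec_def)
      ultimately show ?thesis by (simp add: inner_diff_left)
    qed
    show ?thesis
    proof (subst ext[OF eq], rule lesssim_diff[OF lesssim_diff[OF lesssim_add[OF lesssim_diff]]])
      show "(\<lambda>n. lc \<bullet> s n - gradient \<phi> zs \<bullet> d n) \<preceq> (\<lambda>n. ?Y n + k n * norm (S n))"
        by (intro Y_le multiplier_inner_s lesssim_const lc(1))
      show "(\<lambda>n. ls n \<bullet> s n - gradient \<phi> zs \<bullet> d n) \<preceq> (\<lambda>n. ?Y n + k n * norm (S n))"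
        by (intro Y_le multiplier_inner_s ls_bounded ls)
      show "(\<lambda>n. \<Sum>i\<in>UNIV. l n $ i * s n $ i) \<preceq> (\<lambda>n. ?Y n + k n * norm (S n))"
        "(\<lambda>n. \<Sum>i\<in>-B. l n $ i * s n $ i) \<preceq> (\<lambda>n. ?Y n + k n * norm (S n))"
        by (intro Y_le m_Y lesssim_sum complementarity)+
      show "(\<lambda>n. \<Sum>i\<in>B. (l n - ls n) $ i * s n $ i) \<preceq> (\<lambda>n. ?Y n + k n * norm (S n))"
      proof (rule lesssimI[of _ 1], rule always_eventually, rule allI)
        fix n
        have "norm (\<Sum>i\<in>B. (l n - ls n) $ i * s n $ i) \<le> (\<Sum>i\<in>B. k n * s n $ i)"
        proof (rule sum_norm_le)
          fix i
          have "\<bar>(l n - ls n) $ i\<bar> \<le> k n" unfolding k_def by (rule component_le_norm_cart)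
          then show "norm ((l n - ls n) $ i * s n $ i) \<le> k n * s n $ i"
            using pos(2)[of n i] by (simp add: abs_mult mult_right_mono)
        qed
        also have "\<dots> = k n * norm (S n)" using S0 by (simp add: S_def sum_distrib_left[symmetric])
        also have "\<dots> \<le> ?Y n + k n * norm (S n)" by simp
        finally show "norm (\<Sum>i\<in>B. (l n - ls n) $ i * s n $ i) \<le> 1 * (?Y n + k n * norm (S n))" by simp
      qed
    qed
  qed
  finally (lesssim_trans) have "S \<preceq> ?Y"
    by (rule lesssim_absorb) (use tendsto_norm_zero[OF l_ls_lim] in \<open>auto simp: k_def[abs_def]\<close>)
  moreover have "norm (s n $ i) \<le> norm (S n)" for n
    using member_le_sum[of i B "\<lambda>i. s n $ i"] assms pos(2)[of n] S0[of n] by (simp add: S_def less_imp_le)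
  ultimately show ?thesis by (auto intro: lesssim_norm_le)
qed

lemma transpose_A_d:
  "(\<lambda>n. transpose A *v d n) \<preceq> (\<lambda>n. m n + (norm (d n))\<^sup>2)"
proof (rule lesssim_vec)
  fix i
  show "(\<lambda>n. (transpose A *v d n) $ i) \<preceq> (\<lambda>n. m n + (norm (d n))\<^sup>2)"
  proof (cases "i \<in> B")
    case True
    then have eq: "(transpose A *v d n) $ i = (g (z n) + s n) $ i - s n $ i - (g (z n) - g zs - transpose (nabla_g g zs) *v d n) $ i" for n
      by (simp add: A_def transpose_nabla_g_on_mult_vector transpose_nabla_g_mult_vector B_def active_def)
    show ?thesis
      unfolding eq
    proof (intro lesssim_diff active_s_preliminary True)
      show "(\<lambda>n. (g (z n) + s n) $ i) \<preceq> (\<lambda>n. m n + (norm (d n))\<^sup>2)"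
        by (rule lesssim_mono[OF lesssim_nth[OF residual_g]]) auto
      show "(\<lambda>n. (g (z n) - g zs - transpose (nabla_g g zs) *v d n) $ i) \<preceq> (\<lambda>n. m n + (norm (d n))\<^sup>2)"
        by (rule lesssim_mono[OF lesssim_nth[OF g_expansion[OF tendsto_const z_lim, folded d_def]]]) auto
    qed
  qed (simp add: A_def transpose_nabla_g_on_mult_vector)
qed

lemma nabla_g_zs_split:
  "nabla_g g zs *v v = A *v v + (\<Sum>i\<in>-B. v $ i *\<^sub>R grad_g g zs i)"
  using sum.union_disjoint[of B "-B" "\<lambda>i. v $ i *\<^sub>R grad_g g zs i"]
  by (simp add: A_def nabla_g_on_mult_vector nabla_g_mult_vector Un_commute)

text \<open>The quadratic form of \<open>Hs\<close> at \<open>d\<close> equals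
  \<open>d \<bullet> \<rho>\<close> minus \<open>(transpose A *v d) \<bullet> (l - ls)\<close>. Both
  products are small enough to be absorbed, provided the second factor of the latter is replaced by
  something of order \<open>m + D\<close>; coercivity then bounds \<open>D\<close> itself.\<close>

lemma d_order: "d \<preceq> m"
proof -
  define D where "D n = norm (d n)" for n
  define k where "k n = norm (l n - ls n)" for n
  have D0: "0 \<le> D n" and k0: "0 \<le> k n" for n by (auto simp: D_def k_def)
  have D: "D \<longlonglongrightarrow> 0" unfolding D_def[abs_def] by (rule tendsto_norm_zero[OF d_lim])
  have k: "k \<longlonglongrightarrow> 0" unfolding k_def[abs_def] by (rule tendsto_norm_zero[OF l_ls_lim])
  have dD: "d \<preceq> D" by (rule lesssimI[of _ 1]) (simp add: D_def)
  \<comment> \<open>The stationarity condition linearized at the solution. Its size exceeds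
    \<open>m\<close> only by terms quadratic in \<open>D\<close> or weighted with
    \<open>k\<close>.\<close>
  define \<rho> where "\<rho> n = Hs n *v d n + A *v (l n - ls n)" for n
  have \<rho>: "\<rho> \<preceq> (\<lambda>n. m n + (D n)\<^sup>2 + k n * D n)" (is "_ \<preceq> ?R")
  proof -
    have eq: "\<rho> n = Lz \<phi> g (z n) (l n) - (Lz \<phi> g (z n) (l n) - Lz \<phi> g zs (l n) - Lzz \<phi> g zs (l n) *v (z n - zs))
       - (Lzz \<phi> g zs (l n) - Hs n) *v d n - (\<Sum>i\<in>-B. l n $ i *\<^sub>R grad_g g zs i)" for n
    proof -
      have "Lz \<phi> g zs (ls n) = 0" using ls[of n] by (simp add: multipliers_def KKT_def)
      moreover have "(\<Sum>i\<in>-B. (l n - ls n) $ i *\<^sub>R grad_g g zs i) = (\<Sum>i\<in>-B. l n $ i *\<^sub>R grad_g g zs i)"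
        using multipliers_inactive[OF ls] by (intro sum.cong) (auto simp: B_def)
      ultimately have "Lz \<phi> g zs (l n) = A *v (l n - ls n) + (\<Sum>i\<in>-B. l n $ i *\<^sub>R grad_g g zs i)"
        using Lz_diff[of zs "l n" "ls n"] by (simp add: nabla_g_zs_split)
      then show ?thesis by (simp add: \<rho>_def d_def matrix_vector_mult_diff_rdistrib)
    qed
    show ?thesis
      unfolding eq
    proof (rule lesssim_diff[OF lesssim_diff[OF lesssim_diff]])
      show "(\<lambda>n. Lz \<phi> g (z n) (l n)) \<preceq> ?R"
        by (rule lesssim_mono[OF residual_Lz]) (auto simp: D0 k0)
      show "(\<lambda>n. Lz \<phi> g (z n) (l n) - Lz \<phi> g zs (l n) - Lzz \<phi> g zs (l n) *v (z n - zs)) \<preceq> ?R"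
        by (rule lesssim_mono[OF Lz_expansion[OF tendsto_const z_lim l_bounded]]) (auto simp: D_def d_def k0)
      show "(\<lambda>n. (Lzz \<phi> g zs (l n) - Hs n) *v d n) \<preceq> ?R"
        by (rule lesssim_mono[OF lesssim_matrix_vector[OF Lzz_diff_multiplier dD]]) (auto simp: D0 k_def)
      have "(\<lambda>n. l n $ i *\<^sub>R grad_g g zs i) \<preceq> m" if "i \<in> -B" for i
        using lesssim_scaleR[OF inactive_l lesssim_const, of i] that by simp
      then show "(\<lambda>n. \<Sum>i\<in>-B. l n $ i *\<^sub>R grad_g g zs i) \<preceq> ?R"
        by (intro lesssim_mono[OF lesssim_sum, of _ _ m]) (auto simp: D0 k0)
    qed
  qed
  \<comment> \<open>Merely \<open>l - ls\<close> tending to zero would be too weak in the product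
    with \<open>transpose A *v d\<close>; the preimage has a rate, because its image is
    \<open>\<rho>\<close> minus the Hessian term.\<close>
  obtain w where w: "\<And>n. A *v w n = A *v (l n - ls n)" "w \<preceq> (\<lambda>n. norm (A *v (l n - ls n)))"
    by (rule preimage[of "\<lambda>n. l n - ls n"], rule that)
  have w_mD: "w \<preceq> (\<lambda>n. m n + D n)"
  proof -
    have "(\<lambda>n. \<rho> n - Hs n *v d n) \<preceq> (\<lambda>n. m n + D n)"
    proof (rule lesssim_diff)
      have "\<forall>\<^sub>F n in sequentially. D n < 1" "\<forall>\<^sub>F n in sequentially. k n < 1"
        using D k by (auto intro: order_tendstoD)
      then have "\<forall>\<^sub>F n in sequentially. \<bar>?R n\<bar> \<le> 2 * (m n + D n)"
      proof eventually_elim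
        case (elim n)
        have "D n * D n \<le> 1 * D n" "k n * D n \<le> 1 * D n"
          using elim D0[of n] by (intro mult_right_mono; simp)+
        moreover have "0 \<le> m n" by simp
        ultimately have "D n * D n + k n * D n \<le> m n + 2 * D n" by linarith
        then show ?case using D0[of n] k0[of n] by (simp add: power2_eq_square)
      qed
      then show "\<rho> \<preceq> (\<lambda>n. m n + D n)" by (rule lesssim_le_trans[OF \<rho>])
      show "(\<lambda>n. Hs n *v d n) \<preceq> (\<lambda>n. m n + D n)"
        by (rule lesssim_mono[OF lesssim_matrix_vector[OF Hs_bounded dD]]) (auto simp: D0)
    qed
    then show ?thesis by (intro lesssim_trans[OF w(2)]) (simp add: \<rho>_def)
  qed
  \<comment> \<open>The term \<open>k\<close> comes from \<open>d \<bullet> \<rho>\<close>, the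
    others from expanding products of \<open>m + D\<close> and of \<open>m\<close> plus the square
    of \<open>D\<close>.\<close>
  define e where "e n = k n + 2 * m n + D n + (D n)\<^sup>2" for n
  define Q where "Q n = m n * D n + (m n)\<^sup>2 + e n * (D n)\<^sup>2" for n
  have Q0: "0 \<le> Q n" for n by (simp add: Q_def e_def D0 k0)
  have Ad: "(\<lambda>n. transpose A *v d n) \<preceq> (\<lambda>n. m n + (D n)\<^sup>2)"
    using transpose_A_d by (simp add: D_def)
  have "(\<lambda>n. d n \<bullet> (Hs n *v d n)) \<preceq> Q"
  proof -
    have "d n \<bullet> (Hs n *v d n) = d n \<bullet> \<rho> n - (transpose A *v d n) \<bullet> w n" for n
      by (simp add: \<rho>_def inner_add_right w(1)[symmetric] inner_matrix_vector[of "d n" A])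
    moreover have "(\<lambda>n. d n \<bullet> \<rho> n) \<preceq> Q"
      by (rule lesssim_mono[OF lesssim_inner[OF dD \<rho>]])
         (auto simp: Q_def e_def D0 k0 algebra_simps power2_eq_square)
    moreover have "(\<lambda>n. (transpose A *v d n) \<bullet> w n) \<preceq> Q"
      by (rule lesssim_mono[OF lesssim_inner[OF Ad w_mD]])
         (auto simp: Q_def e_def D0 k0 algebra_simps power2_eq_square)
    ultimately show ?thesis by (simp add: lesssim_diff)
  qed
  moreover have "(\<lambda>n. (norm (transpose A *v d n))\<^sup>2) \<preceq> Q"
    using lesssim_mono[OF lesssim_inner[OF Ad Ad], of Q]
    by (auto simp: Q_def e_def D0 k0 algebra_simps power2_eq_square dot_square_norm)
  ultimately have "(\<lambda>n. \<bar>d n \<bullet> (Hs n *v d n)\<bar> + (norm (transpose A *v d n))\<^sup>2) \<preceq> Q"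
    by (intro lesssim_add) (auto simp: lesssim_def)
  with coercive[of d] have "(\<lambda>n. (D n)\<^sup>2) \<preceq> (\<lambda>n. m n * D n + (m n)\<^sup>2 + e n * (D n)\<^sup>2)"
    unfolding D_def[symmetric] Q_def[abs_def] by (rule lesssim_trans)
  then have "D \<preceq> m"
  proof (rule lesssim_absorb_quadratic)
    have "e \<longlonglongrightarrow> 0 + 2 * 0 + 0 + 0\<^sup>2"
      unfolding e_def[abs_def] by (intro tendsto_intros k D m_lim)
    then show "e \<longlonglongrightarrow> 0" by simp
  qed (auto simp: D0)
  then show ?thesis by (simp add: D_def[abs_def])
qed

lemma m_plus_d_sq: "(\<lambda>n. m n + (norm (d n))\<^sup>2) \<preceq> m"
proof (rule lesssim_add[OF lesssim_refl])
  have "(\<lambda>n. d n \<bullet> d n) \<preceq> (\<lambda>n. m n * 1)"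
    by (rule lesssim_inner[OF d_order lesssim_tendsto[OF d_lim]])
  then show "(\<lambda>n. (norm (d n))\<^sup>2) \<preceq> m" by (simp add: dot_square_norm)
qed

section \<open>Two-sided sizes of slacks and multipliers\<close>

lemma active_s: "i \<in> B \<Longrightarrow> (\<lambda>n. s n $ i) \<preceq> m"
  using lesssim_trans[OF active_s_preliminary m_plus_d_sq] .

lemma s_bounded: "s \<preceq> (\<lambda>_. 1)"
proof -
  have "(\<lambda>n. (g (z n) - g zs - transpose (nabla_g g zs) *v d n) + transpose (nabla_g g zs) *v d n + g zs) \<preceq> (\<lambda>_. 1)"
  proof (intro lesssim_add lesssim_const)
    have "(\<lambda>n. (norm (d n))\<^sup>2) \<longlonglongrightarrow> 0" using tendsto_power[OF tendsto_norm_zero[OF d_lim], of 2] by simp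
    from lesssim_tendsto_zero[OF g_expansion[OF tendsto_const z_lim, folded d_def] this]
    show "(\<lambda>n. g (z n) - g zs - transpose (nabla_g g zs) *v d n) \<preceq> (\<lambda>_. 1)" by (rule lesssim_tendsto)
    show "(\<lambda>n. transpose (nabla_g g zs) *v d n) \<preceq> (\<lambda>_. 1)"
      using lesssim_matrix_vector[OF lesssim_const lesssim_tendsto[OF d_lim]] by simp
  qed
  then have "(\<lambda>n. (g (z n) + s n) - g (z n)) \<preceq> (\<lambda>_. 1)"
    by (intro lesssim_diff lesssim_trans[OF residual_g lesssim_tendsto[OF m_lim]]) simp
  then show ?thesis by simp
qed

text \<open>Centrality bounds every product of slack and multiplier below by a multiple of
  \<open>m\<close>, so an upper bound \<open>Y\<close> on one factor becomes a lower bound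
  \<open>m / Y\<close> on the other.\<close>

lemma bounded_below_of_product:
  assumes "(\<lambda>n. x n $ i) \<preceq> Y" "\<And>n. 0 < x n $ i" "\<And>n. 0 \<le> Y n"
    "\<And>n. \<gamma> * m n \<le> x n $ i * y n"
  obtains c where "c > 0" "\<forall>\<^sub>F n in sequentially. c * m n \<le> Y n * y n"
proof -
  obtain K where K: "K > 0" "\<forall>\<^sub>F n in sequentially. norm (x n $ i) \<le> K * \<bar>Y n\<bar>"
    using assms(1) by (rule lesssimE)
  show ?thesis
  proof (rule that[of "\<gamma> / K"])
    show "\<gamma> / K > 0" using K(1) \<gamma> by simp
    show "\<forall>\<^sub>F n in sequentially. \<gamma> / K * m n \<le> Y n * y n"
      using K(2)
    proof eventually_elim
      case (elim n)
      have "0 < x n $ i * y n"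
        using \<gamma> m_pos[of n] assms(4)[of n] by (meson less_le_trans mult_pos_pos)
      then have "0 < y n" using assms(2)[of n] by (simp add: zero_less_mult_iff)
      then have "x n $ i * y n \<le> K * Y n * y n"
        using elim assms(2)[of n] assms(3)[of n] by (intro mult_right_mono) auto
      then have "\<gamma> * m n \<le> K * (Y n * y n)" using assms(4)[of n] by (simp add: mult_ac)
      then show ?case using K(1) by (simp add: field_simps)
    qed
  qed
qed

lemma active_l_bounded_below:
  assumes "i \<in> B"
  obtains c where "c > 0" "\<forall>\<^sub>F n in sequentially. c \<le> l n $ i"
proof -
  obtain c where "c > 0" "\<forall>\<^sub>F n in sequentially. c * m n \<le> m n * l n $ i"
    using bounded_below_of_product[OF active_s[OF assms], of "\<lambda>n. l n $ i"] centred pos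
    by (auto simp: m_def[symmetric] mult.commute)
  then show ?thesis by (intro that[of c]) (auto simp: mult.commute[of _ "m _"])
qed

lemma s_bounded_below:
  obtains c where "c > 0" "\<forall>\<^sub>F n in sequentially. c * m n \<le> s n $ i"
  using bounded_below_of_product[OF lesssim_nth[OF l_bounded], of i "\<lambda>n. s n $ i"] centred pos
  by (auto simp: m_def[symmetric])

lemma l_bounded_below:
  obtains c where "c > 0" "\<forall>\<^sub>F n in sequentially. c * m n \<le> l n $ i"
  using bounded_below_of_product[OF lesssim_nth[OF s_bounded], of i "\<lambda>n. l n $ i"] centred pos
  by (auto simp: m_def[symmetric] mult.commute)

end

section \<open>The perturbed Newton step\<close>

lemma lesssim_cancel_square:
  fixes x Y :: "nat \<Rightarrow> real"
  assumes "(\<lambda>n. (x n)\<^sup>2) \<preceq> (\<lambda>n. x n * Y n)"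
  shows "x \<preceq> Y"
proof -
  obtain K where K: "K > 0" "\<forall>\<^sub>F n in sequentially. norm ((x n)\<^sup>2) \<le> K * \<bar>x n * Y n\<bar>"
    using assms by (rule lesssimE)
  from K(2) have "\<forall>\<^sub>F n in sequentially. norm (x n) \<le> norm (K * Y n)"
  proof eventually_elim
    case (elim n)
    then have "\<bar>x n\<bar> * \<bar>x n\<bar> \<le> \<bar>x n\<bar> * (K * \<bar>Y n\<bar>)"
      by (simp add: power2_eq_square abs_mult mult_ac)
    then have "\<bar>x n\<bar> \<le> K * \<bar>Y n\<bar>" if "x n \<noteq> 0"
      using that mult_le_cancel_left_pos[of "\<bar>x n\<bar>"] zero_less_abs_iff by blast
    then show ?case using K(1) by (cases "x n = 0") (auto simp: abs_mult)
  qed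
  moreover have "(\<lambda>n. K * Y n) \<preceq> Y" using lesssim_mult[OF lesssim_const lesssim_refl, of K Y] by simp
  ultimately show ?thesis by (rule lesssim_norm_le[rotated])
qed

lemma lesssim_cancel_left:
  assumes "(\<lambda>n. c n * X n) \<preceq> (\<lambda>n. c n * Y n)" "\<And>n. 0 < (c n :: real)"
  shows "X \<preceq> Y"
proof -
  obtain K where K: "\<forall>\<^sub>F n in sequentially. norm (c n * X n) \<le> K * \<bar>c n * Y n\<bar>"
    using assms(1) by (rule lesssimE)
  have "norm (X n) \<le> norm (K * Y n)" if "norm (c n * X n) \<le> K * \<bar>c n * Y n\<bar>" for n
  proof -
    have "c n * \<bar>X n\<bar> \<le> c n * (K * \<bar>Y n\<bar>)" using that assms(2)[of n] by (simp add: abs_mult mult_ac)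
    then have "\<bar>X n\<bar> \<le> K * \<bar>Y n\<bar>" using assms(2)[of n] by simp
    then show ?thesis by (simp add: abs_mult) (smt (verit) mult_right_mono abs_ge_zero abs_ge_self)
  qed
  then have "\<forall>\<^sub>F n in sequentially. norm (X n) \<le> norm (K * Y n)" using K by (auto elim: eventually_mono)
  moreover have "(\<lambda>n. K * Y n) \<preceq> Y" using lesssim_mult[OF lesssim_const lesssim_refl, of K Y] by simp
  ultimately show ?thesis by (rule lesssim_norm_le[rotated])
qed

lemma eventually_perturbed_below:
  fixes x h Y e :: "nat \<Rightarrow> real"
  assumes "c > 0" "\<forall>\<^sub>F n in sequentially. c * Y n \<le> x n" "(\<lambda>n. h n - x n) \<preceq> (\<lambda>n. Y n * e n)"
    "e \<longlonglongrightarrow> 0" "\<And>n. 0 < Y n"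
  shows "\<forall>\<^sub>F n in sequentially. c / 2 * Y n \<le> h n"
proof -
  obtain K where K: "K > 0" "\<forall>\<^sub>F n in sequentially. norm (h n - x n) \<le> K * \<bar>Y n * e n\<bar>"
    using assms(3) by (rule lesssimE)
  have "\<forall>\<^sub>F n in sequentially. \<bar>e n\<bar> < c / (2 * K)"
    using tendsto_rabs[OF assms(4)] K(1) assms(1) by (intro order_tendstoD(2)) auto
  with K(2) assms(2) show ?thesis
  proof eventually_elim
    case (elim n)
    have "K * (Y n * \<bar>e n\<bar>) \<le> K * (Y n * (c / (2 * K)))"
      using elim(3) K(1) assms(5)[of n] by (intro mult_left_mono) auto
    also have "\<dots> = c / 2 * Y n" using K(1) by simp
    finally have "K * \<bar>Y n * e n\<bar> \<le> c / 2 * Y n"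
      unfolding abs_mult abs_of_pos[OF assms(5)] .
    then have "\<bar>h n - x n\<bar> \<le> c / 2 * Y n"
      using elim(1) by simp
    moreover have "c / 2 * Y n = c * Y n / 2" by simp
    ultimately show ?case using elim(2) unfolding abs_le_iff by linarith
  qed
qed

lemma eventually_divide_below:
  fixes x y X Y :: "nat \<Rightarrow> real"
  assumes "c > 0" "\<forall>\<^sub>F n in sequentially. c * X n \<le> x n" "y \<preceq> Y" "\<And>n. 0 < y n" "\<And>n. 0 < X n" "\<And>n. 0 < Y n"
  obtains c' where "c' > 0" "\<forall>\<^sub>F n in sequentially. c' * (X n / Y n) \<le> x n / y n"
proof -
  obtain K where K: "K > 0" "\<forall>\<^sub>F n in sequentially. norm (y n) \<le> K * \<bar>Y n\<bar>"
    using assms(3) by (rule lesssimE)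
  show ?thesis
  proof (rule that[of "c / K"])
    show "c / K > 0" using assms(1) K(1) by simp
    show "\<forall>\<^sub>F n in sequentially. c / K * (X n / Y n) \<le> x n / y n"
      using assms(2) K(2)
    proof eventually_elim
      case (elim n)
      have "c / K * (X n / Y n) = (c * X n) / (K * Y n)" by simp
      also have "\<dots> \<le> x n / y n"
        using elim assms(1,4-6) by (intro frac_le) (auto simp: less_imp_le intro: order_trans[rotated])
      finally show ?case .
    qed
  qed
qed

text \<open>The multiplier update evaluated exactly on perturbed data. Reintroducing it as an
  unknown undoes the condensation of the linear system, and the computed \<open>dl\<close> differs
  from it only by rounding errors of the final assignment.\<close>

definition multiplier_step ::
  "real^'m \<Rightarrow> real^'m \<Rightarrow> real^'m \<Rightarrow> real^'m^'n \<Rightarrow> real^'n \<Rightarrow> real^'m \<Rightarrow> real^'m" where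
  "multiplier_step b t l J y h = (\<chi> i. (b $ i - t $ i / l $ i + column i J \<bullet> y) / h $ i)"

text \<open>The vector \<open>h\<close> is the diagonal of the perturbed \<open>D + G\<close>; \<open>Fm\<close> and \<open>\<rho>\<close> collect the
  perturbations of the linear system.\<close>

locale approx_step = kkt_sequence \<phi> g zs C \<gamma> z l s
  for \<phi> :: "real^'n \<Rightarrow> real" and g :: "real^'n \<Rightarrow> real^'m" and zs :: "real^'n"
    and C \<gamma> :: real and z :: "nat \<Rightarrow> real^'n" and l s :: "nat \<Rightarrow> real^'m" +
  fixes Kr :: real and u :: "nat \<Rightarrow> real" and t b h dl ds :: "nat \<Rightarrow> real^'m" and dz \<rho> :: "nat \<Rightarrow> real^'n"
    and Fm :: "nat \<Rightarrow> real^'n^'n" and J :: "nat \<Rightarrow> real^'m^'n"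
  assumes u_pos [simp]: "\<And>n. 0 < u n"
    and u_div_mu_lim: "(\<lambda>n. u n / mu (l n) (s n)) \<longlonglongrightarrow> 0"
    and t_order': "t \<preceq> (\<lambda>n. (mu (l n) (s n))\<^sup>2)"
    and Fm_order': "Fm \<preceq> (\<lambda>n. u n / mu (l n) (s n))"
    and \<rho>_order: "\<rho> \<preceq> u"
    and J_order: "(\<lambda>n. J n - nabla_g g (z n)) \<preceq> u"
    and b_order: "(\<lambda>n. b n - g (z n)) \<preceq> u"
    and h_active': "\<And>i. i \<in> active g zs \<Longrightarrow> (\<lambda>n. h n $ i - s n $ i / l n $ i) \<preceq> (\<lambda>n. mu (l n) (s n) * u n)"
    and h_inactive': "\<And>i. i \<notin> active g zs \<Longrightarrow> (\<lambda>n. h n $ i - s n $ i / l n $ i) \<preceq> (\<lambda>n. u n / mu (l n) (s n))"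
    and step_eq: "\<And>n. (\<And>i. h n $ i \<noteq> 0) \<Longrightarrow>
      (Lzz \<phi> g (z n) (l n) + Fm n) *v dz n + J n *v multiplier_step (b n) (t n) (l n) (J n) (dz n) (h n)
        = - Lz \<phi> g (z n) (l n) + \<rho> n"
    and dl_error: "\<And>n i. (\<And>i. h n $ i \<noteq> 0) \<Longrightarrow>
      \<bar>dl n $ i - multiplier_step (b n) (t n) (l n) (J n) (dz n) (h n) $ i\<bar>
        \<le> Kr * (u n * (\<bar>b n $ i\<bar> + \<bar>t n $ i / l n $ i\<bar> + norm (column i (J n)) * norm (dz n)) / \<bar>h n $ i\<bar>)"
    and ds_error: "\<And>n i.
      \<bar>ds n $ i + (b n $ i + s n $ i) + column i (J n) \<bullet> dz n\<bar>
        \<le> Kr * (u n * (\<bar>b n $ i\<bar> + \<bar>s n $ i\<bar> + norm (column i (J n)) * norm (dz n)))"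
begin

section \<open>Sizes of the perturbed data\<close>

definition r :: "nat \<Rightarrow> real" where "r n = u n / m n"
definition ell :: "nat \<Rightarrow> real^'m" where
  "ell n = multiplier_step (b n) (t n) (l n) (J n) (dz n) (h n)"

lemmas t_order = t_order'[folded m_def]
  and Fm_order = Fm_order'[folded m_def, folded r_def]
  and h_active = h_active'[folded m_def B_def]
  and h_inactive = h_inactive'[folded m_def B_def]

lemma u_eq: "u n = m n * r n"
  using m_pos[of n] by (simp add: r_def del: m_pos)

lemma r_pos [simp]: "0 < r n" "0 \<le> r n"
  using m_pos[of n] u_pos[of n] by (auto simp: r_def simp del: m_pos u_pos intro: less_imp_le)

lemma r_lim: "r \<longlonglongrightarrow> 0"
  using u_div_mu_lim by (simp add: r_def[abs_def] m_def)

lemma u_le_m: "u \<preceq> m"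
  using lesssim_mult[OF lesssim_refl lesssim_tendsto[OF r_lim], of m] by (simp add: u_eq[symmetric])

lemma u_lim: "u \<longlonglongrightarrow> 0"
  by (rule lesssim_tendsto_zero[OF u_le_m m_lim])

lemma m_sq_le_m: "(\<lambda>n. (m n)\<^sup>2) \<preceq> m"
  using lesssim_mult[OF lesssim_refl lesssim_tendsto[OF m_lim], of m] by (simp add: power2_eq_square)

text \<open>The unperturbed quotient \<open>s / l\<close> is at least of order \<open>m\<close> on
  the active set and of order \<open>1 / m\<close> off it. The perturbations of orders
  \<open>m * u\<close> and \<open>u / m\<close> are in both cases a relative change of order
  \<open>u\<close>, so half of the lower bound survives.\<close>

lemma eventually_h:
  obtains c where "c > 0" "\<forall>\<^sub>F n in sequentially. c * (if i \<in> B then m n else 1 / m n) \<le> h n $ i"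
proof (cases "i \<in> B")
  case True
  obtain c where c: "c > 0" "\<forall>\<^sub>F n in sequentially. c * m n \<le> s n $ i" by (rule s_bounded_below)
  obtain c' where c': "c' > 0" "\<forall>\<^sub>F n in sequentially. c' * (m n / 1) \<le> s n $ i / l n $ i"
    by (rule eventually_divide_below[OF c lesssim_nth[OF l_bounded, of i]]) (use pos in auto)
  have "\<forall>\<^sub>F n in sequentially. c' / 2 * (m n / 1) \<le> h n $ i"
    by (rule eventually_perturbed_below[OF c' _ u_lim]) (use h_active[OF True] in auto)
  then show ?thesis using c'(1) True by (intro that[of "c' / 2"]) auto
next
  case False
  obtain c where c: "c > 0" "\<forall>\<^sub>F n in sequentially. c * 1 \<le> s n $ i"
    using inactive_s_bounded_below[OF False] by (metis mult.right_neutral)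
  obtain c' where c': "c' > 0" "\<forall>\<^sub>F n in sequentially. c' * (1 / m n) \<le> s n $ i / l n $ i"
    by (rule eventually_divide_below[OF c inactive_l[OF False]]) (use pos in auto)
  have "\<forall>\<^sub>F n in sequentially. c' / 2 * (1 / m n) \<le> h n $ i"
    by (rule eventually_perturbed_below[OF c' _ u_lim]) (use h_inactive[OF False] in auto)
  then show ?thesis using c'(1) False by (intro that[of "c' / 2"]) auto
qed

text \<open>Discharges, for large indices, the premise under which the inverse of the perturbed D is
  meaningful and \<open>step_eq\<close> and \<open>dl_error\<close> may be used.\<close>

lemma eventually_h_pos: "\<forall>\<^sub>F n in sequentially. \<forall>i. 0 < h n $ i"
proof (rule eventually_all_finite)
  fix i
  obtain c where c: "c > 0" "\<forall>\<^sub>F n in sequentially. c * (if i \<in> B then m n else 1 / m n) \<le> h n $ i"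
    by (rule eventually_h)
  from c(2) show "\<forall>\<^sub>F n in sequentially. 0 < h n $ i"
  proof eventually_elim
    case (elim n)
    have "0 < c * (if i \<in> B then m n else 1 / m n)" using c(1) by simp
    then show ?case using elim by linarith
  qed
qed

lemma inverse_h_active: "i \<in> B \<Longrightarrow> (\<lambda>n. inverse (h n $ i)) \<preceq> (\<lambda>n. inverse (m n))"
  and inverse_h_inactive: "i \<notin> B \<Longrightarrow> (\<lambda>n. inverse (h n $ i)) \<preceq> m"
proof -
  obtain c where c: "c > 0" "\<forall>\<^sub>F n in sequentially. c * (if i \<in> B then m n else 1 / m n) \<le> h n $ i"
    by (rule eventually_h)
  have *: "(\<lambda>n. inverse (h n $ i)) \<preceq> (\<lambda>n. inverse (if i \<in> B then m n else 1 / m n))"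
    by (rule lesssim_inverse[OF c]) simp
  then show "i \<in> B \<Longrightarrow> (\<lambda>n. inverse (h n $ i)) \<preceq> (\<lambda>n. inverse (m n))"
    and "i \<notin> B \<Longrightarrow> (\<lambda>n. inverse (h n $ i)) \<preceq> m" by simp_all
qed

lemma inverse_l_active:
  assumes "i \<in> B" shows "(\<lambda>n. inverse (l n $ i)) \<preceq> (\<lambda>_. 1)"
proof -
  obtain c where c: "c > 0" "\<forall>\<^sub>F n in sequentially. c \<le> l n $ i"
    using active_l_bounded_below[OF assms] .
  have "(\<lambda>n. inverse (l n $ i)) \<preceq> (\<lambda>n. inverse 1)"
    by (rule lesssim_inverse[OF c(1)]) (use c in auto)
  then show ?thesis by simp
qed

lemma h_active_order:
  assumes "i \<in> B" shows "(\<lambda>n. h n $ i) \<preceq> m"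
proof -
  have "(\<lambda>n. s n $ i * inverse (l n $ i)) \<preceq> m"
    using lesssim_mult[OF active_s[OF assms] inverse_l_active[OF assms]] by simp
  moreover have "(\<lambda>n. h n $ i - s n $ i / l n $ i) \<preceq> m"
    by (rule lesssim_trans[OF h_active[OF assms]])
       (use lesssim_mult[OF lesssim_refl lesssim_tendsto[OF u_lim], of m] in simp)
  ultimately have "(\<lambda>n. (h n $ i - s n $ i / l n $ i) + s n $ i * inverse (l n $ i)) \<preceq> m"
    by (intro lesssim_add)
  then show ?thesis by (simp add: divide_inverse)
qed

lemma t_div_l_active: "i \<in> B \<Longrightarrow> (\<lambda>n. t n $ i / l n $ i) \<preceq> (\<lambda>n. (m n)\<^sup>2)"
  using lesssim_mult[OF lesssim_nth[OF t_order] inverse_l_active] by (simp add: divide_inverse)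

text \<open>Off the active set the multiplier may be as small as a multiple of \<open>m\<close>,
  which costs one power compared with \<open>t_div_l_active\<close>.\<close>

lemma t_div_l: "(\<lambda>n. t n $ i / l n $ i) \<preceq> m"
proof -
  obtain c where c: "c > 0" "\<forall>\<^sub>F n in sequentially. c * m n \<le> l n $ i" by (rule l_bounded_below)
  have "(\<lambda>n. inverse (l n $ i)) \<preceq> (\<lambda>n. inverse (m n))" by (rule lesssim_inverse[OF c]) simp
  from lesssim_mult[OF lesssim_nth[OF t_order, of i] this]
  have "(\<lambda>n. t n $ i * inverse (l n $ i)) \<preceq> (\<lambda>n. (m n)\<^sup>2 * inverse (m n))" .
  moreover have "(m n)\<^sup>2 * inverse (m n) = m n" for n
    using m_pos[of n] by (simp add: power2_eq_square del: m_pos)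
  ultimately show ?thesis by (simp add: divide_inverse)
qed

lemma J_minus_nabla_g_zs: "(\<lambda>n. J n - nabla_g g zs) \<preceq> m"
proof -
  have "(\<lambda>n. (J n - nabla_g g (z n)) + (nabla_g g (z n) - nabla_g g zs)) \<preceq> m"
    by (rule lesssim_add[OF lesssim_trans[OF J_order u_le_m]
          lesssim_trans[OF nabla_g_diff[OF tendsto_const z_lim, folded d_def]]]) (simp add: d_order)
  then show ?thesis by simp
qed

lemma J_bounded: "J \<preceq> (\<lambda>_. 1)"
  using lesssim_add[OF lesssim_trans[OF J_minus_nabla_g_zs lesssim_tendsto[OF m_lim]] lesssim_const[of "nabla_g g zs"]]
  by simp

lemma column_lesssim: "M \<preceq> Y \<Longrightarrow> (\<lambda>n. column i (M n)) \<preceq> Y" for M :: "nat \<Rightarrow> real^'m^'n"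
  by (rule lesssim_vec) (auto simp: column_def intro: lesssim_nth)

lemma column_nabla_g: "column i (nabla_g g x) = grad_g g x i"
  by (simp add: column_def nabla_g_def)

lemma column_diff: "column i (M - N) = column i M - column i (N :: real^'m^'n)"
  by (simp add: column_def vec_eq_iff)

lemma g_active:
  assumes "i \<in> B" shows "(\<lambda>n. g (z n) $ i) \<preceq> m"
  using lesssim_diff[OF lesssim_nth[OF residual_g, of i] active_s[OF assms]] by simp

lemma g_bounded: "(\<lambda>n. g (z n)) \<preceq> (\<lambda>_. 1)"
  using lesssim_diff[OF lesssim_trans[OF residual_g lesssim_tendsto[OF m_lim]] s_bounded] by simp

lemma b_active:
  assumes "i \<in> B" shows "(\<lambda>n. b n $ i) \<preceq> m"
  using lesssim_add[OF lesssim_nth[OF lesssim_trans[OF b_order u_le_m], of i] g_active[OF assms]] by simp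

lemma b_bounded: "b \<preceq> (\<lambda>_. 1)"
  using lesssim_add[OF lesssim_trans[OF b_order lesssim_tendsto[OF u_lim]] g_bounded] by simp

text \<open>This is \<open>z n + dz n - zs\<close>, the error after a full step. The shift by
  \<open>d\<close> makes the active constraint values disappear from the right-hand side, since
  \<open>g (z n) $ i\<close> is the linearization along \<open>d\<close> up to second order.\<close>

definition p :: "nat \<Rightarrow> real^'n" where "p n = dz n + d n"
definition P :: "nat \<Rightarrow> real" where "P n = norm (p n)"
definition lB :: "nat \<Rightarrow> real^'m" where "lB n = (\<chi> i. if i \<in> B then ell n $ i else 0)"

lemma P_nonneg [simp]: "0 \<le> P n" by (simp add: P_def)

lemma p_order: "p \<preceq> P" by (rule lesssimI[of _ 1]) (simp add: P_def)

lemma dz_order_P: "dz \<preceq> (\<lambda>n. m n + P n)"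
proof -
  have "(\<lambda>n. p n - d n) \<preceq> (\<lambda>n. m n + P n)"
    by (rule lesssim_diff[OF lesssim_mono[OF p_order] lesssim_mono[OF d_order]]) auto
  then show ?thesis by (simp add: p_def)
qed

text \<open>The inverse of \<open>h\<close> already supplies a factor \<open>m\<close> here, so a
  crude bound on the bracket suffices.\<close>

lemma ell_inactive_order:
  assumes "i \<notin> B" shows "(\<lambda>n. ell n $ i) \<preceq> (\<lambda>n. m n * (1 + P n))"
proof -
  have "(\<lambda>n. b n $ i - t n $ i / l n $ i + column i (J n) \<bullet> dz n) \<preceq> (\<lambda>n. 1 + P n)"
  proof (intro lesssim_add lesssim_diff)
    show "(\<lambda>n. b n $ i) \<preceq> (\<lambda>n. 1 + P n)" by (rule lesssim_mono[OF lesssim_nth[OF b_bounded]]) auto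
    show "(\<lambda>n. t n $ i / l n $ i) \<preceq> (\<lambda>n. 1 + P n)"
      by (rule lesssim_mono[OF lesssim_trans[OF t_div_l lesssim_tendsto[OF m_lim]]]) auto
    have "(\<lambda>n. m n + P n) \<preceq> (\<lambda>n. 1 + P n)"
      by (rule lesssim_add[OF lesssim_mono[OF lesssim_tendsto[OF m_lim]] lesssim_mono[OF lesssim_refl]]) auto
    then show "(\<lambda>n. column i (J n) \<bullet> dz n) \<preceq> (\<lambda>n. 1 + P n)"
      using lesssim_inner[OF column_lesssim[OF J_bounded] lesssim_trans[OF dz_order_P]] by simp
  qed
  from lesssim_mult[OF inverse_h_inactive[OF assms] this]
  show ?thesis by (simp add: ell_def multiplier_step_def divide_inverse mult.commute)
qed

lemma J_lB: "nabla_g g zs *v lB n = A *v lB n"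
  by (simp add: nabla_g_zs_split lB_def)

text \<open>What is left of the stationarity row in terms of \<open>p\<close> and the active
  multipliers, with the Jacobian frozen at the solution.\<close>

definition \<tau> :: "nat \<Rightarrow> real^'n" where "\<tau> n = A *v lB n + (H n + Fm n) *v p n"

lemma HF_bounded: "(\<lambda>n. H n + Fm n) \<preceq> (\<lambda>_. 1)"
proof -
  have "(\<lambda>n. (H n - Hs n) + Hs n + Fm n) \<preceq> (\<lambda>_. 1)"
    by (intro lesssim_add Hs_bounded lesssim_tendsto[OF H_lim] lesssim_trans[OF Fm_order lesssim_tendsto[OF r_lim]])
  then show ?thesis by simp
qed

text \<open>Each discarded term has a factor \<open>m\<close>: freezing the Jacobian costs
  \<open>m\<close> times \<open>lB\<close>, the inactive multipliers are of order
  \<open>m * (1 + P)\<close>, and the shift contributes \<open>(H + Fm) *v d\<close>. No separate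
  \<open>r\<close> occurs; it can enter only through \<open>lB\<close>, and then multiplied by
  \<open>m\<close>.\<close>

lemma \<tau>_order: "\<tau> \<preceq> (\<lambda>n. m n * (1 + norm (lB n) + P n))" (is "_ \<preceq> ?Y")
proof -
  have m_Y: "X \<preceq> ?Y" if "X \<preceq> m" for X :: "nat \<Rightarrow> real^'n"
    by (rule lesssim_mono[OF that]) (auto simp: distrib_left)
  have "(\<lambda>n. - Lz \<phi> g (z n) (l n) + \<rho> n + (H n + Fm n) *v d n - (J n - nabla_g g zs) *v lB n - J n *v (ell n - lB n)) \<preceq> ?Y"
  proof (rule lesssim_diff[OF lesssim_diff[OF lesssim_add[OF lesssim_add]]])
    show "(\<lambda>n. - Lz \<phi> g (z n) (l n)) \<preceq> ?Y" by (intro m_Y) (simp add: residual_Lz)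
    show "\<rho> \<preceq> ?Y" by (intro m_Y lesssim_trans[OF \<rho>_order u_le_m])
    show "(\<lambda>n. (H n + Fm n) *v d n) \<preceq> ?Y"
      using lesssim_matrix_vector[OF HF_bounded d_order] by (intro m_Y) simp
    have "lB \<preceq> (\<lambda>n. norm (lB n))" by (rule lesssimI[of _ 1]) simp
    then show "(\<lambda>n. (J n - nabla_g g zs) *v lB n) \<preceq> ?Y"
      by (rule lesssim_mono[OF lesssim_matrix_vector[OF J_minus_nabla_g_zs]]) (auto simp: distrib_left)
    have "(\<lambda>n. ell n - lB n) \<preceq> (\<lambda>n. m n * (1 + P n))"
    proof (rule lesssim_vec)
      fix i
      show "(\<lambda>n. (ell n - lB n) $ i) \<preceq> (\<lambda>n. m n * (1 + P n))"
        using ell_inactive_order[of i] by (cases "i \<in> B") (simp_all add: lB_def)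
    qed
    then show "(\<lambda>n. J n *v (ell n - lB n)) \<preceq> ?Y"
      by (rule lesssim_mono[OF lesssim_matrix_vector[OF J_bounded]]) (auto simp: distrib_left)
  qed
  moreover have "\<forall>\<^sub>F n in sequentially. norm (\<tau> n) \<le> norm (- Lz \<phi> g (z n) (l n) + \<rho> n + (H n + Fm n) *v d n
     - (J n - nabla_g g zs) *v lB n - J n *v (ell n - lB n))"
    using eventually_h_pos
  proof eventually_elim
    case (elim n)
    then have "(H n + Fm n) *v dz n + J n *v ell n = - Lz \<phi> g (z n) (l n) + \<rho> n"
      unfolding ell_def by (intro step_eq) (metis less_irrefl)
    then have "\<tau> n = - Lz \<phi> g (z n) (l n) + \<rho> n + (H n + Fm n) *v d n - (J n - nabla_g g zs) *v lB n - J n *v (ell n - lB n)"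
      by (simp add: \<tau>_def p_def J_lB[symmetric] matrix_vector_mult_diff_rdistrib matrix_vector_mult_diff_distrib
          matrix_vector_right_distrib matrix_vector_mult_add_rdistrib algebra_simps)
    then show ?case by simp
  qed
  ultimately show ?thesis by (rule lesssim_norm_le)
qed

text \<open>The size expected of the active multipliers. The summand \<open>r\<close> is the
  roundoff \<open>u\<close> in the constraints divided by \<open>h\<close>, which is of order
  \<open>m\<close>.\<close>

definition R :: "nat \<Rightarrow> real" where "R n = m n + r n + P n"

lemma R_nonneg [simp]: "0 \<le> R n" by (simp add: R_def)

text \<open>The complementarity row. Because \<open>g zs $ i = 0\<close>, the computed constraint
  value is the linearization along \<open>d\<close> up to \<open>u\<close> and second order, and
  joins the term with \<open>dz\<close> to form \<open>transpose A *v p\<close>; freezing the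
  Jacobian costs \<open>m * (m + P)\<close>.\<close>

lemma transpose_A_p_active:
  assumes "i \<in> B"
  shows "(\<lambda>n. (transpose A *v p n) $ i - h n $ i * ell n $ i) \<preceq> (\<lambda>n. m n * R n)" (is "_ \<preceq> ?Y")
proof -
  have le: "X \<preceq> ?Y" if "X \<preceq> (\<lambda>n. m n * (m n + P n))" for X :: "nat \<Rightarrow> real"
    by (rule lesssim_mono[OF that]) (auto simp: R_def distrib_left)
  have le': "X \<preceq> ?Y" if "X \<preceq> (\<lambda>n. (m n)\<^sup>2)" for X :: "nat \<Rightarrow> real"
    by (rule lesssim_mono[OF that]) (auto simp: R_def distrib_left power2_eq_square)
  have u_le: "X \<preceq> ?Y" if "X \<preceq> u" for X :: "nat \<Rightarrow> real"
    by (rule lesssim_mono[OF that]) (auto simp: R_def distrib_left u_eq[symmetric] less_imp_le)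
  let ?X = "\<lambda>n. t n $ i / l n $ i - column i (J n - nabla_g g zs) \<bullet> dz n
     - (g (z n) - g zs - transpose (nabla_g g zs) *v d n) $ i - (b n - g (z n)) $ i"
  have "?X \<preceq> ?Y"
  proof (rule lesssim_diff[OF lesssim_diff[OF lesssim_diff]])
    show "(\<lambda>n. t n $ i / l n $ i) \<preceq> ?Y" by (rule le'[OF t_div_l_active[OF assms]])
    show "(\<lambda>n. column i (J n - nabla_g g zs) \<bullet> dz n) \<preceq> ?Y"
      by (rule le[OF lesssim_inner[OF column_lesssim[OF J_minus_nabla_g_zs] dz_order_P]])
    have "(\<lambda>n. (norm (d n))\<^sup>2) \<preceq> (\<lambda>n. (m n)\<^sup>2)"
      using lesssim_inner[OF d_order d_order] by (simp add: dot_square_norm power2_eq_square[of "m _"])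
    then show "(\<lambda>n. (g (z n) - g zs - transpose (nabla_g g zs) *v d n) $ i) \<preceq> ?Y"
      by (intro le' lesssim_nth lesssim_trans[OF g_expansion[OF tendsto_const z_lim, folded d_def]])
    show "(\<lambda>n. (b n - g (z n)) $ i) \<preceq> ?Y" by (rule u_le[OF lesssim_nth[OF b_order]])
  qed
  moreover have "\<forall>\<^sub>F n in sequentially. norm ((transpose A *v p n) $ i - h n $ i * ell n $ i) \<le> norm (?X n)"
    using eventually_h_pos
  proof eventually_elim
    case (elim n)
    then have "h n $ i \<noteq> 0" by (metis less_irrefl)
    then have "h n $ i * ell n $ i = b n $ i - t n $ i / l n $ i + column i (J n) \<bullet> dz n"
      by (simp add: ell_def multiplier_step_def)
    moreover have "g zs $ i = 0" using assms by (simp add: B_def active_def)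
    ultimately have "(transpose A *v p n) $ i - h n $ i * ell n $ i = ?X n"
      using assms by (simp add: A_def transpose_nabla_g_on_mult_vector transpose_nabla_g_mult_vector p_def
          inner_add_right inner_diff_left column_diff column_nabla_g)
    then show ?case by simp
  qed
  ultimately show ?thesis by (rule lesssim_norm_le)
qed

end

section \<open>Bounds for the multipliers and for the error after the step\<close>

context approx_step
begin

lemma eventually_small: "\<forall>\<^sub>F n in sequentially. m n \<le> 1 \<and> r n \<le> 1"
proof -
  have "\<forall>\<^sub>F n in sequentially. m n < 1" "\<forall>\<^sub>F n in sequentially. r n < 1"
    using m_lim r_lim by (auto intro: order_tendstoD)
  then show ?thesis by eventually_elim auto
qed

text \<open>Trades \<open>r\<close> for a constant. This is affordable wherever a factor
  \<open>m\<close> already provides the smallness, and it keeps u/mu out of the primal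
  estimate.\<close>

lemma R_le: "R \<preceq> (\<lambda>n. 1 + P n)"
proof (rule lesssimI[of _ 2], rule eventually_mono[OF eventually_small])
  fix n assume "m n \<le> 1 \<and> r n \<le> 1"
  then have "R n \<le> 2 * (1 + P n)" using P_nonneg[of n] unfolding R_def distrib_left by linarith
  then show "norm (R n) \<le> 2 * (1 + P n)" by simp
qed

text \<open>The multipliers split into a part controlled by \<open>A\<close> and a part in its kernel; the latter
  is estimated by testing the complementarity equations against it, which annihilates the
  linearized constraints.\<close>

lemma lB_order_R: "lB \<preceq> R" and
  obtain_w: "\<exists>w. (\<forall>n. A *v w n = A *v lB n) \<and> w \<preceq> (\<lambda>n. m n + P n)"
proof -
  define L where "L n = norm (lB n)" for n
  have L0: "0 \<le> L n" for n by (simp add: L_def)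
  have lBL: "lB \<preceq> L" by (rule lesssimI[of _ 1]) (simp add: L_def)
  obtain w where w: "\<And>n i. i \<notin> B \<Longrightarrow> w n $ i = 0" "\<And>n. A *v w n = A *v lB n" "w \<preceq> (\<lambda>n. norm (A *v lB n))"
    by (rule preimage[of lB], rule that)
  define W where "W n = norm (w n)" for n
  have wW: "w \<preceq> W" by (rule lesssimI[of _ 1]) (simp add: W_def)
  \<comment> \<open>The image of \<open>lB\<close> under \<open>A\<close> is \<open>\<tau>\<close>
    minus the Hessian term, hence known up to a feedback \<open>m * L\<close> from the
    multipliers.\<close>
  have w_order: "w \<preceq> (\<lambda>n. P n + m n + m n * L n)" (is "_ \<preceq> ?Yw")
  proof -
    have "\<tau> \<preceq> ?Yw"
    proof (rule lesssim_le_trans[OF \<tau>_order], rule eventually_mono[OF eventually_small])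
      fix n assume "m n \<le> 1 \<and> r n \<le> 1"
      then have "m n * P n \<le> 1 * P n" by (intro mult_right_mono) auto
      then show "\<bar>m n * (1 + norm (lB n) + P n)\<bar> \<le> 1 * ?Yw n"
        using L0[of n] by (simp add: distrib_left L_def[symmetric])
    qed
    moreover have "(\<lambda>n. (H n + Fm n) *v p n) \<preceq> ?Yw"
      by (rule lesssim_mono[OF lesssim_matrix_vector[OF HF_bounded p_order]]) (auto simp: L0)
    ultimately have "(\<lambda>n. \<tau> n - (H n + Fm n) *v p n) \<preceq> ?Yw" by (rule lesssim_diff)
    then have "(\<lambda>n. A *v lB n) \<preceq> ?Yw" by (simp add: \<tau>_def)
    then show ?thesis by (intro lesssim_trans[OF w(3)]) simp
  qed
  \<comment> \<open>The component in the kernel of \<open>A\<close>, of which the stationarity row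
    gives no information.\<close>
  define v where "v n = lB n - w n" for n
  define N where "N n = norm (v n)" for n
  have N0: "0 \<le> N n" and W0: "0 \<le> W n" for n by (auto simp: N_def W_def)
  have vN: "v \<preceq> N" by (rule lesssimI[of _ 1]) (simp add: N_def)
  have v_inactive: "v n $ i = 0" if "i \<notin> B" for n i
    using w(1)[OF that] that by (simp add: v_def lB_def)
  define Sh where "Sh n = (\<Sum>i\<in>B. h n $ i * (v n $ i)\<^sup>2)" for n
  have "(\<lambda>n. m n * (v n $ i)\<^sup>2) \<preceq> Sh" if i: "i \<in> B" for i
  proof -
    obtain c where c: "c > 0" "\<forall>\<^sub>F n in sequentially. c * (if i \<in> B then m n else 1 / m n) \<le> h n $ i"
      by (rule eventually_h)
    from c(2) eventually_h_pos have "\<forall>\<^sub>F n in sequentially. norm (m n * (v n $ i)\<^sup>2) \<le> 1 / c * Sh n"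
    proof eventually_elim
      case (elim n)
      have "c * m n * (v n $ i)\<^sup>2 \<le> h n $ i * (v n $ i)\<^sup>2"
        using elim(1) i by (intro mult_right_mono) auto
      also have "\<dots> \<le> Sh n"
        unfolding Sh_def using i elim(2) by (intro member_le_sum) (auto simp: less_imp_le)
      finally show ?case using c(1) by (simp add: field_simps)
    qed
    then show ?thesis by (rule lesssimI)
  qed
  then have "(\<lambda>n. \<Sum>i\<in>B. m n * (v n $ i)\<^sup>2) \<preceq> Sh" by (rule lesssim_sum)
  moreover have "m n * (N n)\<^sup>2 = (\<Sum>i\<in>B. m n * (v n $ i)\<^sup>2)" for n
  proof -
    have "(N n)\<^sup>2 = (\<Sum>i\<in>UNIV. v n $ i * v n $ i)"
      by (simp add: N_def dot_square_norm[symmetric] inner_vec_def)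
    also have "\<dots> = (\<Sum>i\<in>B. (v n $ i)\<^sup>2)"
      using v_inactive by (intro sum.mono_neutral_cong_right) (auto simp: power2_eq_square)
    finally show ?thesis by (simp add: sum_distrib_left)
  qed
  ultimately have "(\<lambda>n. m n * (N n)\<^sup>2) \<preceq> Sh" by simp
  also have "Sh \<preceq> (\<lambda>n. m n * (N n * (R n + W n)))" (is "_ \<preceq> ?Y")
  proof -
    let ?q = "\<lambda>n i. (transpose A *v p n) $ i"
    \<comment> \<open>Testing the active complementarity rows with \<open>v\<close> removes
      \<open>transpose A *v p\<close>, since \<open>A *v v n = 0\<close>. What remains are the row
      residuals and the contribution of \<open>w\<close>, both of which carry a factor
      \<open>m\<close>.\<close>
    have eq: "Sh n = - (\<Sum>i\<in>B. v n $ i * (?q n i - h n $ i * ell n $ i)) - (\<Sum>i\<in>B. v n $ i * (h n $ i * w n $ i))" for n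
    proof -
      have "A *v v n = 0" using w(2) by (simp add: v_def matrix_vector_mult_diff_distrib)
      then have "(transpose A *v p n) \<bullet> v n = 0" using inner_matrix_vector[of "p n" A "v n"] by simp
      then have "(\<Sum>i\<in>UNIV. v n $ i * ?q n i) = 0" by (simp add: inner_vec_def mult.commute)
      moreover have "(\<Sum>i\<in>UNIV. v n $ i * ?q n i) = (\<Sum>i\<in>B. v n $ i * ?q n i)"
        using v_inactive by (intro sum.mono_neutral_right) auto
      ultimately have "(\<Sum>i\<in>B. v n $ i * ?q n i) = 0" by simp
      moreover have "h n $ i * (v n $ i)\<^sup>2 = v n $ i * ?q n i - v n $ i * (?q n i - h n $ i * ell n $ i) - v n $ i * (h n $ i * w n $ i)"
        if "i \<in> B" for i
        using that by (simp add: v_def lB_def power2_eq_square algebra_simps)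
      ultimately show ?thesis by (simp add: Sh_def sum_subtractf)
    qed
    have "(\<lambda>n. \<Sum>i\<in>B. v n $ i * (?q n i - h n $ i * ell n $ i)) \<preceq> ?Y"
    proof (rule lesssim_sum)
      fix i assume "i \<in> B"
      then show "(\<lambda>n. v n $ i * (?q n i - h n $ i * ell n $ i)) \<preceq> ?Y"
        by (intro lesssim_mono[OF lesssim_mult[OF lesssim_nth[OF vN] transpose_A_p_active]])
           (auto simp: N0 W0 distrib_left)
    qed
    moreover have "(\<lambda>n. \<Sum>i\<in>B. v n $ i * (h n $ i * w n $ i)) \<preceq> ?Y"
    proof (rule lesssim_sum)
      fix i assume "i \<in> B"
      then show "(\<lambda>n. v n $ i * (h n $ i * w n $ i)) \<preceq> ?Y"
        by (intro lesssim_mono[OF lesssim_mult[OF lesssim_nth[OF vN] lesssim_mult[OF h_active_order lesssim_nth[OF wW]]]])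
           (auto simp: N0 W0 distrib_left)
    qed
    ultimately show ?thesis unfolding eq by (intro lesssim_diff) simp_all
  qed
  \<comment> \<open>The lower bound on \<open>h\<close> and the right-hand side share the factor
    \<open>m\<close>, so the weak definiteness on the kernel costs nothing here; the loss is already
    contained in the \<open>r\<close> of \<open>R\<close>.\<close>
  finally (lesssim_trans) have "(\<lambda>n. (N n)\<^sup>2) \<preceq> (\<lambda>n. N n * (R n + W n))"
    by (rule lesssim_cancel_left) simp
  then have N_order: "N \<preceq> (\<lambda>n. R n + W n)" by (rule lesssim_cancel_square)
  \<comment> \<open>The feedback of \<open>lB\<close> on itself goes through \<open>w\<close> and
    has the vanishing factor \<open>m\<close>.\<close>
  have lB_order: "lB \<preceq> R"
  proof (rule lesssim_absorb)
    have Y_le: "(\<lambda>n. R n + W n) \<preceq> (\<lambda>n. R n + m n * norm (lB n))"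
    proof (rule lesssim_add)
      show "R \<preceq> (\<lambda>n. R n + m n * norm (lB n))" by (rule lesssim_mono[OF lesssim_refl]) auto
      have "W \<preceq> ?Yw" using w_order by (simp add: W_def[abs_def])
      then show "W \<preceq> (\<lambda>n. R n + m n * norm (lB n))"
        by (rule lesssim_mono) (auto simp: L_def R_def)
    qed
    have "v \<preceq> (\<lambda>n. R n + m n * norm (lB n))"
      using lesssim_trans[OF vN lesssim_trans[OF N_order Y_le]] .
    moreover have "w \<preceq> (\<lambda>n. R n + m n * norm (lB n))"
      by (rule lesssim_mono[OF w_order]) (auto simp: L_def R_def)
    ultimately have "(\<lambda>n. v n + w n) \<preceq> (\<lambda>n. R n + m n * norm (lB n))" by (rule lesssim_add)
    then show "lB \<preceq> (\<lambda>n. R n + m n * norm (lB n))" by (simp add: v_def)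
  qed (auto simp: m_lim)
  then show "lB \<preceq> R" .
  \<comment> \<open>With the multipliers bounded, the feedback in \<open>w\<close> becomes
    \<open>m * (1 + P)\<close>. The resulting bound on \<open>w\<close> is free of \<open>r\<close>,
    in contrast to that on \<open>lB\<close>.\<close>
  have mR: "(\<lambda>n. m n * L n) \<preceq> (\<lambda>n. m n * (1 + P n))"
    by (rule lesssim_mult[OF lesssim_refl]) (use lesssim_trans[OF lB_order R_le] in \<open>simp add: L_def\<close>)
  have "(\<lambda>n. m n * (1 + P n)) \<preceq> (\<lambda>n. m n + P n)"
  proof (rule lesssimI[of _ 1], rule eventually_mono[OF eventually_small])
    fix n assume "m n \<le> 1 \<and> r n \<le> 1"
    then have "m n * P n \<le> 1 * P n" by (intro mult_right_mono) auto
    then show "norm (m n * (1 + P n)) \<le> 1 * (m n + P n)" by (simp add: distrib_left)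
  qed
  from lesssim_trans[OF mR this] have "?Yw \<preceq> (\<lambda>n. m n + P n)"
    by (intro lesssim_add) (auto intro: lesssim_mono[OF lesssim_refl])
  from lesssim_trans[OF w_order this] w(2)
  show "\<exists>w. (\<forall>n. A *v w n = A *v lB n) \<and> w \<preceq> (\<lambda>n. m n + P n)" by auto
qed

lemma transpose_A_p_order: "(\<lambda>n. transpose A *v p n) \<preceq> (\<lambda>n. m n * R n)"
proof (rule lesssim_vec)
  fix i
  show "(\<lambda>n. (transpose A *v p n) $ i) \<preceq> (\<lambda>n. m n * R n)"
  proof (cases "i \<in> B")
    case True
    have "(\<lambda>n. h n $ i * lB n $ i) \<preceq> (\<lambda>n. m n * R n)"
      by (rule lesssim_mult[OF h_active_order[OF True] lesssim_nth[OF lB_order_R]])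
    from lesssim_add[OF transpose_A_p_active[OF True] this]
    show ?thesis using True by (simp add: lB_def)
  qed (simp add: A_def transpose_nabla_g_on_mult_vector)
qed

text \<open>In the quadratic form of \<open>Hs\<close> at \<open>p\<close>, the multipliers occur
  only as \<open>A *v lB\<close>, which equals \<open>A *v w\<close>, and are paired with
  \<open>transpose A *v p\<close>. The first factor has no \<open>r\<close>, and in the bound
  \<open>m * R\<close> of the second \<open>r\<close> may be replaced by 1. Hence \<open>p\<close>
  is of order \<open>m\<close> although \<open>lB\<close> may be as large as u/mu.\<close>

lemma p_order_m: "p \<preceq> m"
proof -
  obtain w where w: "\<And>n. A *v w n = A *v lB n" "w \<preceq> (\<lambda>n. m n + P n)"
    using obtain_w by blast
  have m1P: "(\<lambda>n. m n * R n) \<preceq> (\<lambda>n. m n * (1 + P n))"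
    by (rule lesssim_mult[OF lesssim_refl R_le])
  have \<tau>: "\<tau> \<preceq> (\<lambda>n. m n * (1 + P n))"
  proof (rule lesssim_trans[OF \<tau>_order], rule lesssim_mult[OF lesssim_refl])
    have "(\<lambda>n. norm (lB n)) \<preceq> (\<lambda>n. 1 + P n)" using lesssim_trans[OF lB_order_R R_le] by simp
    from lesssim_add[OF lesssim_refl this]
    show "(\<lambda>n. 1 + norm (lB n) + P n) \<preceq> (\<lambda>n. 1 + P n)"
      by (simp add: algebra_simps)
  qed
  define k where "k n = norm (H n - Hs n + Fm n)" for n
  have k: "k \<longlonglongrightarrow> 0"
    unfolding k_def[abs_def]
    using tendsto_norm_zero[OF tendsto_add_zero[OF H_lim lesssim_tendsto_zero[OF Fm_order r_lim]]] .
  \<comment> \<open>\<open>k\<close> measures the change from \<open>Hs\<close> to the perturbed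
    Hessian; \<open>2 * m\<close> covers the products of \<open>1 + P\<close> and
    \<open>m + P\<close> once \<open>m\<close> is at most 1.\<close>
  define e where "e n = k n + 2 * m n" for n
  define Q where "Q n = m n * P n + (m n)\<^sup>2 + e n * (P n)\<^sup>2" for n
  have k0: "0 \<le> k n" for n by (simp add: k_def)
  have poly: "(\<lambda>n. P n * (m n * (1 + P n))) \<preceq> Q" "(\<lambda>n. m n * (1 + P n) * (m n + P n)) \<preceq> Q"
    "(\<lambda>n. m n * (1 + P n) * (m n * (1 + P n))) \<preceq> Q"
  proof -
    have m2: "m n * (m n * P n) \<le> m n * P n" "m n * (P n * (m n * P n)) \<le> m n * (P n * P n)" if "m n \<le> 1" for n
      using that mult_right_mono[of "m n" 1 "m n * P n"] mult_right_mono[of "m n" 1 "m n * (P n * P n)"]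
      by (simp_all add: mult_ac)
    have "0 \<le> k n * (P n * P n)" "0 \<le> m n * (P n * P n)" "0 \<le> m n * P n" "0 \<le> m n * m n" for n
      using k0[of n] by simp_all
    note nn = this
    have Q_eq: "2 * Q n = 2 * (m n * P n) + 2 * (m n * m n) + 2 * (k n * (P n * P n)) + 4 * (m n * (P n * P n))" for n
      by (simp add: Q_def e_def algebra_simps power2_eq_square)
    show "(\<lambda>n. P n * (m n * (1 + P n))) \<preceq> Q"
      by (rule lesssimI[of _ 1], rule always_eventually, rule allI)
         (use nn in \<open>simp add: Q_def e_def algebra_simps power2_eq_square\<close>)
    show "(\<lambda>n. m n * (1 + P n) * (m n + P n)) \<preceq> Q"
    proof (rule lesssimI[of _ 2], rule eventually_mono[OF eventually_small])
      fix n assume small: "m n \<le> 1 \<and> r n \<le> 1"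
      have "m n * (1 + P n) * (m n + P n) = m n * m n + m n * P n + m n * (m n * P n) + m n * (P n * P n)"
        by (simp add: algebra_simps)
      then have "m n * (1 + P n) * (m n + P n) \<le> 2 * Q n"
        using m2(1)[OF conjunct1[OF small]] nn[of n] unfolding Q_eq by linarith
      then show "norm (m n * (1 + P n) * (m n + P n)) \<le> 2 * Q n" by simp
    qed
    show "(\<lambda>n. m n * (1 + P n) * (m n * (1 + P n))) \<preceq> Q"
    proof (rule lesssimI[of _ 2], rule eventually_mono[OF eventually_small])
      fix n assume small: "m n \<le> 1 \<and> r n \<le> 1"
      have "m n * (1 + P n) * (m n * (1 + P n)) = m n * m n + 2 * (m n * (m n * P n)) + m n * (P n * (m n * P n))"
        by (simp add: algebra_simps)
      then have "m n * (1 + P n) * (m n * (1 + P n)) \<le> 2 * Q n"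
        using m2[OF conjunct1[OF small]] nn[of n] unfolding Q_eq by linarith
      then show "norm (m n * (1 + P n) * (m n * (1 + P n))) \<le> 2 * Q n" by simp
    qed
  qed
  have Ap: "(\<lambda>n. transpose A *v p n) \<preceq> (\<lambda>n. m n * (1 + P n))"
    by (rule lesssim_trans[OF transpose_A_p_order m1P])
  have "(\<lambda>n. p n \<bullet> (Hs n *v p n)) \<preceq> Q"
  proof -
    have eq: "p n \<bullet> (Hs n *v p n) = p n \<bullet> \<tau> n - (transpose A *v p n) \<bullet> w n - p n \<bullet> ((H n - Hs n + Fm n) *v p n)" for n
    proof -
      have "(transpose A *v p n) \<bullet> w n = p n \<bullet> (A *v lB n)" by (simp add: inner_matrix_vector[symmetric] w(1))
      then show ?thesis
        by (simp add: \<tau>_def inner_add_right inner_diff_right matrix_vector_mult_diff_rdistrib matrix_vector_mult_add_rdistrib)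
    qed
    have 1: "(\<lambda>n. p n \<bullet> \<tau> n) \<preceq> Q" by (rule lesssim_trans[OF lesssim_inner[OF p_order \<tau>] poly(1)])
    have 2: "(\<lambda>n. (transpose A *v p n) \<bullet> w n) \<preceq> Q" by (rule lesssim_trans[OF lesssim_inner[OF Ap w(2)] poly(2)])
    have kk: "(\<lambda>n. H n - Hs n + Fm n) \<preceq> k" by (rule lesssimI[of _ 1]) (simp add: k_def)
    have 3: "(\<lambda>n. p n \<bullet> ((H n - Hs n + Fm n) *v p n)) \<preceq> Q"
      by (rule lesssim_mono[OF lesssim_inner[OF p_order lesssim_matrix_vector[OF kk p_order]]])
         (auto simp: k0 Q_def e_def power2_eq_square algebra_simps)
    show ?thesis using lesssim_diff[OF lesssim_diff[OF 1 2] 3] by (simp only: eq)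
  qed
  moreover have "(\<lambda>n. (norm (transpose A *v p n))\<^sup>2) \<preceq> Q"
    using lesssim_trans[OF lesssim_inner[OF Ap Ap] poly(3)] by (simp add: dot_square_norm)
  ultimately have "(\<lambda>n. \<bar>p n \<bullet> (Hs n *v p n)\<bar> + (norm (transpose A *v p n))\<^sup>2) \<preceq> Q"
    by (intro lesssim_add) (auto simp: lesssim_def)
  with coercive[of p] have "(\<lambda>n. (P n)\<^sup>2) \<preceq> (\<lambda>n. m n * P n + (m n)\<^sup>2 + e n * (P n)\<^sup>2)"
    unfolding P_def[symmetric] Q_def[abs_def] by (rule lesssim_trans)
  then have "P \<preceq> m"
  proof (rule lesssim_absorb_quadratic)
    have "e \<longlonglongrightarrow> 0 + 2 * 0"
      unfolding e_def[abs_def] by (intro tendsto_intros k m_lim)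
    then show "e \<longlonglongrightarrow> 0" by simp
  qed auto
  then show ?thesis by (simp add: P_def[abs_def])
qed

section \<open>Orders of the components of the computed step\<close>

lemma P_order: "P \<preceq> m"
  using p_order_m by (simp add: P_def[abs_def])

lemma dz_order: "dz \<preceq> m"
  by (rule lesssim_trans[OF dz_order_P lesssim_add[OF lesssim_refl P_order]])

lemma R_order: "R \<preceq> (\<lambda>n. m n + r n)"
  unfolding R_def[abs_def]
  by (rule lesssim_add[OF lesssim_refl lesssim_trans[OF P_order]]) (auto intro: lesssim_mono[OF lesssim_refl])

lemma ell_active_order: "i \<in> B \<Longrightarrow> (\<lambda>n. ell n $ i) \<preceq> (\<lambda>n. m n + r n)"
  using lesssim_nth[OF lesssim_trans[OF lB_order_R R_order], of i] by (simp add: lB_def)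

abbreviation U :: "nat \<Rightarrow> real" where "U n \<equiv> u n + (m n)\<^sup>2"

text \<open>The final error bound is the product of the size \<open>m\<close> of the active slacks
  with the size \<open>m + r\<close> of the active multiplier steps.\<close>

lemma U_eq: "U n = m n * (m n + r n)"
  using u_eq[of n] by (simp add: distrib_left power2_eq_square)

lemma U_nonneg [simp]: "0 \<le> U n"
  using u_pos[of n] by (simp add: less_imp_le del: u_pos)

lemma le_U: "X \<preceq> u \<Longrightarrow> X \<preceq> U" "X \<preceq> (\<lambda>n. (m n)\<^sup>2) \<Longrightarrow> X \<preceq> U"
  by (erule lesssim_mono; use u_pos in \<open>simp add: less_imp_le\<close>)+

lemma U_le_m: "U \<preceq> m"
  by (rule lesssim_add[OF u_le_m m_sq_le_m])

lemma lesssim_m_m: "X \<preceq> (\<lambda>n. m n * m n) \<Longrightarrow> X \<preceq> U"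
  using le_U(2)[of X] by (simp add: power2_eq_square)

lemma h_ell_order:
  assumes "i \<in> B" shows "(\<lambda>n. h n $ i * ell n $ i) \<preceq> U"
  using lesssim_mult[OF h_active_order[OF assms] ell_active_order[OF assms]] by (simp add: U_eq[symmetric])

text \<open>Adding \<open>h * l\<close> to the bracket of the multiplier step brings in
  \<open>s\<close>, which cancels the constraint value up to the residual. The bracket drops from
  order 1 to order \<open>m\<close>, and the inverse of \<open>h\<close> supplies the second factor
  \<open>m\<close>.\<close>

lemma ell_inactive_plus_l:
  assumes "i \<notin> B" shows "(\<lambda>n. ell n $ i + l n $ i) \<preceq> (\<lambda>n. (m n)\<^sup>2)"
proof -
  let ?X = "\<lambda>n. (b n - g (z n)) $ i + (g (z n) + s n) $ i - t n $ i / l n $ i + column i (J n) \<bullet> dz n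
      + (h n $ i - s n $ i / l n $ i) * l n $ i"
  have "?X \<preceq> m"
  proof (rule lesssim_add[OF lesssim_add[OF lesssim_diff[OF lesssim_add]]])
    show "(\<lambda>n. (b n - g (z n)) $ i) \<preceq> m" by (rule lesssim_nth[OF lesssim_trans[OF b_order u_le_m]])
    show "(\<lambda>n. (g (z n) + s n) $ i) \<preceq> m" by (rule lesssim_nth[OF residual_g])
    show "(\<lambda>n. t n $ i / l n $ i) \<preceq> m" by (rule t_div_l)
    show "(\<lambda>n. column i (J n) \<bullet> dz n) \<preceq> m"
      using lesssim_inner[OF column_lesssim[OF J_bounded] dz_order] by simp
    \<comment> \<open>The perturbation of \<open>h\<close> is only of order \<open>u / m\<close> off
      the active set, but it multiplies \<open>l\<close>, which is of order
      \<open>m\<close>.\<close>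
    have "u n / m n * m n = u n" for n using m_pos[of n] by (simp del: m_pos)
    then show "(\<lambda>n. (h n $ i - s n $ i / l n $ i) * l n $ i) \<preceq> m"
      using lesssim_trans[OF _ u_le_m] lesssim_mult[OF h_inactive[OF assms] inactive_l[OF assms]] by simp
  qed
  from lesssim_mult[OF this inverse_h_inactive[OF assms]]
  have "(\<lambda>n. ?X n * inverse (h n $ i)) \<preceq> (\<lambda>n. (m n)\<^sup>2)" by (simp add: power2_eq_square)
  moreover have "\<forall>\<^sub>F n in sequentially. norm (ell n $ i + l n $ i) \<le> norm (?X n * inverse (h n $ i))"
    using eventually_h_pos
  proof eventually_elim
    case (elim n)
    then have "h n $ i \<noteq> 0" by (metis less_irrefl)
    moreover have "l n $ i \<noteq> 0" using pos(1)[of n i] by simp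
    ultimately have "ell n $ i + l n $ i = ?X n * inverse (h n $ i)"
      by (simp add: ell_def multiplier_step_def field_simps)
    then show ?case by simp
  qed
  ultimately show ?thesis by (rule lesssim_norm_le)
qed

lemma dl_minus_ell_bound:
  assumes "(\<lambda>n. \<bar>b n $ i\<bar> + \<bar>t n $ i / l n $ i\<bar> + norm (column i (J n)) * norm (dz n)) \<preceq> W"
    "(\<lambda>n. inverse (h n $ i)) \<preceq> V"
  shows "(\<lambda>n. dl n $ i - ell n $ i) \<preceq> (\<lambda>n. u n * W n * V n)"
proof -
  let ?W = "\<lambda>n. \<bar>b n $ i\<bar> + \<bar>t n $ i / l n $ i\<bar> + norm (column i (J n)) * norm (dz n)"
  have "(\<lambda>n. Kr * (u n * ?W n * inverse (h n $ i))) \<preceq> (\<lambda>n. 1 * (u n * W n * V n))"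
    by (intro lesssim_mult lesssim_const lesssim_refl assms)
  moreover have "\<forall>\<^sub>F n in sequentially. norm (dl n $ i - ell n $ i) \<le> norm (Kr * (u n * ?W n * inverse (h n $ i)))"
    using eventually_h_pos
  proof eventually_elim
    case (elim n)
    have "norm (dl n $ i - ell n $ i) \<le> Kr * (u n * ?W n / \<bar>h n $ i\<bar>)"
      unfolding ell_def real_norm_def by (rule dl_error) (use elim in \<open>metis less_irrefl\<close>)
    also have "\<dots> = Kr * (u n * ?W n * inverse (h n $ i))"
      using elim by (simp add: divide_inverse less_imp_le)
    finally show ?case by (rule order_trans) simp
  qed
  ultimately have "(\<lambda>n. dl n $ i - ell n $ i) \<preceq> (\<lambda>n. 1 * (u n * W n * V n))" by (rule lesssim_norm_le)
  then show ?thesis by simp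
qed

lemma column_dz_order: "(\<lambda>n. norm (column i (J n)) * norm (dz n)) \<preceq> m"
  using lesssim_mult[of "\<lambda>n. norm (column i (J n))" "\<lambda>_. 1" "\<lambda>n. norm (dz n)" m]
    column_lesssim[OF J_bounded] dz_order by simp

lemma lesssim_abs: "X \<preceq> Y \<Longrightarrow> (\<lambda>n. \<bar>X n\<bar>) \<preceq> Y" for X :: "nat \<Rightarrow> real"
  by (simp add: lesssim_def)

text \<open>The smallness \<open>m\<close> of the bracket on the active set offsets the
  amplification \<open>1 / m\<close> by the inverse of \<open>h\<close>.\<close>

lemma dl_minus_ell_active:
  assumes "i \<in> B" shows "(\<lambda>n. dl n $ i - ell n $ i) \<preceq> u"
proof -
  have "(\<lambda>n. \<bar>b n $ i\<bar> + \<bar>t n $ i / l n $ i\<bar> + norm (column i (J n)) * norm (dz n)) \<preceq> m"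
    by (intro lesssim_add lesssim_abs column_dz_order b_active assms t_div_l)
  from dl_minus_ell_bound[OF this inverse_h_active[OF assms]]
  have "(\<lambda>n. dl n $ i - ell n $ i) \<preceq> (\<lambda>n. u n * m n * inverse (m n))" .
  moreover have "u n * m n * inverse (m n) = u n" for n using m_pos[of n] by (simp del: m_pos)
  ultimately show ?thesis by simp
qed

lemma dl_minus_ell_inactive:
  assumes "i \<notin> B" shows "(\<lambda>n. dl n $ i - ell n $ i) \<preceq> (\<lambda>n. u n * m n)"
proof -
  have "(\<lambda>n. \<bar>b n $ i\<bar> + \<bar>t n $ i / l n $ i\<bar> + norm (column i (J n)) * norm (dz n)) \<preceq> (\<lambda>_. 1)"
    by (intro lesssim_add lesssim_abs lesssim_nth[OF b_bounded] lesssim_trans[OF column_dz_order lesssim_tendsto[OF m_lim]]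
        lesssim_trans[OF t_div_l lesssim_tendsto[OF m_lim]])
  from dl_minus_ell_bound[OF this inverse_h_inactive[OF assms]]
  show ?thesis by simp
qed

lemma dl_minus_ell: "(\<lambda>n. dl n - ell n) \<preceq> u"
proof (rule lesssim_vec)
  fix i
  have "(\<lambda>n. u n * m n) \<preceq> u"
    using lesssim_mult[OF lesssim_refl lesssim_tendsto[OF m_lim], of u] by simp
  then show "(\<lambda>n. (dl n - ell n) $ i) \<preceq> u"
    using dl_minus_ell_active[of i] lesssim_trans[OF dl_minus_ell_inactive[of i]]
    by (cases "i \<in> B") simp_all
qed

lemma dl_active:
  assumes "i \<in> B" shows "(\<lambda>n. dl n $ i) \<preceq> (\<lambda>n. m n + r n)"
proof -
  have "u \<preceq> (\<lambda>n. m n + r n)" by (rule lesssim_mono[OF u_le_m]) auto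
  from lesssim_add[OF lesssim_trans[OF dl_minus_ell_active[OF assms] this] ell_active_order[OF assms]]
  show ?thesis by simp
qed

lemma dl_inactive:
  assumes "i \<notin> B" shows "(\<lambda>n. l n $ i + dl n $ i) \<preceq> (\<lambda>n. (m n)\<^sup>2)"
proof -
  have "(\<lambda>n. u n * m n) \<preceq> (\<lambda>n. (m n)\<^sup>2)"
    using lesssim_mult[OF u_le_m lesssim_refl, of m] by (simp add: power2_eq_square)
  from lesssim_add[OF lesssim_trans[OF dl_minus_ell_inactive[OF assms] this] ell_inactive_plus_l[OF assms]]
  show ?thesis by (simp add: add.commute)
qed

lemma dl_order: "dl \<preceq> (\<lambda>n. m n + r n)"
proof (rule lesssim_vec)
  fix i
  show "(\<lambda>n. dl n $ i) \<preceq> (\<lambda>n. m n + r n)"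
  proof (cases "i \<in> B")
    case False
    have m_le: "m \<preceq> (\<lambda>n. m n + r n)" by (rule lesssim_mono[OF lesssim_refl]) auto
    from lesssim_diff[OF lesssim_trans[OF dl_inactive[OF False] m_sq_le_m] inactive_l[OF False]]
    show ?thesis using lesssim_trans[OF _ m_le] by simp
  qed (rule dl_active)
qed

lemma ds_eq: "(\<lambda>n. ds n + (g (z n) + s n) + transpose (nabla_g g (z n)) *v dz n) \<preceq> u"
proof (rule lesssim_vec)
  fix i
  let ?W = "\<lambda>n. \<bar>b n $ i\<bar> + \<bar>s n $ i\<bar> + norm (column i (J n)) * norm (dz n)"
  have "(\<lambda>n. Kr * (u n * ?W n)) \<preceq> (\<lambda>n. 1 * (u n * 1))"
    by (intro lesssim_mult lesssim_const lesssim_refl lesssim_add lesssim_abs lesssim_nth[OF b_bounded]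
        lesssim_nth[OF s_bounded] lesssim_trans[OF column_dz_order lesssim_tendsto[OF m_lim]])
  then have "(\<lambda>n. Kr * (u n * ?W n)) \<preceq> u" by simp
  then have 1: "(\<lambda>n. ds n $ i + (b n $ i + s n $ i) + column i (J n) \<bullet> dz n) \<preceq> u"
    by (rule lesssim_norm_le) (use order_trans[OF ds_error abs_ge_self] in auto)
  have 2: "(\<lambda>n. column i (J n - nabla_g g (z n)) \<bullet> dz n) \<preceq> u"
    using lesssim_inner[OF column_lesssim[OF J_order] lesssim_trans[OF dz_order lesssim_tendsto[OF m_lim]]] by simp
  from lesssim_diff[OF lesssim_diff[OF 1 lesssim_nth[OF b_order, of i]] 2]
  show "(\<lambda>n. (ds n + (g (z n) + s n) + transpose (nabla_g g (z n)) *v dz n) $ i) \<preceq> u"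
    by (simp add: transpose_nabla_g_mult_vector column_diff column_nabla_g inner_diff_left algebra_simps)
qed

lemma ds_order: "ds \<preceq> m"
proof -
  have "(\<lambda>n. nabla_g g (z n)) \<preceq> (\<lambda>_. 1)"
    using lesssim_diff[OF J_bounded lesssim_trans[OF J_order lesssim_tendsto[OF u_lim]]] by simp
  then have "(\<lambda>n. transpose (nabla_g g (z n))) \<preceq> (\<lambda>_. 1)"
    by (intro lesssim_vec) (auto simp: transpose_def intro!: lesssim_nth)
  from lesssim_matrix_vector[OF this dz_order]
  have "(\<lambda>n. transpose (nabla_g g (z n)) *v dz n) \<preceq> m" by simp
  from lesssim_diff[OF lesssim_diff[OF lesssim_trans[OF ds_eq u_le_m] this] residual_g]
  show ?thesis by simp
qed

text \<open>The slack update and the complementarity row contain the same linearized constraint, so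
  \<open>s + ds\<close> equals \<open>- (h * ell + t / l)\<close> up to roundoff;
  \<open>h * ell\<close> is the product of an order \<open>m\<close> and an order
  \<open>m + r\<close> quantity.\<close>

lemma ds_active:
  assumes "i \<in> B" shows "(\<lambda>n. s n $ i + ds n $ i) \<preceq> U"
proof -
  let ?X = "\<lambda>n. (ds n + (g (z n) + s n) + transpose (nabla_g g (z n)) *v dz n) $ i - (h n $ i * ell n $ i + t n $ i / l n $ i)
      + (b n - g (z n)) $ i + column i (J n - nabla_g g (z n)) \<bullet> dz n"
  have 2: "(\<lambda>n. column i (J n - nabla_g g (z n)) \<bullet> dz n) \<preceq> u"
    using lesssim_inner[OF column_lesssim[OF J_order] lesssim_trans[OF dz_order lesssim_tendsto[OF m_lim]]] by simp
  have "?X \<preceq> U"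
    by (rule lesssim_add[OF lesssim_add[OF lesssim_diff[OF _ lesssim_add]]])
       (intro le_U(1) lesssim_nth[OF ds_eq] h_ell_order[OF assms] le_U(2)[OF t_div_l_active[OF assms]]
         lesssim_nth[OF b_order] 2)+
  moreover have "\<forall>\<^sub>F n in sequentially. norm (s n $ i + ds n $ i) \<le> norm (?X n)"
    using eventually_h_pos
  proof eventually_elim
    case (elim n)
    then have "h n $ i \<noteq> 0" by (metis less_irrefl)
    then have "h n $ i * ell n $ i = b n $ i - t n $ i / l n $ i + column i (J n) \<bullet> dz n"
      by (simp add: ell_def multiplier_step_def)
    then have "s n $ i + ds n $ i = ?X n"
      by (simp add: transpose_nabla_g_mult_vector column_diff column_nabla_g inner_diff_left)
    then show ?case by simp
  qed
  ultimately show ?thesis by (rule lesssim_norm_le)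
qed

end

section \<open>Estimates for the computed step\<close>

lemma diag_mat_mult: "diag_mat a ** diag_mat b = diag_mat (\<chi> i. a $ i * b $ i)"
  by (simp add: diag_mat_def matrix_matrix_mult_def vec_eq_iff if_distrib[of "\<lambda>x. _ * x"] if_distrib[of "\<lambda>x. x * _"] cong: if_cong)

lemma diag_mat_mult_vector: "(diag_mat a *v v) $ i = a $ i * v $ i"
  by (simp add: diag_mat_def matrix_vector_mult_def if_distrib[of "\<lambda>x. x * _"] cong: if_cong)

lemma matrix_inv_unique:
  fixes M N :: "real^'m^'m"
  assumes "M ** N = mat 1" "N ** M = mat 1"
  shows "matrix_inv M = N"
proof -
  have "M ** matrix_inv M = mat 1 \<and> matrix_inv M ** M = mat 1"
    unfolding matrix_inv_def by (rule someI[of _ N]) (use assms in simp)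
  then have "matrix_inv M = matrix_inv M ** (M ** N)" "matrix_inv M ** M = mat 1"
    using assms by (simp_all add: matrix_mul_rid)
  then show ?thesis by (simp add: matrix_mul_assoc matrix_mul_lid)
qed

lemma matrix_inv_diag_mat:
  assumes "\<And>i. a $ i \<noteq> 0"
  shows "matrix_inv (diag_mat a) = diag_mat (\<chi> i. 1 / a $ i)"
proof (rule matrix_inv_unique)
  have "diag_mat (\<chi> i. 1) = (mat 1 :: real^'m^'m)" by (simp add: diag_mat_def mat_def vec_eq_iff)
  then show "diag_mat a ** diag_mat (\<chi> i. 1 / a $ i) = mat 1" "diag_mat (\<chi> i. 1 / a $ i) ** diag_mat a = mat 1"
    using assms by (simp_all add: diag_mat_mult)
qed

text \<open>Write \<open>c\<close> for the inner product constant. Division contributes 1, the inner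
  product \<open>c\<close>, and the two additions \<open>3 * (2 + c)\<close>, so \<open>w\<close>
  has error factor \<open>7 + 4 * c\<close> and size at most \<open>(8 + 4 * c) * W\<close>. The
  last multiplication adds the latter, giving \<open>15 + 8 * c\<close>.\<close>

lemma computed_multiplier_error:
  fixes x y :: "real^'n" and u :: real
  assumes fp: "fp_model u Fl fl" "0 \<le> u" "u \<le> 1"
    and Fl: "fp_vector Fl x" "fp_vector Fl y" "e \<in> Fl" "b \<in> Fl" "t \<in> Fl" "l \<in> Fl" "l \<noteq> 0"
    and p: "fp_inner fl x y p" and w: "w \<in> fp_diff_plus fl b (fl FDiv t l) p"
    and W: "W = \<bar>b\<bar> + \<bar>t / l\<bar> + norm x * norm y"
  shows "\<bar>fl FMul e w - e * (b - t / l + x \<bullet> y)\<bar>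
    \<le> (15 + 8 * ((2 * 2 ^ CARD('n) + 1) * CARD('n))) * (u * W * \<bar>e\<bar>)"
proof -
  define c :: real where "c = (2 * 2 ^ CARD('n) + 1) * CARD('n)"
  have c: "0 \<le> c" by (simp add: c_def)
  define q where "q = fl FDiv t l"
  define k where "k = norm x * norm y"
  have k: "0 \<le> k" by (simp add: k_def)
  have q: "q \<in> Fl" "\<bar>q - t / l\<bar> \<le> u * \<bar>t / l\<bar>"
    using fp_model_op[OF fp(1) Fl(5,6), of FDiv] Fl(7) by (auto simp: q_def)
  have pk: "p \<in> Fl" "\<bar>p - x \<bullet> y\<bar> \<le> c * (u * k)"
    using fp_inner_error[OF p fp Fl(1,2)] by (auto simp: c_def k_def)
  have "w \<in> Fl" and w3: "\<bar>w - (b - q + p)\<bar> \<le> 3 * (u * (\<bar>b\<bar> + \<bar>q\<bar> + \<bar>p\<bar>))"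
    using fp_diff_plus_error[OF w[folded q_def] fp Fl(4) q(1) pk(1)] by auto
  have xy: "\<bar>x \<bullet> y\<bar> \<le> k" unfolding k_def by (rule Cauchy_Schwarz_ineq2)
  have W0: "0 \<le> W" "\<bar>t / l\<bar> \<le> W" "k \<le> W" using k by (auto simp: W k_def)
  have "u * \<bar>t / l\<bar> \<le> \<bar>t / l\<bar>" "u * k \<le> k"
    by (intro mult_left_le_one_le abs_ge_zero fp(2,3) k)+
  then have "\<bar>q\<bar> \<le> 2 * \<bar>t / l\<bar>" "\<bar>p\<bar> \<le> k + c * k"
    using q(2) pk(2) xy mult_left_mono[OF \<open>u * k \<le> k\<close> c] by linarith+
  moreover have "c * k \<le> c * W" using c W0 by (intro mult_left_mono)
  ultimately have "\<bar>b\<bar> + \<bar>q\<bar> + \<bar>p\<bar> \<le> (2 + c) * W"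
  proof -
    have "\<bar>b\<bar> + 2 * \<bar>t / l\<bar> + k \<le> 2 * W" using k unfolding W k_def[symmetric] by simp
    moreover have "(2 + c) * W = 2 * W + c * W" by (rule distrib_right)
    ultimately show ?thesis
      using \<open>\<bar>q\<bar> \<le> 2 * \<bar>t / l\<bar>\<close> \<open>\<bar>p\<bar> \<le> k + c * k\<close> \<open>c * k \<le> c * W\<close> by linarith
  qed
  then have "3 * (u * (\<bar>b\<bar> + \<bar>q\<bar> + \<bar>p\<bar>)) \<le> 3 * (u * ((2 + c) * W))"
    using fp(2) by (intro mult_left_mono) auto
  note e1 = order_trans[OF w3 this]
  have "u * \<bar>t / l\<bar> \<le> u * W" "c * (u * k) \<le> c * (u * W)"
    by (intro mult_left_mono fp(2) W0 c)+
  note e2 = order_trans[OF q(2) this(1)] and e3 = order_trans[OF pk(2) this(2)]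
  have "\<bar>w - (b - t / l + x \<bullet> y)\<bar> \<le> \<bar>w - (b - q + p)\<bar> + \<bar>q - t / l\<bar> + \<bar>p - x \<bullet> y\<bar>"
    by linarith
  also have "\<dots> \<le> 3 * (u * ((2 + c) * W)) + u * W + c * (u * W)"
    by (intro add_mono e1 e2 e3)
  also have "\<dots> = 7 * (u * W) + 4 * (c * (u * W))" by (simp add: algebra_simps)
  finally have err: "\<bar>w - (b - t / l + x \<bullet> y)\<bar> \<le> 7 * (u * W) + 4 * (c * (u * W))" .
  have "u * W \<le> W" using fp(2,3) W0 by (intro mult_left_le_one_le) auto
  then have "c * (u * W) \<le> c * W" using c by (rule mult_left_mono)
  moreover have "\<bar>b - t / l + x \<bullet> y\<bar> \<le> W" using xy unfolding W k_def[symmetric] by linarith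
  ultimately have "\<bar>w\<bar> \<le> 8 * W + 4 * (c * W)" using err \<open>u * W \<le> W\<close> by linarith
  then have "u * (\<bar>e\<bar> * \<bar>w\<bar>) \<le> u * (\<bar>e\<bar> * (8 * W + 4 * (c * W)))"
    using fp(2) by (intro mult_left_mono) auto
  moreover have "\<bar>fl FMul e w - e * w\<bar> \<le> u * (\<bar>e\<bar> * \<bar>w\<bar>)"
    using fp_model_op(2)[OF fp(1) Fl(3) \<open>w \<in> Fl\<close>, of FMul] by (simp add: abs_mult)
  moreover have "\<bar>e * w - e * (b - t / l + x \<bullet> y)\<bar> \<le> \<bar>e\<bar> * (7 * (u * W) + 4 * (c * (u * W)))"
    using err by (simp add: right_diff_distrib[symmetric] abs_mult mult_left_mono del: right_diff_distrib)
  ultimately have "\<bar>fl FMul e w - e * (b - t / l + x \<bullet> y)\<bar>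
      \<le> u * (\<bar>e\<bar> * (8 * W + 4 * (c * W))) + \<bar>e\<bar> * (7 * (u * W) + 4 * (c * (u * W)))"
    by linarith
  also have "\<dots> = (15 + 8 * c) * (u * W * \<bar>e\<bar>)" by (simp add: algebra_simps)
  finally show ?thesis by (simp add: c_def)
qed

lemma computed_slack_error:
  fixes x y :: "real^'n" and u :: real
  assumes fp: "fp_model u Fl fl" "0 \<le> u" "u \<le> 1"
    and Fl: "fp_vector Fl x" "fp_vector Fl y" "b \<in> Fl" "s \<in> Fl"
    and p: "fp_inner fl x y p" and W: "W = \<bar>b\<bar> + \<bar>s\<bar> + norm x * norm y"
  shows "\<bar>fl FSub (- fl FAdd b s) p + (b + s) + x \<bullet> y\<bar>
    \<le> (15 + 8 * ((2 * 2 ^ CARD('n) + 1) * CARD('n))) * (u * W)"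
proof -
  define c :: real where "c = (2 * 2 ^ CARD('n) + 1) * CARD('n)"
  have c: "0 \<le> c" by (simp add: c_def)
  define k where "k = norm x * norm y"
  have k: "0 \<le> k" by (simp add: k_def)
  have xy: "\<bar>x \<bullet> y\<bar> \<le> k" unfolding k_def by (rule Cauchy_Schwarz_ineq2)
  have pk: "p \<in> Fl" "\<bar>p - x \<bullet> y\<bar> \<le> c * (u * k)"
    using fp_inner_error[OF p fp Fl(1,2)] by (auto simp: c_def k_def)
  define a where "a = fl FAdd b s"
  have a: "a \<in> Fl" "\<bar>a - (b + s)\<bar> \<le> u * \<bar>b + s\<bar>"
    using fp_model_op[OF fp(1) Fl(3,4), of FAdd] by (auto simp: a_def)
  have d: "\<bar>fl FSub (- a) p - (- a - p)\<bar> \<le> u * \<bar>- a - p\<bar>"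
    using fp_model_op(2)[OF fp(1) fp_model_uminus[OF fp(1) a(1)] pk(1), of FSub] by simp
  have W0: "0 \<le> W" "k \<le> W" "\<bar>b + s\<bar> + k \<le> W" using k by (auto simp: W k_def)
  have "c * (u * k) \<le> c * (u * W)" "u * \<bar>b + s\<bar> + u * k \<le> u * W"
    using fp(2) W0 c unfolding distrib_left[symmetric] by (auto intro!: mult_left_mono)
  moreover have "0 \<le> u * k" using fp k by simp
  ultimately have ap: "\<bar>a - (b + s)\<bar> + \<bar>p - x \<bullet> y\<bar> \<le> u * W + c * (u * W)" using a(2) pk(2) by linarith
  have "u * W \<le> W" using fp(2,3) W0 by (intro mult_left_le_one_le) auto
  then have "c * (u * W) \<le> c * W" using c by (rule mult_left_mono)
  then have "\<bar>- a - p\<bar> \<le> 2 * W + c * W" using ap xy W0 \<open>u * W \<le> W\<close> by linarith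
  then have "u * \<bar>- a - p\<bar> \<le> u * (2 * W + c * W)" using fp(2) by (rule mult_left_mono)
  moreover have "u * (2 * W + c * W) = 2 * (u * W) + c * (u * W)" by (simp add: algebra_simps)
  ultimately have "\<bar>fl FSub (- a) p + (b + s) + x \<bullet> y\<bar> \<le> 3 * (u * W) + 2 * (c * (u * W))"
    using ap d by linarith
  \<comment> \<open>Relaxed to the constant of the multiplier error, so that one constant covers
    both assignments.\<close>
  also have "\<dots> \<le> 15 * (u * W) + 8 * (c * (u * W))"
    using fp(2) W0 c by (intro add_mono mult_right_mono) auto
  finally show ?thesis by (simp add: a_def c_def algebra_simps)
qed

text \<open>The assumptions on the step in \<open>approx_step\<close> for a single instance with
  explicit constants, so that the perturbations can be chosen index by index.\<close>

definition step_data ::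
  "(real^'n \<Rightarrow> real) \<Rightarrow> (real^'n \<Rightarrow> real^'m) \<Rightarrow> real^'n \<Rightarrow> real \<Rightarrow> real \<Rightarrow> real \<Rightarrow>
   real^'n \<Rightarrow> real^'m \<Rightarrow> real^'m \<Rightarrow> real^'m \<Rightarrow> real^'n \<Rightarrow> real^'m \<Rightarrow> real^'m \<Rightarrow>
   real^'n^'n \<Rightarrow> real^'n \<Rightarrow> real^'m^'n \<Rightarrow> real^'m \<Rightarrow> real^'m \<Rightarrow> bool" where
  "step_data \<phi> g zs K Kr u z l s t dz dl ds Fm \<rho> J b h \<longleftrightarrow>
     norm Fm \<le> K * u + K * (u / mu l s) \<and> norm \<rho> \<le> 2 * K * u \<and>
     norm (J - nabla_g g z) \<le> K * u \<and> norm (b - g z) \<le> K * u \<and>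
     (\<forall>i\<in>active g zs. \<bar>h $ i - s $ i / l $ i\<bar> \<le> K * (mu l s * u)) \<and>
     (\<forall>i\<in>- active g zs. \<bar>h $ i - s $ i / l $ i\<bar> \<le> K * (u / mu l s)) \<and>
     ((\<forall>i. h $ i \<noteq> 0) \<longrightarrow>
       (Lzz \<phi> g z l + Fm) *v dz + J *v multiplier_step b t l J dz h = - Lz \<phi> g z l + \<rho> \<and>
       (\<forall>i. \<bar>dl $ i - multiplier_step b t l J dz h $ i\<bar>
         \<le> Kr * (u * (\<bar>b $ i\<bar> + \<bar>t $ i / l $ i\<bar> + norm (column i J) * norm dz) / \<bar>h $ i\<bar>))) \<and>
     (\<forall>i. \<bar>ds $ i + (b $ i + s $ i) + column i J \<bullet> dz\<bar>
       \<le> Kr * (u * (\<bar>b $ i\<bar> + \<bar>s $ i\<bar> + norm (column i J) * norm dz)))"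

lemma computed_step_imp_step_data:
  fixes \<phi> :: "real^'n \<Rightarrow> real" and g :: "real^'n \<Rightarrow> real^'m"
  assumes step: "computed_step \<phi> g zs K u Fl fl z l s t dz dl ds"
    and fp: "fp_model u Fl fl" "0 \<le> u" "u \<le> 1" and pos: "\<And>i. 0 < l $ i"
  shows "\<exists>Fm \<rho> J b h. step_data \<phi> g zs K (15 + 8 * ((2 * 2 ^ CARD('n) + 1) * CARD('n))) u z l s t dz dl ds Fm \<rho> J b h"
proof -
  obtain Fbar fbar F f G Fhat fhat A c J b E where
    pb: "perturbation_bounds K u (mu l s) (active g zs) Fbar fbar F f G Fhat fhat"
    and A: "A = Lzz \<phi> g z l + Fbar" and c: "c = Lz \<phi> g z l + fbar"
    and J: "J = nabla_g g z + F" and b: "b = g z + f"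
    and E: "E = matrix_inv (D_mat l s + G)"
    and Fl: "fp_vector Fl z" "fp_vector Fl l" "fp_vector Fl s" "fp_vector Fl t"
      "\<And>j. fp_vector Fl (J $ j)" "fp_vector Fl b" "\<And>i. E $ i $ i \<in> Fl" "fp_vector Fl dz"
    and eq: "(A + J ** E ** transpose J + Fhat) *v dz
          = - c - (J ** E) *v (b - matrix_inv (diag_mat l) *v t) + fhat"
    and dl: "\<And>i. \<exists>p w. fp_inner fl (column i J) dz p \<and>
               w \<in> fp_diff_plus fl (b $ i) (fl FDiv (t $ i) (l $ i)) p \<and>
               dl $ i = fl FMul (E $ i $ i) w"
    and ds: "\<And>i. \<exists>p. fp_inner fl (column i J) dz p \<and>
               ds $ i = fl FSub (- fl FAdd (b $ i) (s $ i)) p"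
    using step unfolding computed_step_def by blast
  \<comment> \<open>\<open>D + G\<close> is diagonal, since \<open>G\<close> has no off-diagonal
    entries; this is its diagonal.\<close>
  define h where "h = (\<chi> i. s $ i / l $ i + G $ i $ i)"
  have l0: "l $ i \<noteq> 0" for i using pos[of i] by simp
  have col: "fp_vector Fl (column i J)" for i using Fl(5) by (simp add: fp_vector_def column_def)
  have comp: "b $ i \<in> Fl" "t $ i \<in> Fl" "l $ i \<in> Fl" "s $ i \<in> Fl" for i
    using Fl by (auto simp: fp_vector_def)
  have linv: "matrix_inv (diag_mat l) = diag_mat (\<chi> i. 1 / l $ i)"
    by (rule matrix_inv_diag_mat) (rule l0)
  have "D_mat l s + G = diag_mat h"
    using pb unfolding D_mat_def linv diag_mat_mult
    by (auto simp: h_def diag_mat_def vec_eq_iff perturbation_bounds_def)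
  then have Einv: "E = diag_mat (\<chi> i. 1 / h $ i)" if "\<And>i. h $ i \<noteq> 0"
    unfolding E using matrix_inv_diag_mat[of h] that by simp
  \<comment> \<open>The perturbations of the constraint values and gradients stay inside
    \<open>b\<close> and \<open>J\<close>; only those of the Hessian and of the right-hand side have
    to be merged.\<close>
  have "step_data \<phi> g zs K (15 + 8 * ((2 * 2 ^ CARD('n) + 1) * CARD('n))) u z l s t dz dl ds
      (Fbar + Fhat) (fhat - fbar) J b h"
    unfolding step_data_def
  proof (intro conjI ballI allI impI)
    show "norm (Fbar + Fhat) \<le> K * u + K * (u / mu l s)"
      using pb by (auto simp: perturbation_bounds_def intro: norm_triangle_mono)
    show "norm (fhat - fbar) \<le> 2 * K * u"
      using pb norm_triangle_ineq4[of fhat fbar] by (simp add: perturbation_bounds_def)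
    show "norm (J - nabla_g g z) \<le> K * u" "norm (b - g z) \<le> K * u"
      using pb by (auto simp: perturbation_bounds_def J b)
    show "\<bar>h $ i - s $ i / l $ i\<bar> \<le> K * (mu l s * u)" if "i \<in> active g zs" for i
      using pb that by (simp add: perturbation_bounds_def h_def)
    show "\<bar>h $ i - s $ i / l $ i\<bar> \<le> K * (u / mu l s)" if "i \<in> - active g zs" for i
      using pb that unfolding perturbation_bounds_def h_def by simp
  next
    assume h0: "\<forall>i. h $ i \<noteq> 0"
    then have E': "E = diag_mat (\<chi> i. 1 / h $ i)" by (intro Einv) auto
    let ?v = "matrix_inv (diag_mat l) *v t"
    \<comment> \<open>Multiplied by \<open>J\<close>, the second summand is the condensed block on
      the left of the linear system and the first its counterpart on the right, which restores the
      saddle point form.\<close>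
    have "multiplier_step b t l J dz h = E *v (b - ?v) + E *v (transpose J *v dz)"
    proof (subst vec_eq_iff, rule allI)
      fix i
      have "(transpose J *v dz) $ i = column i J \<bullet> dz"
        by (simp add: transpose_def column_def matrix_vector_mult_def inner_vec_def)
      then show "multiplier_step b t l J dz h $ i = (E *v (b - ?v) + E *v (transpose J *v dz)) $ i"
        by (simp add: E' linv diag_mat_mult_vector multiplier_step_def add_divide_distrib[symmetric])
    qed
    then have "J *v multiplier_step b t l J dz h = (J ** E) *v (b - ?v) + (J ** E ** transpose J) *v dz"
      by (simp only: matrix_vector_right_distrib matrix_vector_mul_assoc matrix_mul_assoc)
    moreover have "(A + J ** E ** transpose J + Fhat) *v dz
        = (Lzz \<phi> g z l + (Fbar + Fhat)) *v dz + (J ** E ** transpose J) *v dz"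
      unfolding A matrix_vector_mult_add_rdistrib by simp
    ultimately have "(Lzz \<phi> g z l + (Fbar + Fhat)) *v dz + J *v multiplier_step b t l J dz h
        = (A + J ** E ** transpose J + Fhat) *v dz + (J ** E) *v (b - ?v)"
      by simp
    also have "\<dots> = - Lz \<phi> g z l + (fhat - fbar)"
      unfolding eq c by simp
    finally show "(Lzz \<phi> g z l + (Fbar + Fhat)) *v dz + J *v multiplier_step b t l J dz h
        = - Lz \<phi> g z l + (fhat - fbar)" .
    fix i
    obtain p w where p: "fp_inner fl (column i J) dz p"
      and w: "w \<in> fp_diff_plus fl (b $ i) (fl FDiv (t $ i) (l $ i)) p" and dli: "dl $ i = fl FMul (E $ i $ i) w"
      using dl by blast
    have Ei: "E $ i $ i = 1 / h $ i" by (simp add: E' diag_mat_def)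
    from computed_multiplier_error[OF fp col Fl(8) Fl(7)[of i] comp(1-3)[of i] l0 p w refl]
    show "\<bar>dl $ i - multiplier_step b t l J dz h $ i\<bar>
         \<le> (15 + 8 * ((2 * 2 ^ CARD('n) + 1) * CARD('n))) * (u * (\<bar>b $ i\<bar> + \<bar>t $ i / l $ i\<bar> + norm (column i J) * norm dz) / \<bar>h $ i\<bar>)"
      unfolding dli Ei multiplier_step_def by simp
  next
    fix i
    obtain p where p: "fp_inner fl (column i J) dz p" and dsi: "ds $ i = fl FSub (- fl FAdd (b $ i) (s $ i)) p"
      using ds by blast
    from computed_slack_error[OF fp col Fl(8) comp(1,4)[of i] p refl]
    show "\<bar>ds $ i + (b $ i + s $ i) + column i J \<bullet> dz\<bar>
       \<le> (15 + 8 * ((2 * 2 ^ CARD('n) + 1) * CARD('n))) * (u * (\<bar>b $ i\<bar> + \<bar>s $ i\<bar> + norm (column i J) * norm dz))"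
      unfolding dsi .
  qed
  then show ?thesis by blast
qed

section \<open>Complementarity products and residuals along the step\<close>

context approx_step
begin

text \<open>The step length is an arbitrary sequence, since instances violating an estimate may use
  a different \<alpha> at each index; this is what gives uniformity in \<alpha>.\<close>

context
  fixes \<alpha> :: "nat \<Rightarrow> real"
  assumes \<alpha>: "\<And>n. 0 \<le> \<alpha> n" "\<And>n. \<alpha> n \<le> 1"
begin

lemma \<alpha>_order: "\<alpha> \<preceq> (\<lambda>_. 1)" "(\<lambda>n. 1 - \<alpha> n) \<preceq> (\<lambda>_. 1)"
  using \<alpha> by (auto intro!: lesssimI[of _ 1])

lemma lesssim_\<alpha>: "X \<preceq> Y \<Longrightarrow> (\<lambda>n. \<alpha> n * X n) \<preceq> Y" "X \<preceq> Y \<Longrightarrow> (\<lambda>n. (1 - \<alpha> n) * X n) \<preceq> Y"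
  using lesssim_mult[OF \<alpha>_order(1)] lesssim_mult[OF \<alpha>_order(2)] by fastforce+

lemma lesssim_\<alpha>_scaleR: "X \<preceq> Y \<Longrightarrow> (\<lambda>n. \<alpha> n *\<^sub>R X n) \<preceq> Y"
  using lesssim_scaleR[OF \<alpha>_order(1), of X Y] by simp

text \<open>The expansion is grouped around the factor that a full step nearly annihilates:
  \<open>s + ds\<close> for active constraints, \<open>l + dl\<close> for inactive ones. Each
  remaining product pairs bounded or small factors of total order \<open>U\<close>.\<close>

lemma product_step:
  "(\<lambda>n. (l n $ i + \<alpha> n * dl n $ i) * (s n $ i + \<alpha> n * ds n $ i) - (1 - \<alpha> n) * (l n $ i * s n $ i)) \<preceq> U"
  (is "?X \<preceq> _")
proof (cases "i \<in> B")
  case True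
  have eq: "?X n = \<alpha> n * (l n $ i * (s n $ i + ds n $ i))
      + \<alpha> n * (dl n $ i * ((1 - \<alpha> n) * s n $ i + \<alpha> n * (s n $ i + ds n $ i)))" for n
    by (simp add: algebra_simps)
  have 1: "(\<lambda>n. l n $ i * (s n $ i + ds n $ i)) \<preceq> U"
    using lesssim_mult[OF lesssim_nth[OF l_bounded] ds_active[OF True]] by simp
  have "(\<lambda>n. (1 - \<alpha> n) * s n $ i + \<alpha> n * (s n $ i + ds n $ i)) \<preceq> m"
    by (intro lesssim_add lesssim_\<alpha> active_s True lesssim_trans[OF ds_active[OF True] U_le_m])
  from lesssim_mult[OF dl_active[OF True] this]
  have 2: "(\<lambda>n. dl n $ i * ((1 - \<alpha> n) * s n $ i + \<alpha> n * (s n $ i + ds n $ i))) \<preceq> U"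
    by (simp add: U_eq mult.commute)
  show ?thesis unfolding eq by (rule lesssim_add[OF lesssim_\<alpha>(1)[OF 1] lesssim_\<alpha>(1)[OF 2]])
next
  case False
  have eq: "?X n = \<alpha> n * ((1 - \<alpha> n) * (l n $ i * ds n $ i)) + \<alpha> n * ((l n $ i + dl n $ i) * (s n $ i + \<alpha> n * ds n $ i))" for n
    by (simp add: algebra_simps)
  have 1: "(\<lambda>n. l n $ i * ds n $ i) \<preceq> U"
    by (rule lesssim_m_m[OF lesssim_mult[OF inactive_l[OF False] lesssim_nth[OF ds_order]]])
  have "(\<lambda>n. s n $ i + \<alpha> n * ds n $ i) \<preceq> (\<lambda>_. 1)"
    by (intro lesssim_add lesssim_nth[OF s_bounded] lesssim_\<alpha>(1) lesssim_trans[OF lesssim_nth[OF ds_order] lesssim_tendsto[OF m_lim]])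
  from lesssim_mult[OF dl_inactive[OF False] this]
  have 2: "(\<lambda>n. (l n $ i + dl n $ i) * (s n $ i + \<alpha> n * ds n $ i)) \<preceq> U"
    by (intro le_U(2)) simp
  show ?thesis unfolding eq by (rule lesssim_add[OF lesssim_\<alpha>(1)[OF lesssim_\<alpha>(2)[OF 1]] lesssim_\<alpha>(1)[OF 2]])
qed

lemma mu_step:
  "(\<lambda>n. mu (l n + \<alpha> n *\<^sub>R dl n) (s n + \<alpha> n *\<^sub>R ds n) - (1 - \<alpha> n) * mu (l n) (s n)) \<preceq> U"
proof -
  let ?X = "\<lambda>i n. (l n $ i + \<alpha> n * dl n $ i) * (s n $ i + \<alpha> n * ds n $ i) - (1 - \<alpha> n) * (l n $ i * s n $ i)"
  have "(\<lambda>n. (\<Sum>i\<in>UNIV. ?X i n) * (1 / real CARD('m))) \<preceq> (\<lambda>n. U n * 1)"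
    by (intro lesssim_mult lesssim_sum product_step lesssim_const)
  moreover have "(\<Sum>i\<in>UNIV. ?X i n) * (1 / real CARD('m))
      = mu (l n + \<alpha> n *\<^sub>R dl n) (s n + \<alpha> n *\<^sub>R ds n) - (1 - \<alpha> n) * mu (l n) (s n)" for n
    by (simp add: mu_def inner_vec_def sum_subtractf sum_distrib_left diff_divide_distrib)
  ultimately show ?thesis by simp
qed

lemma z_step_lim: "(\<lambda>n. z n + \<alpha> n *\<^sub>R dz n) \<longlonglongrightarrow> zs"
  using tendsto_add[OF z_lim lesssim_tendsto_zero[OF lesssim_\<alpha>_scaleR[OF dz_order] m_lim]] by simp

lemma \<alpha>_dz_sq: "(\<lambda>n. (norm (z n + \<alpha> n *\<^sub>R dz n - z n))\<^sup>2) \<preceq> U"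
  using lesssim_m_m[OF lesssim_inner[OF lesssim_\<alpha>_scaleR[OF dz_order] lesssim_\<alpha>_scaleR[OF dz_order]]]
  by (simp add: dot_square_norm power_mult_distrib power2_eq_square mult_ac)

lemma r_g_step:
  "(\<lambda>n. r_g g (z n + \<alpha> n *\<^sub>R dz n) (s n + \<alpha> n *\<^sub>R ds n) - (1 - \<alpha> n) *\<^sub>R r_g g (z n) (s n)) \<preceq> U"
proof -
  let ?T = "\<lambda>n. transpose (nabla_g g (z n))"
  have eq: "r_g g (z n + \<alpha> n *\<^sub>R dz n) (s n + \<alpha> n *\<^sub>R ds n) - (1 - \<alpha> n) *\<^sub>R r_g g (z n) (s n)
      = (g (z n + \<alpha> n *\<^sub>R dz n) - g (z n) - ?T n *v (z n + \<alpha> n *\<^sub>R dz n - z n))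
        + \<alpha> n *\<^sub>R (ds n + (g (z n) + s n) + ?T n *v dz n)" for n
    by (simp add: r_g_def matrix_vector_mult_scaleR algebra_simps)
  show ?thesis
    unfolding eq
    by (rule lesssim_add[OF lesssim_trans[OF g_expansion[OF z_lim z_step_lim] \<alpha>_dz_sq]
          lesssim_\<alpha>_scaleR[OF le_U(1)[OF ds_eq]]])
qed

text \<open>The gradient of the Lagrangian is affine in the multiplier, so beyond the Taylor
  remainder in \<open>z\<close> and the residuals of the step equation only the change of the
  Jacobian acting on \<open>dl\<close> is left: order \<open>m\<close> times \<open>m + r\<close>,
  which is \<open>U\<close>.\<close>

lemma r_f_step:
  "(\<lambda>n. r_f \<phi> g (z n + \<alpha> n *\<^sub>R dz n) (l n + \<alpha> n *\<^sub>R dl n) - (1 - \<alpha> n) *\<^sub>R r_f \<phi> g (z n) (l n)) \<preceq> U"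
  (is "?X \<preceq> _")
proof -
  let ?z = "\<lambda>n. z n + \<alpha> n *\<^sub>R dz n"
  let ?Y = "\<lambda>n. (Lz \<phi> g (?z n) (l n) - Lz \<phi> g (z n) (l n) - H n *v (?z n - z n))
    + \<alpha> n *\<^sub>R (\<rho> n - Fm n *v dz n + J n *v (dl n - ell n) + (nabla_g g (?z n) - J n) *v dl n)"
  have N: "(\<lambda>n. nabla_g g (?z n) - J n) \<preceq> m"
  proof -
    have "(\<lambda>n. (nabla_g g (?z n) - nabla_g g (z n)) - (J n - nabla_g g (z n))) \<preceq> m"
      by (rule lesssim_diff[OF lesssim_trans[OF nabla_g_diff[OF z_lim z_step_lim]] lesssim_trans[OF J_order u_le_m]])
         (use lesssim_\<alpha>_scaleR[OF dz_order] in \<open>simp add: lesssim_def\<close>)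
    then show ?thesis by simp
  qed
  have "?Y \<preceq> U"
  proof (rule lesssim_add[OF lesssim_trans[OF Lz_expansion[OF z_lim z_step_lim l_bounded] \<alpha>_dz_sq]],
      rule lesssim_\<alpha>_scaleR, rule lesssim_add[OF lesssim_add[OF lesssim_diff]])
    show "\<rho> \<preceq> U" by (rule le_U(1)[OF \<rho>_order])
    show "(\<lambda>n. Fm n *v dz n) \<preceq> U"
      using lesssim_matrix_vector[OF Fm_order dz_order] by (intro le_U(1)) (simp add: u_eq[symmetric] mult.commute)
    show "(\<lambda>n. J n *v (dl n - ell n)) \<preceq> U"
      using lesssim_matrix_vector[OF J_bounded dl_minus_ell] by (intro le_U(1)) simp
    show "(\<lambda>n. (nabla_g g (?z n) - J n) *v dl n) \<preceq> U"
      using lesssim_matrix_vector[OF N dl_order] by (simp add: U_eq)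
  qed
  moreover have "\<forall>\<^sub>F n in sequentially. norm (?X n) \<le> norm (?Y n)"
    using eventually_h_pos
  proof eventually_elim
    case (elim n)
    then have "(H n + Fm n) *v dz n + J n *v ell n = - Lz \<phi> g (z n) (l n) + \<rho> n"
      unfolding ell_def by (intro step_eq) (metis less_irrefl)
    then have "\<rho> n = (H n + Fm n) *v dz n + J n *v ell n + Lz \<phi> g (z n) (l n)" by simp
    moreover have "Lz \<phi> g (?z n) (l n + \<alpha> n *\<^sub>R dl n) = Lz \<phi> g (?z n) (l n) + \<alpha> n *\<^sub>R (nabla_g g (?z n) *v dl n)"
      using Lz_diff[of "?z n" "l n + \<alpha> n *\<^sub>R dl n" "l n"] by (simp add: matrix_vector_mult_scaleR diff_eq_eq)
    ultimately have "?X n = ?Y n"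
      by (simp add: r_f_def matrix_vector_mult_scaleR matrix_vector_mult_diff_distrib matrix_vector_mult_diff_rdistrib
          matrix_vector_mult_add_rdistrib algebra_simps)
    then show ?case by simp
  qed
  ultimately show ?thesis by (rule lesssim_norm_le)
qed

end

section \<open>Nonnegativity along the step and the deficit of the maximal step length\<close>

lemma nonneg_step_shrinking:
  fixes x dx X :: "nat \<Rightarrow> real"
  assumes "c > 0" "\<forall>\<^sub>F n in sequentially. c * X n \<le> x n" "\<And>n. 0 < X n"
    "(\<lambda>n. x n + dx n) \<preceq> (\<lambda>n. X n * (m n + r n))"
  shows "\<exists>K. \<forall>\<^sub>F n in sequentially. \<forall>\<alpha>. 0 \<le> \<alpha> \<longrightarrow> \<alpha> \<le> 1 \<longrightarrow> K * (m n + r n) \<le> 1 - \<alpha> \<longrightarrow> 0 \<le> x n + \<alpha> * dx n"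
proof -
  obtain K where K: "K > 0" "\<forall>\<^sub>F n in sequentially. norm (x n + dx n) \<le> K * \<bar>X n * (m n + r n)\<bar>"
    using assms(4) by (rule lesssimE)
  from assms(2) K(2) have "\<forall>\<^sub>F n in sequentially. \<forall>\<alpha>. 0 \<le> \<alpha> \<longrightarrow> \<alpha> \<le> 1 \<longrightarrow> K / c * (m n + r n) \<le> 1 - \<alpha> \<longrightarrow> 0 \<le> x n + \<alpha> * dx n"
  proof eventually_elim
    case (elim n)
    show ?case
    proof (intro allI impI)
      fix \<alpha> :: real assume \<alpha>: "0 \<le> \<alpha>" "\<alpha> \<le> 1" "K / c * (m n + r n) \<le> 1 - \<alpha>"
      \<comment> \<open>The new value is \<open>(1 - \<alpha>) * x + \<alpha> * (x + dx)\<close>.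
        The possibly negative second part is dominated by the first as soon as
        \<open>1 - \<alpha>\<close> exceeds \<open>K / c * (m + r)\<close>.\<close>
      have "\<bar>\<alpha> * (x n + dx n)\<bar> \<le> \<bar>x n + dx n\<bar>"
        using \<alpha>(1,2) by (simp add: abs_mult mult_left_le_one_le)
      also have "\<dots> \<le> K * (X n * (m n + r n))" using elim(2) assms(3)[of n] by (simp add: abs_mult)
      also have "\<dots> = (K / c * (m n + r n)) * (c * X n)" using assms(1) by simp
      also have "\<dots> \<le> (1 - \<alpha>) * x n"
        using \<alpha> elim(1) assms(1) assms(3)[of n] by (intro mult_mono) auto
      finally show "0 \<le> x n + \<alpha> * dx n" by (simp add: algebra_simps abs_le_iff)
    qed
  qed
  then show ?thesis ..
qed

lemma nonneg_step_bounded: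
  fixes x dx :: "nat \<Rightarrow> real"
  assumes "c > 0" "\<forall>\<^sub>F n in sequentially. c \<le> x n" "dx \<preceq> Y" "Y \<longlonglongrightarrow> 0"
  shows "\<exists>K. \<forall>\<^sub>F n in sequentially. \<forall>\<alpha>. 0 \<le> \<alpha> \<longrightarrow> \<alpha> \<le> 1 \<longrightarrow> K * (m n + r n) \<le> 1 - \<alpha> \<longrightarrow> 0 \<le> x n + \<alpha> * dx n"
proof -
  have "(\<lambda>n. \<bar>dx n\<bar>) \<longlonglongrightarrow> 0" using tendsto_rabs[OF lesssim_tendsto_zero[OF assms(3,4)]] by simp
  then have "\<forall>\<^sub>F n in sequentially. \<bar>dx n\<bar> < c" using assms(1) by (rule order_tendstoD)
  \<comment> \<open>The component stays above \<open>c\<close> while its step tends to zero, so the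
    full step is safe and the factor 0 works.\<close>
  with assms(2) have "\<forall>\<^sub>F n in sequentially. \<forall>\<alpha>. 0 \<le> \<alpha> \<longrightarrow> \<alpha> \<le> 1 \<longrightarrow> 0 * (m n + r n) \<le> 1 - \<alpha> \<longrightarrow> 0 \<le> x n + \<alpha> * dx n"
  proof eventually_elim
    case (elim n)
    show ?case
    proof (intro allI impI)
      fix \<alpha> :: real assume \<alpha>: "0 \<le> \<alpha>" "\<alpha> \<le> 1"
      have "\<bar>\<alpha> * dx n\<bar> \<le> \<bar>dx n\<bar>"
        using \<alpha>(1,2) by (simp add: abs_mult mult_left_le_one_le)
      then show "0 \<le> x n + \<alpha> * dx n" using elim by linarith
    qed
  qed
  then show ?thesis ..
qed

lemma m_plus_r_lim: "(\<lambda>n. m n + r n) \<longlonglongrightarrow> 0"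
  using tendsto_add[OF m_lim r_lim] by simp

lemma nonneg_step:
  "\<exists>K. \<forall>\<^sub>F n in sequentially. \<forall>\<alpha>. 0 \<le> \<alpha> \<longrightarrow> \<alpha> \<le> 1 \<longrightarrow> K * (m n + r n) \<le> 1 - \<alpha> \<longrightarrow> 0 \<le> l n $ i + \<alpha> * dl n $ i"
  "\<exists>K. \<forall>\<^sub>F n in sequentially. \<forall>\<alpha>. 0 \<le> \<alpha> \<longrightarrow> \<alpha> \<le> 1 \<longrightarrow> K * (m n + r n) \<le> 1 - \<alpha> \<longrightarrow> 0 \<le> s n $ i + \<alpha> * ds n $ i"
proof -
  show "\<exists>K. \<forall>\<^sub>F n in sequentially. \<forall>\<alpha>. 0 \<le> \<alpha> \<longrightarrow> \<alpha> \<le> 1 \<longrightarrow> K * (m n + r n) \<le> 1 - \<alpha> \<longrightarrow> 0 \<le> l n $ i + \<alpha> * dl n $ i"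
  proof (cases "i \<in> B")
    case True
    obtain c where c: "c > 0" "\<forall>\<^sub>F n in sequentially. c \<le> l n $ i" using active_l_bounded_below[OF True] .
    show ?thesis by (rule nonneg_step_bounded[OF c dl_active[OF True] m_plus_r_lim])
  next
    case False
    obtain c where c: "c > 0" "\<forall>\<^sub>F n in sequentially. c * m n \<le> l n $ i" by (rule l_bounded_below)
    show ?thesis
      by (rule nonneg_step_shrinking[OF c]) (use le_U(2)[OF dl_inactive[OF False]] in \<open>auto simp: U_eq\<close>)
  qed
  show "\<exists>K. \<forall>\<^sub>F n in sequentially. \<forall>\<alpha>. 0 \<le> \<alpha> \<longrightarrow> \<alpha> \<le> 1 \<longrightarrow> K * (m n + r n) \<le> 1 - \<alpha> \<longrightarrow> 0 \<le> s n $ i + \<alpha> * ds n $ i"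
  proof (cases "i \<in> B")
    case True
    obtain c where c: "c > 0" "\<forall>\<^sub>F n in sequentially. c * m n \<le> s n $ i" by (rule s_bounded_below)
    show ?thesis
      by (rule nonneg_step_shrinking[OF c]) (use ds_active[OF True] in \<open>auto simp: U_eq\<close>)
  next
    case False
    obtain c where c: "c > 0" "\<forall>\<^sub>F n in sequentially. c \<le> s n $ i" using inactive_s_bounded_below[OF False] .
    show ?thesis by (rule nonneg_step_bounded[OF c lesssim_nth[OF ds_order] m_lim])
  qed
qed

lemma max_step_order: "(\<lambda>n. 1 - max_step (l n) (s n) (dl n) (ds n)) \<preceq> (\<lambda>n. r n + m n)"
proof -
  have "\<forall>i. \<exists>K. \<forall>\<^sub>F n in sequentially. \<forall>\<alpha>. 0 \<le> \<alpha> \<longrightarrow> \<alpha> \<le> 1 \<longrightarrow> K * (m n + r n) \<le> 1 - \<alpha> \<longrightarrow> 0 \<le> l n $ i + \<alpha> * dl n $ i"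
    using nonneg_step(1) by blast
  from choice[OF this] obtain K1 where K1: "\<forall>i. \<forall>\<^sub>F n in sequentially. \<forall>\<alpha>. 0 \<le> \<alpha> \<longrightarrow> \<alpha> \<le> 1 \<longrightarrow> K1 i * (m n + r n) \<le> 1 - \<alpha> \<longrightarrow> 0 \<le> l n $ i + \<alpha> * dl n $ i" ..
  have "\<forall>i. \<exists>K. \<forall>\<^sub>F n in sequentially. \<forall>\<alpha>. 0 \<le> \<alpha> \<longrightarrow> \<alpha> \<le> 1 \<longrightarrow> K * (m n + r n) \<le> 1 - \<alpha> \<longrightarrow> 0 \<le> s n $ i + \<alpha> * ds n $ i"
    using nonneg_step(2) by blast
  from choice[OF this] obtain K2 where K2: "\<forall>i. \<forall>\<^sub>F n in sequentially. \<forall>\<alpha>. 0 \<le> \<alpha> \<longrightarrow> \<alpha> \<le> 1 \<longrightarrow> K2 i * (m n + r n) \<le> 1 - \<alpha> \<longrightarrow> 0 \<le> s n $ i + \<alpha> * ds n $ i" ..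
  \<comment> \<open>Dominates all componentwise factors; the summand 1 makes it positive for the
    division below.\<close>
  define K where "K = 1 + (\<Sum>i\<in>UNIV. \<bar>K1 i\<bar> + \<bar>K2 i\<bar>)"
  have K: "K > 0" using sum_nonneg[of UNIV "\<lambda>i. \<bar>K1 i\<bar> + \<bar>K2 i\<bar>"] unfolding K_def by simp
  have Ki: "K1 i \<le> K" "K2 i \<le> K" for i
    using member_le_sum[of i UNIV "\<lambda>i. \<bar>K1 i\<bar> + \<bar>K2 i\<bar>"] by (auto simp: K_def)
  have mr: "0 \<le> m n + r n" for n by simp
  have "\<forall>\<^sub>F n in sequentially. \<forall>i. \<forall>\<alpha>. 0 \<le> \<alpha> \<longrightarrow> \<alpha> \<le> 1 \<longrightarrow> K * (m n + r n) \<le> 1 - \<alpha> \<longrightarrow>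
      0 \<le> l n $ i + \<alpha> * dl n $ i \<and> 0 \<le> s n $ i + \<alpha> * ds n $ i"
  proof (rule eventually_all_finite)
    fix i
    show "\<forall>\<^sub>F n in sequentially. \<forall>\<alpha>. 0 \<le> \<alpha> \<longrightarrow> \<alpha> \<le> 1 \<longrightarrow> K * (m n + r n) \<le> 1 - \<alpha> \<longrightarrow>
      0 \<le> l n $ i + \<alpha> * dl n $ i \<and> 0 \<le> s n $ i + \<alpha> * ds n $ i"
      using K1[rule_format, of i] K2[rule_format, of i]
    proof eventually_elim
      case (elim n)
      have "K1 i * (m n + r n) \<le> K * (m n + r n)" "K2 i * (m n + r n) \<le> K * (m n + r n)"
        using Ki mr by (auto intro!: mult_right_mono)
      then show ?case using elim by (meson order_trans)
    qed
  qed
  \<comment> \<open>Ensures that the candidate step length \<open>1 - K * (m + r)\<close> lies in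
    the unit interval.\<close>
  moreover have "\<forall>\<^sub>F n in sequentially. m n + r n < 1 / K"
    using m_plus_r_lim by (rule order_tendstoD) (use K in simp)
  ultimately have "\<forall>\<^sub>F n in sequentially. norm (1 - max_step (l n) (s n) (dl n) (ds n)) \<le> K * (r n + m n)"
  proof eventually_elim
    case (elim n)
    define a where "a = 1 - K * (m n + r n)"
    have "0 \<le> K * (m n + r n)" using K mr[of n] by (intro mult_nonneg_nonneg) auto
    moreover have "K * (m n + r n) \<le> 1" using elim(2) K by (simp add: field_simps)
    ultimately have a: "0 \<le> a" "a \<le> 1" by (auto simp: a_def)
    have "0 \<le> l n $ i + \<alpha> * dl n $ i \<and> 0 \<le> s n $ i + \<alpha> * ds n $ i" if "0 \<le> \<alpha>" "\<alpha> \<le> a" for \<alpha> i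
    proof -
      have "\<alpha> \<le> 1" "K * (m n + r n) \<le> 1 - \<alpha>" using that(2) a(2) unfolding a_def by linarith+
      then show ?thesis using elim(1) that(1) by blast
    qed
    then have "a \<le> max_step (l n) (s n) (dl n) (ds n)" "max_step (l n) (s n) (dl n) (ds n) \<le> 1"
      using pos a by (auto intro!: max_step_bounds simp: less_imp_le)
    then show ?case by (simp add: a_def add.commute)
  qed
  then show ?thesis by (rule lesssimI)
qed

end

section \<open>Uniformity of the constants\<close>

definition admissible ::
  "(real^'n \<Rightarrow> real) \<Rightarrow> (real^'n \<Rightarrow> real^'m) \<Rightarrow> real^'n \<Rightarrow> real \<Rightarrow> real \<Rightarrow> real \<Rightarrow> real \<Rightarrow> real \<Rightarrow>
   real \<Rightarrow> real^'n \<Rightarrow> real^'m \<Rightarrow> real^'m \<Rightarrow> real^'m \<Rightarrow> real^'n \<Rightarrow> real^'m \<Rightarrow> real^'m \<Rightarrow> bool" where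
  "admissible \<phi> g zs C \<gamma> Ct K \<epsilon> u z l s t dz dl ds \<longleftrightarrow>
     0 < u \<and> iterate_conditions \<phi> g C \<gamma> Ct z l s t \<and>
     sol_dist \<phi> g zs z l \<le> \<epsilon> \<and> mu l s \<le> \<epsilon> \<and> u / mu l s \<le> \<epsilon> \<and> u \<le> \<epsilon> \<and>
     (\<exists>Fl fl. fp_model u Fl fl \<and> computed_step \<phi> g zs K u Fl fl z l s t dz dl ds)"

definition step_estimates ::
  "(real^'n \<Rightarrow> real) \<Rightarrow> (real^'n \<Rightarrow> real^'m) \<Rightarrow> real \<Rightarrow> real \<Rightarrow>
   real^'n \<Rightarrow> real^'m \<Rightarrow> real^'m \<Rightarrow> real^'n \<Rightarrow> real^'m \<Rightarrow> real^'m \<Rightarrow> real \<Rightarrow> bool" where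
  "step_estimates \<phi> g K' u z l s dz dl ds \<alpha> \<longleftrightarrow>
     \<bar>1 - max_step l s dl ds\<bar> \<le> K' * (u / mu l s) + K' * mu l s \<and>
     (\<forall>i. \<bar>(l $ i + \<alpha> * dl $ i) * (s $ i + \<alpha> * ds $ i) - (1 - \<alpha>) * (l $ i * s $ i)\<bar>
            \<le> K' * u + K' * (mu l s)\<^sup>2) \<and>
     \<bar>mu (l + \<alpha> *\<^sub>R dl) (s + \<alpha> *\<^sub>R ds) - (1 - \<alpha>) * mu l s\<bar>
       \<le> K' * u + K' * (mu l s)\<^sup>2 \<and>
     norm (r_f \<phi> g (z + \<alpha> *\<^sub>R dz) (l + \<alpha> *\<^sub>R dl) - (1 - \<alpha>) *\<^sub>R r_f \<phi> g z l)
       \<le> K' * u + K' * (mu l s)\<^sup>2 \<and>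
     norm (r_g g (z + \<alpha> *\<^sub>R dz) (s + \<alpha> *\<^sub>R ds) - (1 - \<alpha>) *\<^sub>R r_g g z s)
       \<le> K' * u + K' * (mu l s)\<^sup>2"

text \<open>The growing factor eventually exceeds any hidden constant; it is the factor that a
  sequence of violating instances is required to beat.\<close>

lemma lesssim_eventually_Suc:
  assumes "X \<preceq> Y" "\<And>n. 0 \<le> Y n"
  shows "\<forall>\<^sub>F n in sequentially. norm (X n) \<le> real (Suc n) * Y n"
proof -
  obtain K where K: "\<forall>\<^sub>F n in sequentially. norm (X n) \<le> K * \<bar>Y n\<bar>" using assms(1) by (rule lesssimE)
  have "\<forall>\<^sub>F n in sequentially. K \<le> real n"
    using filterlim_real_sequentially by (simp add: filterlim_at_top)
  with K show ?thesis
  proof eventually_elim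
    case (elim n)
    have "K * Y n \<le> real (Suc n) * Y n" using elim(2) assms(2)[of n] by (intro mult_right_mono) auto
    then show ?case using elim(1) assms(2)[of n] by simp
  qed
qed

lemma (in approx_step) eventually_step_estimates:
  assumes "\<And>n. 0 \<le> \<alpha> n" "\<And>n. \<alpha> n \<le> 1"
  shows "\<forall>\<^sub>F n in sequentially. step_estimates \<phi> g (real (Suc n)) (u n) (z n) (l n) (s n) (dz n) (dl n) (ds n) (\<alpha> n)"
proof -
  have "\<forall>\<^sub>F n in sequentially. \<forall>i. norm ((l n $ i + \<alpha> n * dl n $ i) * (s n $ i + \<alpha> n * ds n $ i) - (1 - \<alpha> n) * (l n $ i * s n $ i))
      \<le> real (Suc n) * U n"
    by (intro eventually_all_finite lesssim_eventually_Suc product_step assms U_nonneg)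
  moreover have "\<forall>\<^sub>F n in sequentially. norm (1 - max_step (l n) (s n) (dl n) (ds n)) \<le> real (Suc n) * (r n + m n)"
    by (rule lesssim_eventually_Suc[OF max_step_order]) simp
  moreover note lesssim_eventually_Suc[OF mu_step[of \<alpha>, OF assms] U_nonneg]
    lesssim_eventually_Suc[OF r_f_step[of \<alpha>, OF assms] U_nonneg]
    lesssim_eventually_Suc[OF r_g_step[of \<alpha>, OF assms] U_nonneg]
  ultimately show ?thesis
  proof eventually_elim
    case (elim n)
    then show ?case
      unfolding step_estimates_def distrib_left[symmetric] m_def r_def real_norm_def by blast
  qed
qed

text \<open>Threshold \<open>1 / (N + 1)\<close> and constant \<open>N + 1\<close> are tied to one
  index, so that a failure for every \<open>N\<close> yields a single sequence along which the
  limits hold and yet each estimate with factor \<open>N + 1\<close> is violated in some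
  part.\<close>

lemma uniform_step_estimates:
  fixes \<phi> :: "real^'n \<Rightarrow> real" and g :: "real^'n \<Rightarrow> real^'m"
  assumes smooth: "twice_lipschitz_differentiable \<phi>" "\<And>i. twice_lipschitz_differentiable (\<lambda>z. g z $ i)"
    and sol: "solution_conditions \<phi> g zs" and \<gamma>: "0 < \<gamma>" and K: "0 < K"
  shows "\<exists>N. \<forall>u z l s t dz dl ds \<alpha>.
    admissible \<phi> g zs C \<gamma> Ct K (inverse (real (Suc N))) u z l s t dz dl ds \<longrightarrow> 0 \<le> \<alpha> \<longrightarrow> \<alpha> \<le> 1 \<longrightarrow>
    step_estimates \<phi> g (real (Suc N)) u z l s dz dl ds \<alpha>"
proof (rule ccontr)
  define bad where "bad N = (\<lambda>(u, z, l, s, t, dz, dl, ds, \<alpha>).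
    admissible \<phi> g zs C \<gamma> Ct K (inverse (real (Suc N))) u z l s t dz dl ds \<and> 0 \<le> \<alpha> \<and> \<alpha> \<le> 1 \<and>
    \<not> step_estimates \<phi> g (real (Suc N)) u z l s dz dl ds \<alpha>)" for N
  assume "\<not> ?thesis"
  then have "\<forall>N. \<exists>x. bad N x" unfolding bad_def by fastforce
  from choice[OF this] obtain x where x: "\<forall>N. bad N (x N)" ..
  define u where "u N = fst (x N)" for N
  define z where "z N = fst (snd (x N))" for N
  define l where "l N = fst (snd (snd (x N)))" for N
  define s where "s N = fst (snd (snd (snd (x N))))" for N
  define t where "t N = fst (snd (snd (snd (snd (x N)))))" for N
  define dz where "dz N = fst (snd (snd (snd (snd (snd (x N))))))" for N
  define dl where "dl N = fst (snd (snd (snd (snd (snd (snd (x N)))))))" for N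
  define ds where "ds N = fst (snd (snd (snd (snd (snd (snd (snd (x N))))))))" for N
  define \<alpha> where "\<alpha> N = snd (snd (snd (snd (snd (snd (snd (snd (x N))))))))" for N
  have bad: "admissible \<phi> g zs C \<gamma> Ct K (inverse (real (Suc N))) (u N) (z N) (l N) (s N) (t N) (dz N) (dl N) (ds N)"
    "0 \<le> \<alpha> N" "\<alpha> N \<le> 1"
    "\<not> step_estimates \<phi> g (real (Suc N)) (u N) (z N) (l N) (s N) (dz N) (dl N) (ds N) (\<alpha> N)" for N
    using x[rule_format, of N]
    unfolding bad_def u_def z_def l_def s_def t_def dz_def dl_def ds_def \<alpha>_def by (simp_all add: case_prod_unfold)
  have small: "0 < u N" "sol_dist \<phi> g zs (z N) (l N) \<le> inverse (real (Suc N))" "mu (l N) (s N) \<le> inverse (real (Suc N))"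
    "u N / mu (l N) (s N) \<le> inverse (real (Suc N))" "u N \<le> inverse (real (Suc N))" for N
    using bad(1)[of N] by (auto simp: admissible_def)
  have iter: "norm (Lz \<phi> g (z N) (l N)) \<le> C * mu (l N) (s N)" "norm (g (z N) + s N) \<le> C * mu (l N) (s N)"
    "0 < l N $ i" "0 < s N $ i" "\<gamma> * mu (l N) (s N) \<le> l N $ i * s N $ i" "norm (t N) \<le> Ct * (mu (l N) (s N))\<^sup>2" for N i
    using bad(1)[of N] by (auto simp: admissible_def iterate_conditions_def)
  have mu_pos: "0 < mu (l N) (s N)" for N
    unfolding mu_def inner_vec_def using iter(3,4) by (auto intro!: divide_pos_pos sum_pos)
  have lim: "f \<longlonglongrightarrow> 0" if "\<And>N. 0 \<le> f N" "\<And>N. f N \<le> inverse (real (Suc N))" for f :: "nat \<Rightarrow> real"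
    by (rule tendsto_sandwich[OF _ _ tendsto_const LIMSEQ_inverse_real_of_nat]) (use that in auto)
  have le1: "inverse (real (Suc N)) \<le> 1" for N by (simp add: inverse_le_1_iff)
  define Kr :: real where "Kr = 15 + 8 * ((2 * 2 ^ CARD('n) + 1) * CARD('n))"
  \<comment> \<open>The floating-point system may change with the index; \<open>Kr\<close> depends
    only on the dimension, so the rounding bounds are uniform along the sequence.\<close>
  have "\<forall>N. \<exists>y. case y of (Fm, \<rho>, J, b, h) \<Rightarrow>
      step_data \<phi> g zs K Kr (u N) (z N) (l N) (s N) (t N) (dz N) (dl N) (ds N) Fm \<rho> J b h"
  proof
    fix N
    obtain Fl fl where "fp_model (u N) Fl fl"
      "computed_step \<phi> g zs K (u N) Fl fl (z N) (l N) (s N) (t N) (dz N) (dl N) (ds N)"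
      using bad(1)[of N] by (auto simp: admissible_def)
    then obtain Fm \<rho> J b h where
      "step_data \<phi> g zs K Kr (u N) (z N) (l N) (s N) (t N) (dz N) (dl N) (ds N) Fm \<rho> J b h"
      using computed_step_imp_step_data[of \<phi> g zs K "u N" Fl fl "z N" "l N"] iter(3)[of N]
        order_trans[OF small(5) le1, of N] small(1)[of N] unfolding Kr_def by (meson less_imp_le)
    then show "\<exists>y. case y of (Fm, \<rho>, J, b, h) \<Rightarrow>
      step_data \<phi> g zs K Kr (u N) (z N) (l N) (s N) (t N) (dz N) (dl N) (ds N) Fm \<rho> J b h"
      by (intro exI[of _ "(Fm, \<rho>, J, b, h)"]) simp
  qed
  from choice[OF this] obtain y where y: "\<forall>N. case y N of (Fm, \<rho>, J, b, h) \<Rightarrow>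
      step_data \<phi> g zs K Kr (u N) (z N) (l N) (s N) (t N) (dz N) (dl N) (ds N) Fm \<rho> J b h" ..
  define Fm where "Fm N = fst (y N)" for N
  define \<rho> where "\<rho> N = fst (snd (y N))" for N
  define J where "J N = fst (snd (snd (y N)))" for N
  define b where "b N = fst (snd (snd (snd (y N))))" for N
  define h where "h N = snd (snd (snd (snd (y N))))" for N
  have data: "step_data \<phi> g zs K Kr (u N) (z N) (l N) (s N) (t N) (dz N) (dl N) (ds N) (Fm N) (\<rho> N) (J N) (b N) (h N)" for N
    using y[rule_format, of N] unfolding Fm_def \<rho>_def J_def b_def h_def by (simp add: case_prod_unfold)
  interpret approx_step \<phi> g zs C \<gamma> z l s Kr u t b h dl ds dz \<rho> Fm J
  proof unfold_locales
    show "(\<lambda>n. sol_dist \<phi> g zs (z n) (l n)) \<longlonglongrightarrow> 0"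
      by (rule lim) (use small(2) in \<open>auto simp: sol_dist_def infdist_nonneg\<close>)
    show "(\<lambda>n. mu (l n) (s n)) \<longlonglongrightarrow> 0"
      by (rule lim) (use small(3) mu_pos in \<open>auto simp: less_imp_le\<close>)
    show "(\<lambda>n. u n / mu (l n) (s n)) \<longlonglongrightarrow> 0"
      by (rule lim) (use small(1,4) mu_pos in \<open>auto simp: less_imp_le\<close>)
    show "t \<preceq> (\<lambda>n. (mu (l n) (s n))\<^sup>2)"
      by (rule lesssimI[of _ Ct]) (use iter(6) in auto)
    show "Fm \<preceq> (\<lambda>n. u n / mu (l n) (s n))"
    proof (rule lesssimI[of _ "2 * K"], rule always_eventually, rule allI)
      fix N
      \<comment> \<open>With mu at most 1, the Hessian perturbation of size \<open>u\<close> is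
        dominated by the solver perturbation of size u/mu.\<close>
      have "mu (l N) (s N) \<le> 1" using order_trans[OF small(3) le1] .
      then have "u N \<le> u N / mu (l N) (s N)"
        using mu_pos[of N] small(1)[of N] by (simp add: field_simps)
      then have "K * u N \<le> K * (u N / mu (l N) (s N))" using K by (intro mult_left_mono) auto
      then show "norm (Fm N) \<le> 2 * K * (u N / mu (l N) (s N))"
        using data[of N] unfolding step_data_def by linarith
    qed
    show "\<rho> \<preceq> u" by (rule lesssimI[of _ "2 * K"]) (use data in \<open>auto simp: step_data_def\<close>)
    show "(\<lambda>n. J n - nabla_g g (z n)) \<preceq> u" "(\<lambda>n. b n - g (z n)) \<preceq> u"
      by (rule lesssimI[of _ K]; use data in \<open>auto simp: step_data_def\<close>)+
    show "(\<lambda>n. h n $ i - s n $ i / l n $ i) \<preceq> (\<lambda>n. mu (l n) (s n) * u n)" if "i \<in> active g zs" for i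
      by (rule lesssimI[of _ K]) (use data that in \<open>auto simp: step_data_def\<close>)
    show "(\<lambda>n. h n $ i - s n $ i / l n $ i) \<preceq> (\<lambda>n. u n / mu (l n) (s n))" if "i \<notin> active g zs" for i
    proof (rule lesssimI[of _ K], rule always_eventually, rule allI)
      show "norm (h n $ i - s n $ i / l n $ i) \<le> K * (u n / mu (l n) (s n))" for n
        using data[of n] that unfolding step_data_def real_norm_def by blast
    qed
  qed (use smooth sol \<gamma> iter small(1) data in \<open>auto simp: step_data_def\<close>)
  \<comment> \<open>The estimates with factor \<open>Suc N\<close> hold from some index on, whereas
    every member of the sequence was chosen to violate them.\<close>
  have "\<forall>\<^sub>F N in sequentially. False"
    using eventually_step_estimates[of \<alpha>] bad(2,3,4) by (simp add: eventually_mono)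
  then show False by simp
qed

theorem mainTheorem6:
  fixes \<phi> :: "real^'n \<Rightarrow> real" and g :: "real^'n \<Rightarrow> real^'m" and zs :: "real^'n"
    and C \<gamma> Ct K :: real
  assumes "twice_lipschitz_differentiable \<phi>"
    and "\<And>i. twice_lipschitz_differentiable (\<lambda>z. g z $ i)"
    and "solution_conditions \<phi> g zs"
    and "0 < C" and "0 < \<gamma>" and "\<gamma> < 1" and "0 < Ct" and "0 < K"
  shows "\<exists>\<epsilon>>0. \<exists>\<eta>>0. \<exists>\<beta>\<^sub>0>0. \<exists>K'>0.
    \<forall>(\<beta>::real) (u::real) Fl fl r Q \<Sigma> P z l s t dz dl ds.
      0 < u \<and> fp_model u Fl fl \<and> is_svd g zs r Q \<Sigma> P \<and>
      iterate_conditions \<phi> g C \<gamma> Ct z l s t \<and>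
      \<beta>\<^sub>0 \<le> \<beta> \<and> conditioning \<phi> g zs r Q \<Sigma> \<beta> u (mu l s) \<and>
      sol_dist \<phi> g zs z l \<le> \<epsilon> \<and> mu l s \<le> \<epsilon> \<and> u / mu l s \<le> \<eta> \<and> u \<le> \<eta> \<and>
      computed_step \<phi> g zs K u Fl fl z l s t dz dl ds
      \<longrightarrow>
      \<bar>1 - max_step l s dl ds\<bar> \<le> K' * (u / mu l s) + K' * mu l s \<and>
      (\<forall>\<alpha>\<in>{0..1}.
        (\<forall>i. \<bar>(l $ i + \<alpha> * dl $ i) * (s $ i + \<alpha> * ds $ i) - (1 - \<alpha>) * (l $ i * s $ i)\<bar>
               \<le> K' * u + K' * (mu l s)\<^sup>2) \<and>
        \<bar>mu (l + \<alpha> *\<^sub>R dl) (s + \<alpha> *\<^sub>R ds) - (1 - \<alpha>) * mu l s\<bar>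
          \<le> K' * u + K' * (mu l s)\<^sup>2 \<and>
        norm (r_f \<phi> g (z + \<alpha> *\<^sub>R dz) (l + \<alpha> *\<^sub>R dl) - (1 - \<alpha>) *\<^sub>R r_f \<phi> g z l)
          \<le> K' * u + K' * (mu l s)\<^sup>2 \<and>
        norm (r_g g (z + \<alpha> *\<^sub>R dz) (s + \<alpha> *\<^sub>R ds) - (1 - \<alpha>) *\<^sub>R r_g g z s)
          \<le> K' * u + K' * (mu l s)\<^sup>2)"
proof -
  obtain N where N: "\<forall>u z l s t dz dl ds \<alpha>.
      admissible \<phi> g zs C \<gamma> Ct K (inverse (real (Suc N))) u z l s t dz dl ds \<longrightarrow> 0 \<le> \<alpha> \<longrightarrow> \<alpha> \<le> 1 \<longrightarrow>
      step_estimates \<phi> g (real (Suc N)) u z l s dz dl ds \<alpha>"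
    using uniform_step_estimates[OF assms(1-3,5,8)] by blast
  \<comment> \<open>The index \<open>N\<close> supplies both thresholds as
    \<open>1 / (N + 1)\<close> and the common constant as \<open>N + 1\<close>.\<close>
  show ?thesis
  proof (rule exI[of _ "inverse (real (Suc N))"], rule conjI, simp,
      rule exI[of _ "inverse (real (Suc N))"], rule conjI, simp,
      rule exI[of _ 1], rule conjI, simp, rule exI[of _ "real (Suc N)"], rule conjI, simp,
      intro allI impI, goal_cases)
    case (1 \<beta> u Fl fl r Q \<Sigma> P z l s t dz dl ds)
    then have "admissible \<phi> g zs C \<gamma> Ct K (inverse (real (Suc N))) u z l s t dz dl ds"
      unfolding admissible_def by blast
    with N have est: "step_estimates \<phi> g (real (Suc N)) u z l s dz dl ds \<alpha>" if "\<alpha> \<in> {0..1}" for \<alpha>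
      using that unfolding atLeastAtMost_iff by blast
    show ?case
    proof (rule conjI, goal_cases)
      case 1
      \<comment> \<open>The bound on the maximal step does not involve \<alpha>; any admissible
        value, such as 0, extracts it.\<close>
      show ?case using est[of 0] unfolding step_estimates_def by simp
    next
      case 2
      show ?case using est unfolding step_estimates_def by blast
    qed
  qed
qed

end
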